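(* Let $\mathcal M$ be a complete and cocomplete pointed symmetric monoidal category in which the monoidal product commutes with colimits on both sides, and let $\mathcal O$ be a $\mathfrak C$-colored operad in $\mathcal M$. Then the adjunction $\mathrm{coker}:\overrightarrow{\mathcal M}^{\square}\rightleftarrows\overrightarrow{\mathcal M}^{\otimes}:\ker$ (left adjoint $\mathrm{coker}$) induces an adjunction $$\mathrm{coker}:\mathrm{Alg}(\overrightarrow{\mathcal O}^{\square};\overrightarrow{\mathcal M}^{\square})\rightleftarrows \mathrm{Alg}(\overrightarrow{\mathcal O}^{\otimes};\overrightarrow{\mathcal M}^{\otimes}):\ker$$ in which the left adjoint, the right adjoint, the unit, and the counit are defined entrywise.
   Context: A category is pointed if its initial object $\varnothing$ is isomorphic to its terminal object $*$. Arrow category. $\overrightarrow{\mathcal M}$ has as objects the morphisms $f:X_0\to X_1$ of $\mathcal M$ and as morphisms $\alpha=(\alpha_0,\alpha_1):f\to g$ the commutative squares $g\alpha_0=\alpha_1f$. $\overrightarrow{\mathcal M}^{\otimes}$ is $\overrightarrow{\mathcal M}$ with monoidal product $f\otimes g:X_0\otimes Y_0\to X_1\otimes Y_1$ and unit $\mathrm{Id}_{\mathbb 1}$. $\overrightarrow{\mathcal M}^{\square}$ is $\overrightarrow{\mathcal M}$ with the pushout product $f\square g:(X_0\otimes Y_1)\amalg_{X_0\otimes Y_0}(X_1\otimes Y_0)\to X_1\otimes Y_1$ and unit $\varnothing\to\mathbb 1$. The functors $L_0(X)=(\mathrm{Id}:X\to X)$ and $L_1(X)=(\varnothing\to X)$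 are strict symmetric monoidal functors $\mathcal M\to\overrightarrow{\mathcal M}^{\otimes}$ and $\mathcal M\to\overrightarrow{\mathcal M}^{\square}$. Operads. For a set $\mathfrak C$ of colors, a $\mathfrak C$-colored operad $\mathcal O$ is a colored symmetric operad with entries $\mathcal O\binom{d}{c_1,\dots,c_n}$ ($d,c_i\in\mathfrak C$, $n\ge0$). An algebra is a family $(A_c)_{c\in\mathfrak C}$ with structure maps $\mathcal O\binom{d}{c_1,\dots,c_n}\otimes A_{c_1}\otimes\cdots\otimes A_{c_n}\to A_d$ that are associative, unital and equivariant; $\mathrm{Alg}(\mathcal O;\mathcal M)$ is the category of algebras. Set $\overrightarrow{\mathcal O}^{\otimes}=L_0\mathcal O$ and $\overrightarrow{\mathcal O}^{\square}=L_1\mathcal O$ (applied entrywise), operads in $\overrightarrow{\mathcal M}^{\otimes}$ and $\overrightarrow{\mathcal M}^{\square}$. Cokernel and kernel. $\mathrm{coker}(f:X_0\to X_1)$ is the map $X_1\to X_1\amalg_{X_0}*$ and $\ker f$ is the map $X_0\times_{X_1}*\to X_0$. It is known that $\mathrm{coker}:\overrightarrow{\mathcal M}^{\square}\to\overrightarrow{\mathcal M}^{\otimes}$ is a strictly unital strong symmetric monoidal functor, left adjoint to $\ker$, which is thereby lax symmetric monoidal, with monoidal unit and counit. "Defined entrywise" means computed, for each color $c\in\mathfrak C$, by the functors, unit and counit of the adjunction between $\overrightarrow{\mathcal M}^{\square}$ and $\overrightarrow{\mathcal M}^{\otimes}$. *)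

theory Defs
  imports Main "HOL-Library.FuncSet" "HOL-Library.Infinite_Typeclass"
begin

section \<open>Categories, functors and adjunctions\<close>

record ('o, 'm) category =
  Obj :: "'o set"
  Arr :: "'m set"
  Dom :: "'m \<Rightarrow> 'o"
  Cod :: "'m \<Rightarrow> 'o"
  Ident :: "'o \<Rightarrow> 'm"
  Comp :: "'m \<Rightarrow> 'm \<Rightarrow> 'm"  (infixr "\<cdot>\<index>" 55)

definition hom :: "('o, 'm, 'z) category_scheme \<Rightarrow> 'o \<Rightarrow> 'o \<Rightarrow> 'm set" where
  "hom C a b = {f \<in> Arr C. Dom C f = a \<and> Cod C f = b}"

locale category =
  fixes C :: "('o, 'm, 'z) category_scheme" (structure)
  assumes dom_obj: "f \<in> Arr C \<Longrightarrow> Dom C f \<in> Obj C"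
    and cod_obj: "f \<in> Arr C \<Longrightarrow> Cod C f \<in> Obj C"
    and ident_hom: "a \<in> Obj C \<Longrightarrow> Ident C a \<in> hom C a a"
    and comp_hom: "\<lbrakk>f \<in> hom C a b; g \<in> hom C b c\<rbrakk> \<Longrightarrow> g \<cdot> f \<in> hom C a c"
    and comp_ident_right: "f \<in> hom C a b \<Longrightarrow> f \<cdot> Ident C a = f"
    and comp_ident_left: "f \<in> hom C a b \<Longrightarrow> Ident C b \<cdot> f = f"
    and comp_assoc: "\<lbrakk>f \<in> hom C a b; g \<in> hom C b c; h \<in> hom C c d\<rbrakk>
      \<Longrightarrow> (h \<cdot> g) \<cdot> f = h \<cdot> (g \<cdot> f)"

record ('o, 'm, 'p, 'n) fctr =
  Fo :: "'o \<Rightarrow> 'p"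
  Fa :: "'m \<Rightarrow> 'n"

locale is_functor = A: category A + B: category B
  for A :: "('o, 'm, 'y) category_scheme" and B :: "('p, 'n, 'z) category_scheme" +
  fixes F :: "('o, 'm, 'p, 'n, 'w) fctr_scheme"
  assumes obj_map: "a \<in> Obj A \<Longrightarrow> Fo F a \<in> Obj B"
    and hom_map: "f \<in> hom A a b \<Longrightarrow> Fa F f \<in> hom B (Fo F a) (Fo F b)"
    and ident_map: "a \<in> Obj A \<Longrightarrow> Fa F (Ident A a) = Ident B (Fo F a)"
    and comp_map: "\<lbrakk>f \<in> hom A a b; g \<in> hom A b c\<rbrakk>
      \<Longrightarrow> Fa F (g \<cdot>\<^bsub>A\<^esub> f) = Fa F g \<cdot>\<^bsub>B\<^esub> Fa F f"

definition inverse_arrows :: "('o, 'm, 'z) category_scheme \<Rightarrow> 'm \<Rightarrow> 'm \<Rightarrow> bool" where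
  "inverse_arrows C f g \<longleftrightarrow> f \<in> Arr C \<and> g \<in> hom C (Cod C f) (Dom C f) \<and>
     g \<cdot>\<^bsub>C\<^esub> f = Ident C (Dom C f) \<and> f \<cdot>\<^bsub>C\<^esub> g = Ident C (Cod C f)"

definition is_iso :: "('o, 'm, 'z) category_scheme \<Rightarrow> 'm \<Rightarrow> bool" where
  "is_iso C f \<longleftrightarrow> (\<exists>g. inverse_arrows C f g)"

definition inverse_of :: "('o, 'm, 'z) category_scheme \<Rightarrow> 'm \<Rightarrow> 'm" where
  "inverse_of C f = (THE g. inverse_arrows C f g)"

text \<open>An adjunction with left adjoint \<open>F\<close>, right adjoint \<open>G\<close>, unit \<open>\<eta>\<close> and counit \<open>\<epsilon>\<close>.\<close>

locale adjunction = F: is_functor A B F + G: is_functor B A G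
  for A :: "('o, 'm, 'y) category_scheme" and B :: "('p, 'n, 'z) category_scheme"
    and F :: "('o, 'm, 'p, 'n, 'v) fctr_scheme" and G :: "('p, 'n, 'o, 'm, 'w) fctr_scheme" +
  fixes \<eta> :: "'o \<Rightarrow> 'm" and \<epsilon> :: "'p \<Rightarrow> 'n"
  assumes unit_hom: "a \<in> Obj A \<Longrightarrow> \<eta> a \<in> hom A a (Fo G (Fo F a))"
    and unit_natural: "f \<in> hom A a a' \<Longrightarrow> \<eta> a' \<cdot>\<^bsub>A\<^esub> f = Fa G (Fa F f) \<cdot>\<^bsub>A\<^esub> \<eta> a"
    and counit_hom: "b \<in> Obj B \<Longrightarrow> \<epsilon> b \<in> hom B (Fo F (Fo G b)) b"
    and counit_natural: "g \<in> hom B b b' \<Longrightarrow> \<epsilon> b' \<cdot>\<^bsub>B\<^esub> Fa F (Fa G g) = g \<cdot>\<^bsub>B\<^esub> \<epsilon> b"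
    and triangle_left: "a \<in> Obj A \<Longrightarrow> \<epsilon> (Fo F a) \<cdot>\<^bsub>B\<^esub> Fa F (\<eta> a) = Ident B (Fo F a)"
    and triangle_right: "b \<in> Obj B \<Longrightarrow> Fa G (\<epsilon> b) \<cdot>\<^bsub>A\<^esub> \<eta> (Fo G b) = Ident A (Fo G b)"


section \<open>Limits and colimits\<close>

definition is_cone :: "('j, 'k, 'y) category_scheme \<Rightarrow> ('o, 'm, 'z) category_scheme \<Rightarrow>
    ('j, 'k, 'o, 'm, 'w) fctr_scheme \<Rightarrow> 'o \<Rightarrow> ('j \<Rightarrow> 'm) \<Rightarrow> bool" where
  "is_cone J C D L \<pi> \<longleftrightarrow> L \<in> Obj C \<and> (\<forall>j\<in>Obj J. \<pi> j \<in> hom C L (Fo D j)) \<and>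
     (\<forall>u\<in>Arr J. Fa D u \<cdot>\<^bsub>C\<^esub> \<pi> (Dom J u) = \<pi> (Cod J u))"

definition is_limit :: "('j, 'k, 'y) category_scheme \<Rightarrow> ('o, 'm, 'z) category_scheme \<Rightarrow>
    ('j, 'k, 'o, 'm, 'w) fctr_scheme \<Rightarrow> 'o \<Rightarrow> ('j \<Rightarrow> 'm) \<Rightarrow> bool" where
  "is_limit J C D L \<pi> \<longleftrightarrow> is_cone J C D L \<pi> \<and>
     (\<forall>L' \<pi>'. is_cone J C D L' \<pi>' \<longrightarrow>
       (\<exists>!m. m \<in> hom C L' L \<and> (\<forall>j\<in>Obj J. \<pi> j \<cdot>\<^bsub>C\<^esub> m = \<pi>' j)))"

definition is_cocone :: "('j, 'k, 'y) category_scheme \<Rightarrow> ('o, 'm, 'z) category_scheme \<Rightarrow>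
    ('j, 'k, 'o, 'm, 'w) fctr_scheme \<Rightarrow> 'o \<Rightarrow> ('j \<Rightarrow> 'm) \<Rightarrow> bool" where
  "is_cocone J C D K \<iota> \<longleftrightarrow> K \<in> Obj C \<and> (\<forall>j\<in>Obj J. \<iota> j \<in> hom C (Fo D j) K) \<and>
     (\<forall>u\<in>Arr J. \<iota> (Cod J u) \<cdot>\<^bsub>C\<^esub> Fa D u = \<iota> (Dom J u))"

definition is_colimit :: "('j, 'k, 'y) category_scheme \<Rightarrow> ('o, 'm, 'z) category_scheme \<Rightarrow>
    ('j, 'k, 'o, 'm, 'w) fctr_scheme \<Rightarrow> 'o \<Rightarrow> ('j \<Rightarrow> 'm) \<Rightarrow> bool" where
  "is_colimit J C D K \<iota> \<longleftrightarrow> is_cocone J C D K \<iota> \<and>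
     (\<forall>K' \<iota>'. is_cocone J C D K' \<iota>' \<longrightarrow>
       (\<exists>!m. m \<in> hom C K K' \<and> (\<forall>j\<in>Obj J. m \<cdot>\<^bsub>C\<^esub> \<iota> j = \<iota>' j)))"

text \<open>The type \<open>'i\<close> plays the role of the universe: a category is small if its objects and its
  arrows are elements of \<open>'i\<close>.  It is only ever used with \<open>'i\<close> infinite, so that all finite
  shapes are small.\<close>

definition complete_cat :: "'i itself \<Rightarrow> ('o, 'm, 'z) category_scheme \<Rightarrow> bool" where
  "complete_cat _ C \<longleftrightarrow>
     (\<forall>(J :: ('i, 'i) category) (D :: ('i, 'i, 'o, 'm) fctr).
        is_functor J C D \<longrightarrow> (\<exists>L \<pi>. is_limit J C D L \<pi>))"

definition cocomplete_cat :: "'i itself \<Rightarrow> ('o, 'm, 'z) category_scheme \<Rightarrow> bool" where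
  "cocomplete_cat _ C \<longleftrightarrow>
     (\<forall>(J :: ('i, 'i) category) (D :: ('i, 'i, 'o, 'm) fctr).
        is_functor J C D \<longrightarrow> (\<exists>K \<iota>. is_colimit J C D K \<iota>))"

definition preserves_colimits :: "'i itself \<Rightarrow> ('o, 'm, 'y) category_scheme \<Rightarrow>
    ('p, 'n, 'z) category_scheme \<Rightarrow> ('o, 'm, 'p, 'n, 'w) fctr_scheme \<Rightarrow> bool" where
  "preserves_colimits _ A B F \<longleftrightarrow>
     (\<forall>(J :: ('i, 'i) category) (D :: ('i, 'i, 'o, 'm) fctr) K \<iota>.
        is_functor J A D \<and> is_colimit J A D K \<iota> \<longrightarrow>
        is_colimit J B \<lparr>Fo = (\<lambda>j. Fo F (Fo D j)), Fa = (\<lambda>u. Fa F (Fa D u))\<rparr>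
          (Fo F K) (\<lambda>j. Fa F (\<iota> j)))"

definition is_initial :: "('o, 'm, 'z) category_scheme \<Rightarrow> 'o \<Rightarrow> bool" where
  "is_initial C a \<longleftrightarrow> a \<in> Obj C \<and> (\<forall>b\<in>Obj C. \<exists>!f. f \<in> hom C a b)"

definition is_terminal :: "('o, 'm, 'z) category_scheme \<Rightarrow> 'o \<Rightarrow> bool" where
  "is_terminal C b \<longleftrightarrow> b \<in> Obj C \<and> (\<forall>a\<in>Obj C. \<exists>!f. f \<in> hom C a b)"

definition pointed :: "('o, 'm, 'z) category_scheme \<Rightarrow> bool" where
  "pointed C \<longleftrightarrow> (\<exists>a b f. is_initial C a \<and> is_terminal C b \<and> f \<in> hom C a b \<and> is_iso C f)"

definition is_pushout :: "('o, 'm, 'z) category_scheme \<Rightarrow> 'm \<Rightarrow> 'm \<Rightarrow> 'm \<Rightarrow> 'm \<Rightarrow> bool" where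
  "is_pushout C f g p q \<longleftrightarrow>
     f \<in> Arr C \<and> g \<in> Arr C \<and> p \<in> Arr C \<and> q \<in> Arr C \<and>
     Dom C f = Dom C g \<and> Dom C p = Cod C f \<and> Dom C q = Cod C g \<and> Cod C p = Cod C q \<and>
     p \<cdot>\<^bsub>C\<^esub> f = q \<cdot>\<^bsub>C\<^esub> g \<and>
     (\<forall>z. \<forall>p'\<in>hom C (Cod C f) z. \<forall>q'\<in>hom C (Cod C g) z. p' \<cdot>\<^bsub>C\<^esub> f = q' \<cdot>\<^bsub>C\<^esub> g \<longrightarrow>
       (\<exists>!u. u \<in> hom C (Cod C p) z \<and> u \<cdot>\<^bsub>C\<^esub> p = p' \<and> u \<cdot>\<^bsub>C\<^esub> q = q'))"

definition is_pullback :: "('o, 'm, 'z) category_scheme \<Rightarrow> 'm \<Rightarrow> 'm \<Rightarrow> 'm \<Rightarrow> 'm \<Rightarrow> bool" where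
  "is_pullback C f g p q \<longleftrightarrow>
     f \<in> Arr C \<and> g \<in> Arr C \<and> p \<in> Arr C \<and> q \<in> Arr C \<and>
     Cod C f = Cod C g \<and> Cod C p = Dom C f \<and> Cod C q = Dom C g \<and> Dom C p = Dom C q \<and>
     f \<cdot>\<^bsub>C\<^esub> p = g \<cdot>\<^bsub>C\<^esub> q \<and>
     (\<forall>z. \<forall>p'\<in>hom C z (Dom C f). \<forall>q'\<in>hom C z (Dom C g). f \<cdot>\<^bsub>C\<^esub> p' = g \<cdot>\<^bsub>C\<^esub> q' \<longrightarrow>
       (\<exists>!u. u \<in> hom C z (Dom C p) \<and> p \<cdot>\<^bsub>C\<^esub> u = p' \<and> q \<cdot>\<^bsub>C\<^esub> u = q'))"

text \<open>Initial and terminal objects, pushouts and pullbacks are chosen once and for all.\<close>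

definition init_obj :: "('o, 'm, 'z) category_scheme \<Rightarrow> 'o" where
  "init_obj C = (SOME a. is_initial C a)"

definition term_obj :: "('o, 'm, 'z) category_scheme \<Rightarrow> 'o" where
  "term_obj C = (SOME a. is_terminal C a)"

text \<open>Only used when \<open>a\<close> is initial or \<open>b\<close> is terminal, and, in a pointed category, when \<open>a\<close> is
  terminal (hence initial too).\<close>

definition the_arr :: "('o, 'm, 'z) category_scheme \<Rightarrow> 'o \<Rightarrow> 'o \<Rightarrow> 'm" where
  "the_arr C a b = (THE f. f \<in> hom C a b)"

definition po_inl :: "('o, 'm, 'z) category_scheme \<Rightarrow> 'm \<Rightarrow> 'm \<Rightarrow> 'm" where
  "po_inl C f g = fst (SOME pq. is_pushout C f g (fst pq) (snd pq))"

definition po_inr :: "('o, 'm, 'z) category_scheme \<Rightarrow> 'm \<Rightarrow> 'm \<Rightarrow> 'm" where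
  "po_inr C f g = snd (SOME pq. is_pushout C f g (fst pq) (snd pq))"

definition po_obj :: "('o, 'm, 'z) category_scheme \<Rightarrow> 'm \<Rightarrow> 'm \<Rightarrow> 'o" where
  "po_obj C f g = Cod C (po_inl C f g)"

definition copair :: "('o, 'm, 'z) category_scheme \<Rightarrow> 'm \<Rightarrow> 'm \<Rightarrow> 'm \<Rightarrow> 'm \<Rightarrow> 'm" where
  "copair C f g p q = (THE u. u \<in> hom C (po_obj C f g) (Cod C p) \<and>
     u \<cdot>\<^bsub>C\<^esub> po_inl C f g = p \<and> u \<cdot>\<^bsub>C\<^esub> po_inr C f g = q)"

definition pb_fst :: "('o, 'm, 'z) category_scheme \<Rightarrow> 'm \<Rightarrow> 'm \<Rightarrow> 'm" where
  "pb_fst C f g = fst (SOME pq. is_pullback C f g (fst pq) (snd pq))"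

definition pb_snd :: "('o, 'm, 'z) category_scheme \<Rightarrow> 'm \<Rightarrow> 'm \<Rightarrow> 'm" where
  "pb_snd C f g = snd (SOME pq. is_pullback C f g (fst pq) (snd pq))"

definition pb_obj :: "('o, 'm, 'z) category_scheme \<Rightarrow> 'm \<Rightarrow> 'm \<Rightarrow> 'o" where
  "pb_obj C f g = Dom C (pb_fst C f g)"

definition pairing :: "('o, 'm, 'z) category_scheme \<Rightarrow> 'm \<Rightarrow> 'm \<Rightarrow> 'm \<Rightarrow> 'm \<Rightarrow> 'm" where
  "pairing C f g p q = (THE u. u \<in> hom C (Dom C p) (pb_obj C f g) \<and>
     pb_fst C f g \<cdot>\<^bsub>C\<^esub> u = p \<and> pb_snd C f g \<cdot>\<^bsub>C\<^esub> u = q)"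


section \<open>Symmetric monoidal categories\<close>

record ('o, 'm) monoidal = "('o, 'm) category" +
  Tensor_o :: "'o \<Rightarrow> 'o \<Rightarrow> 'o"  (infixr "\<otimes>\<^sub>o\<index>" 70)
  Tensor :: "'m \<Rightarrow> 'm \<Rightarrow> 'm"  (infixr "\<otimes>\<index>" 70)
  Unit :: 'o
  Assoc :: "'o \<Rightarrow> 'o \<Rightarrow> 'o \<Rightarrow> 'm"
  LUnit :: "'o \<Rightarrow> 'm"
  RUnit :: "'o \<Rightarrow> 'm"
  Sym :: "'o \<Rightarrow> 'o \<Rightarrow> 'm"

locale symmetric_monoidal = category M for M :: "('o, 'm, 'z) monoidal_scheme" (structure) +
  assumes tensor_obj: "\<lbrakk>a \<in> Obj M; b \<in> Obj M\<rbrakk> \<Longrightarrow> a \<otimes>\<^sub>o b \<in> Obj M"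
    and tensor_hom: "\<lbrakk>f \<in> hom M a a'; g \<in> hom M b b'\<rbrakk> \<Longrightarrow> f \<otimes> g \<in> hom M (a \<otimes>\<^sub>o b) (a' \<otimes>\<^sub>o b')"
    and tensor_ident: "\<lbrakk>a \<in> Obj M; b \<in> Obj M\<rbrakk> \<Longrightarrow> Ident M a \<otimes> Ident M b = Ident M (a \<otimes>\<^sub>o b)"
    and tensor_comp: "\<lbrakk>f \<in> hom M a a'; f' \<in> hom M a' a''; g \<in> hom M b b'; g' \<in> hom M b' b''\<rbrakk>
      \<Longrightarrow> (f' \<cdot> f) \<otimes> (g' \<cdot> g) = (f' \<otimes> g') \<cdot> (f \<otimes> g)"
    and unit_obj: "Unit M \<in> Obj M"
    and assoc_hom: "\<lbrakk>a \<in> Obj M; b \<in> Obj M; c \<in> Obj M\<rbrakk>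
      \<Longrightarrow> Assoc M a b c \<in> hom M ((a \<otimes>\<^sub>o b) \<otimes>\<^sub>o c) (a \<otimes>\<^sub>o (b \<otimes>\<^sub>o c))"
    and assoc_iso: "\<lbrakk>a \<in> Obj M; b \<in> Obj M; c \<in> Obj M\<rbrakk> \<Longrightarrow> is_iso M (Assoc M a b c)"
    and assoc_natural: "\<lbrakk>f \<in> hom M a a'; g \<in> hom M b b'; h \<in> hom M c c'\<rbrakk>
      \<Longrightarrow> Assoc M a' b' c' \<cdot> ((f \<otimes> g) \<otimes> h) = (f \<otimes> (g \<otimes> h)) \<cdot> Assoc M a b c"
    and lunit_hom: "a \<in> Obj M \<Longrightarrow> LUnit M a \<in> hom M (Unit M \<otimes>\<^sub>o a) a"
    and lunit_iso: "a \<in> Obj M \<Longrightarrow> is_iso M (LUnit M a)"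
    and lunit_natural: "f \<in> hom M a a' \<Longrightarrow> LUnit M a' \<cdot> (Ident M (Unit M) \<otimes> f) = f \<cdot> LUnit M a"
    and runit_hom: "a \<in> Obj M \<Longrightarrow> RUnit M a \<in> hom M (a \<otimes>\<^sub>o Unit M) a"
    and runit_iso: "a \<in> Obj M \<Longrightarrow> is_iso M (RUnit M a)"
    and runit_natural: "f \<in> hom M a a' \<Longrightarrow> RUnit M a' \<cdot> (f \<otimes> Ident M (Unit M)) = f \<cdot> RUnit M a"
    and sym_hom: "\<lbrakk>a \<in> Obj M; b \<in> Obj M\<rbrakk> \<Longrightarrow> Sym M a b \<in> hom M (a \<otimes>\<^sub>o b) (b \<otimes>\<^sub>o a)"
    and sym_natural: "\<lbrakk>f \<in> hom M a a'; g \<in> hom M b b'\<rbrakk>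
      \<Longrightarrow> Sym M a' b' \<cdot> (f \<otimes> g) = (g \<otimes> f) \<cdot> Sym M a b"
    and sym_sym: "\<lbrakk>a \<in> Obj M; b \<in> Obj M\<rbrakk> \<Longrightarrow> Sym M b a \<cdot> Sym M a b = Ident M (a \<otimes>\<^sub>o b)"
    and triangle: "\<lbrakk>a \<in> Obj M; b \<in> Obj M\<rbrakk>
      \<Longrightarrow> (Ident M a \<otimes> LUnit M b) \<cdot> Assoc M a (Unit M) b = RUnit M a \<otimes> Ident M b"
    and pentagon: "\<lbrakk>a \<in> Obj M; b \<in> Obj M; c \<in> Obj M; d \<in> Obj M\<rbrakk>
      \<Longrightarrow> Assoc M a b (c \<otimes>\<^sub>o d) \<cdot> Assoc M (a \<otimes>\<^sub>o b) c d =
        (Ident M a \<otimes> Assoc M b c d) \<cdot> Assoc M a (b \<otimes>\<^sub>o c) d \<cdot> (Assoc M a b c \<otimes> Ident M d)"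
    and hexagon: "\<lbrakk>a \<in> Obj M; b \<in> Obj M; c \<in> Obj M\<rbrakk>
      \<Longrightarrow> Assoc M b c a \<cdot> Sym M a (b \<otimes>\<^sub>o c) \<cdot> Assoc M a b c =
        (Ident M b \<otimes> Sym M a c) \<cdot> Assoc M b a c \<cdot> (Sym M a b \<otimes> Ident M c)"

definition tensor_left :: "('o, 'm, 'z) monoidal_scheme \<Rightarrow> 'o \<Rightarrow> ('o, 'm, 'o, 'm) fctr" where
  "tensor_left M x = \<lparr>Fo = (\<lambda>a. x \<otimes>\<^sub>o\<^bsub>M\<^esub> a), Fa = (\<lambda>f. Ident M x \<otimes>\<^bsub>M\<^esub> f)\<rparr>"

definition tensor_right :: "('o, 'm, 'z) monoidal_scheme \<Rightarrow> 'o \<Rightarrow> ('o, 'm, 'o, 'm) fctr" where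
  "tensor_right M x = \<lparr>Fo = (\<lambda>a. a \<otimes>\<^sub>o\<^bsub>M\<^esub> x), Fa = (\<lambda>f. f \<otimes>\<^bsub>M\<^esub> Ident M x)\<rparr>"

definition tensor_preserves_colimits :: "'i itself \<Rightarrow> ('o, 'm, 'z) monoidal_scheme \<Rightarrow> bool" where
  "tensor_preserves_colimits I M \<longleftrightarrow>
     (\<forall>x\<in>Obj M. preserves_colimits I M M (tensor_left M x) \<and>
                preserves_colimits I M M (tensor_right M x))"

text \<open>Iterated tensor products \<open>x\<^sub>1 \<otimes> (x\<^sub>2 \<otimes> (\<dots> \<otimes> (x\<^sub>n \<otimes> \<one>)))\<close> and the coherence isomorphisms
  between them that the axioms of operads and algebras refer to.\<close>

primrec tens_o :: "('o, 'm, 'z) monoidal_scheme \<Rightarrow> 'o list \<Rightarrow> 'o" where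
  "tens_o M [] = Unit M"
| "tens_o M (x # xs) = x \<otimes>\<^sub>o\<^bsub>M\<^esub> tens_o M xs"

primrec tens :: "('o, 'm, 'z) monoidal_scheme \<Rightarrow> 'm list \<Rightarrow> 'm" where
  "tens M [] = Ident M (Unit M)"
| "tens M (f # fs) = f \<otimes>\<^bsub>M\<^esub> tens M fs"

text \<open>\<open>x \<otimes> (y \<otimes> z) \<rightarrow> y \<otimes> (x \<otimes> z)\<close>\<close>

definition left_swap :: "('o, 'm, 'z) monoidal_scheme \<Rightarrow> 'o \<Rightarrow> 'o \<Rightarrow> 'o \<Rightarrow> 'm" where
  "left_swap M x y z =
     Assoc M y x z \<cdot>\<^bsub>M\<^esub> (Sym M x y \<otimes>\<^bsub>M\<^esub> Ident M z) \<cdot>\<^bsub>M\<^esub> inverse_of M (Assoc M x y z)"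

text \<open>\<open>(a \<otimes> b) \<otimes> (c \<otimes> d) \<rightarrow> (a \<otimes> c) \<otimes> (b \<otimes> d)\<close>\<close>

definition interchange :: "('o, 'm, 'z) monoidal_scheme \<Rightarrow> 'o \<Rightarrow> 'o \<Rightarrow> 'o \<Rightarrow> 'o \<Rightarrow> 'm" where
  "interchange M a b c d =
     inverse_of M (Assoc M a c (b \<otimes>\<^sub>o\<^bsub>M\<^esub> d)) \<cdot>\<^bsub>M\<^esub> (Ident M a \<otimes>\<^bsub>M\<^esub> left_swap M b c d) \<cdot>\<^bsub>M\<^esub>
     Assoc M a b (c \<otimes>\<^sub>o\<^bsub>M\<^esub> d)"

text \<open>\<open>tens_o xs \<otimes> tens_o ys \<rightarrow> tens_o (xs @ ys)\<close>\<close>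

primrec append_iso :: "('o, 'm, 'z) monoidal_scheme \<Rightarrow> 'o list \<Rightarrow> 'o list \<Rightarrow> 'm" where
  "append_iso M [] ys = LUnit M (tens_o M ys)"
| "append_iso M (x # xs) ys =
     (Ident M x \<otimes>\<^bsub>M\<^esub> append_iso M xs ys) \<cdot>\<^bsub>M\<^esub> Assoc M x (tens_o M xs) (tens_o M ys)"

text \<open>\<open>tens_o (map tens_o xss) \<rightarrow> tens_o (concat xss)\<close>\<close>

primrec concat_iso :: "('o, 'm, 'z) monoidal_scheme \<Rightarrow> 'o list list \<Rightarrow> 'm" where
  "concat_iso M [] = Ident M (Unit M)"
| "concat_iso M (xs # xss) =
     append_iso M xs (concat xss) \<cdot>\<^bsub>M\<^esub> (Ident M (tens_o M xs) \<otimes>\<^bsub>M\<^esub> concat_iso M xss)"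

text \<open>\<open>tens_o xs \<otimes> tens_o ys \<rightarrow> tens_o [x\<^sub>1 \<otimes> y\<^sub>1, \<dots>, x\<^sub>n \<otimes> y\<^sub>n]\<close> for lists of equal length\<close>

fun zip_iso :: "('o, 'm, 'z) monoidal_scheme \<Rightarrow> 'o list \<Rightarrow> 'o list \<Rightarrow> 'm" where
  "zip_iso M (x # xs) (y # ys) =
     (Ident M (x \<otimes>\<^sub>o\<^bsub>M\<^esub> y) \<otimes>\<^bsub>M\<^esub> zip_iso M xs ys) \<cdot>\<^bsub>M\<^esub>
     interchange M x (tens_o M xs) y (tens_o M ys)"
| "zip_iso M _ _ = LUnit M (Unit M)"

text \<open>\<open>tens_o (replicate n \<one>) \<rightarrow> \<one>\<close>\<close>

primrec units_iso :: "('o, 'm, 'z) monoidal_scheme \<Rightarrow> nat \<Rightarrow> 'm" where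
  "units_iso M 0 = Ident M (Unit M)"
| "units_iso M (Suc n) =
     units_iso M n \<cdot>\<^bsub>M\<^esub> LUnit M (tens_o M (replicate n (Unit M)))"

text \<open>A permutation of \<open>{0..<n}\<close> is given by the list \<open>[\<sigma> 0, \<dots>, \<sigma> (n - 1)]\<close> of its values;
  \<open>reindex \<sigma> xs\<close> is the list whose \<open>i\<close>-th entry is \<open>xs ! \<sigma> i\<close>, and \<open>reindex \<tau> \<sigma>\<close> represents the
  composite \<open>\<sigma> \<circ> \<tau>\<close>.\<close>

definition perms :: "nat \<Rightarrow> nat list set" where
  "perms n = {\<sigma>. distinct \<sigma> \<and> set \<sigma> = {0..<n}}"

definition reindex :: "nat list \<Rightarrow> 'a list \<Rightarrow> 'a list" where
  "reindex \<sigma> xs = map (\<lambda>i. xs ! i) \<sigma>"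

text \<open>For a list \<open>ks\<close> of distinct labels containing \<open>j\<close>, the isomorphism
  \<open>tens_o (map X ks) \<rightarrow> X j \<otimes> tens_o (map X (remove1 j ks))\<close>.\<close>

primrec bring_to_front :: "('o, 'm, 'z) monoidal_scheme \<Rightarrow> (nat \<Rightarrow> 'o) \<Rightarrow> nat \<Rightarrow> nat list \<Rightarrow> 'm" where
  "bring_to_front M X j [] = undefined"
| "bring_to_front M X j (k # ks) =
     (if k = j then Ident M (X j \<otimes>\<^sub>o\<^bsub>M\<^esub> tens_o M (map X ks))
      else left_swap M (X k) (X j) (tens_o M (map X (remove1 j ks))) \<cdot>\<^bsub>M\<^esub>
        (Ident M (X k) \<otimes>\<^bsub>M\<^esub> bring_to_front M X j ks))"

text \<open>For a list \<open>ks\<close> of distinct labels and a rearrangement \<open>js\<close> of it, the isomorphism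
  \<open>tens_o (map X ks) \<rightarrow> tens_o (map X js)\<close> that permutes the tensor factors.\<close>

primrec label_iso :: "('o, 'm, 'z) monoidal_scheme \<Rightarrow> (nat \<Rightarrow> 'o) \<Rightarrow> nat list \<Rightarrow> nat list \<Rightarrow> 'm" where
  "label_iso M X [] ks = Ident M (Unit M)"
| "label_iso M X (j # js) ks =
     (Ident M (X j) \<otimes>\<^bsub>M\<^esub> label_iso M X js (remove1 j ks)) \<cdot>\<^bsub>M\<^esub> bring_to_front M X j ks"

text \<open>\<open>tens_o xs \<rightarrow> tens_o (reindex \<sigma> xs)\<close>\<close>

definition perm_iso :: "('o, 'm, 'z) monoidal_scheme \<Rightarrow> 'o list \<Rightarrow> nat list \<Rightarrow> 'm" where
  "perm_iso M xs \<sigma> = label_iso M (\<lambda>i. xs ! i) \<sigma> [0..<length xs]"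


section \<open>Colored operads and their algebras\<close>

text \<open>\<open>Ent P d [c\<^sub>1, \<dots>, c\<^sub>n]\<close> is the entry with output color \<open>d\<close> and input colors \<open>c\<^sub>i\<close>, \<open>OAct P d cs \<sigma>\<close> is
  the right action \<open>Ent P d cs \<rightarrow> Ent P d (reindex \<sigma> cs)\<close> of \<open>\<sigma>\<close>, and \<open>OComp P d cs [bs\<^sub>1, \<dots>, bs\<^sub>n]\<close> is
  \<open>Ent P d cs \<otimes> (Ent P c\<^sub>1 bs\<^sub>1 \<otimes> \<dots> \<otimes> Ent P c\<^sub>n bs\<^sub>n) \<rightarrow> Ent P d (bs\<^sub>1 @ \<dots> @ bs\<^sub>n)\<close>.\<close>

record ('c, 'o, 'm) operad =
  Ent :: "'c \<Rightarrow> 'c list \<Rightarrow> 'o"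
  OComp :: "'c \<Rightarrow> 'c list \<Rightarrow> 'c list list \<Rightarrow> 'm"
  OUnit :: "'c \<Rightarrow> 'm"
  OAct :: "'c \<Rightarrow> 'c list \<Rightarrow> nat list \<Rightarrow> 'm"

text \<open>The positions in \<open>concat xss\<close> (shifted by \<open>k\<close>), grouped as the entries of \<open>xss\<close>.\<close>

primrec index_blocks :: "nat \<Rightarrow> 'a list list \<Rightarrow> nat list list" where
  "index_blocks k [] = []"
| "index_blocks k (xs # xss) = [k..<k + length xs] # index_blocks (k + length xs) xss"

text \<open>The permutation of the entries of \<open>concat xss\<close> that permutes the blocks by \<open>\<sigma>\<close>, and the one
  that permutes the entries of each block by the corresponding member of \<open>\<tau>s\<close>.\<close>

definition block_perm :: "nat list \<Rightarrow> 'a list list \<Rightarrow> nat list" where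
  "block_perm \<sigma> xss = concat (reindex \<sigma> (index_blocks 0 xss))"

definition sum_perm :: "nat list list \<Rightarrow> 'a list list \<Rightarrow> nat list" where
  "sum_perm \<tau>s xss = concat (map2 reindex \<tau>s (index_blocks 0 xss))"

locale colored_operad = symmetric_monoidal M
  for M :: "('o, 'm, 'z) monoidal_scheme" (structure) and C :: "'c set"
    and P :: "('c, 'o, 'm) operad" +
  assumes ent_obj: "\<lbrakk>d \<in> C; cs \<in> lists C\<rbrakk> \<Longrightarrow> Ent P d cs \<in> Obj M"
    and ocomp_hom: "\<lbrakk>d \<in> C; cs \<in> lists C; bss \<in> lists (lists C); length bss = length cs\<rbrakk>
      \<Longrightarrow> OComp P d cs bss \<in>
        hom M (Ent P d cs \<otimes>\<^sub>o tens_o M (map2 (Ent P) cs bss)) (Ent P d (concat bss))"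
    and ounit_hom: "c \<in> C \<Longrightarrow> OUnit P c \<in> hom M (Unit M) (Ent P c [c])"
    and oact_hom: "\<lbrakk>d \<in> C; cs \<in> lists C; \<sigma> \<in> perms (length cs)\<rbrakk>
      \<Longrightarrow> OAct P d cs \<sigma> \<in> hom M (Ent P d cs) (Ent P d (reindex \<sigma> cs))"
    and oact_ident: "\<lbrakk>d \<in> C; cs \<in> lists C\<rbrakk>
      \<Longrightarrow> OAct P d cs [0..<length cs] = Ident M (Ent P d cs)"
    and oact_comp: "\<lbrakk>d \<in> C; cs \<in> lists C; \<sigma> \<in> perms (length cs); \<tau> \<in> perms (length cs)\<rbrakk>
      \<Longrightarrow> OAct P d (reindex \<sigma> cs) \<tau> \<cdot> OAct P d cs \<sigma> = OAct P d cs (reindex \<tau> \<sigma>)"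
    and ocomp_assoc: "\<lbrakk>d \<in> C; cs \<in> lists C; bss \<in> lists (lists C); length bss = length cs;
        ass \<in> lists (lists (lists C)); map length ass = map length bss\<rbrakk>
      \<Longrightarrow> OComp P d (concat bss) (concat ass) \<cdot>
          (OComp P d cs bss \<otimes> concat_iso M (map2 (map2 (Ent P)) bss ass)) =
        OComp P d cs (map concat ass) \<cdot>
          (Ident M (Ent P d cs) \<otimes>
            (tens M (map (\<lambda>(c, bs, as). OComp P c bs as) (zip cs (zip bss ass))) \<cdot>
             zip_iso M (map2 (Ent P) cs bss) (map (tens_o M) (map2 (map2 (Ent P)) bss ass)))) \<cdot>
          Assoc M (Ent P d cs) (tens_o M (map2 (Ent P) cs bss))
            (tens_o M (map (tens_o M) (map2 (map2 (Ent P)) bss ass)))"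
    and ounit_left: "\<lbrakk>d \<in> C; cs \<in> lists C\<rbrakk>
      \<Longrightarrow> OComp P d [d] [cs] \<cdot> (OUnit P d \<otimes> Ident M (tens_o M [Ent P d cs])) =
        RUnit M (Ent P d cs) \<cdot> LUnit M (tens_o M [Ent P d cs])"
    and ounit_right: "\<lbrakk>d \<in> C; cs \<in> lists C\<rbrakk>
      \<Longrightarrow> OComp P d cs (map (\<lambda>c. [c]) cs) \<cdot>
          (Ident M (Ent P d cs) \<otimes> tens M (map (OUnit P) cs)) =
        RUnit M (Ent P d cs) \<cdot> (Ident M (Ent P d cs) \<otimes> units_iso M (length cs))"
    and ocomp_equivariant_outer: "\<lbrakk>d \<in> C; cs \<in> lists C; bss \<in> lists (lists C);
        length bss = length cs; \<sigma> \<in> perms (length cs)\<rbrakk>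
      \<Longrightarrow> OComp P d (reindex \<sigma> cs) (reindex \<sigma> bss) \<cdot>
          (OAct P d cs \<sigma> \<otimes> perm_iso M (map2 (Ent P) cs bss) \<sigma>) =
        OAct P d (concat bss) (block_perm \<sigma> bss) \<cdot> OComp P d cs bss"
    and ocomp_equivariant_inner: "\<lbrakk>d \<in> C; cs \<in> lists C; bss \<in> lists (lists C);
        length bss = length cs; list_all2 (\<lambda>bs \<tau>. \<tau> \<in> perms (length bs)) bss \<tau>s\<rbrakk>
      \<Longrightarrow> OComp P d cs (map2 reindex \<tau>s bss) \<cdot>
          (Ident M (Ent P d cs) \<otimes>
            tens M (map (\<lambda>(c, bs, \<tau>). OAct P c bs \<tau>) (zip cs (zip bss \<tau>s)))) =
        OAct P d (concat bss) (sum_perm \<tau>s bss) \<cdot> OComp P d cs bss"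

record ('c, 'o, 'm) algebra =
  Car :: "'c \<Rightarrow> 'o"
  Str :: "'c \<Rightarrow> 'c list \<Rightarrow> 'm"

text \<open>Values outside the set of colors are fixed to be \<open>undefined\<close>, so that algebras and their
  morphisms are determined by their entries.\<close>

definition is_algebra :: "('o, 'm, 'z) monoidal_scheme \<Rightarrow> 'c set \<Rightarrow> ('c, 'o, 'm) operad \<Rightarrow>
    ('c, 'o, 'm) algebra \<Rightarrow> bool" where
  "is_algebra M C P A \<longleftrightarrow>
     Car A \<in> extensional C \<and>
     (\<forall>d cs. \<not> (d \<in> C \<and> cs \<in> lists C) \<longrightarrow> Str A d cs = undefined) \<and>
     (\<forall>c\<in>C. Car A c \<in> Obj M) \<and>
     (\<forall>d\<in>C. \<forall>cs\<in>lists C.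
        Str A d cs \<in> hom M (Ent P d cs \<otimes>\<^sub>o\<^bsub>M\<^esub> tens_o M (map (Car A) cs)) (Car A d)) \<and>
     (\<forall>d\<in>C. \<forall>cs\<in>lists C. \<forall>bss\<in>lists (lists C). length bss = length cs \<longrightarrow>
        Str A d (concat bss) \<cdot>\<^bsub>M\<^esub>
          (OComp P d cs bss \<otimes>\<^bsub>M\<^esub> concat_iso M (map (map (Car A)) bss)) =
        Str A d cs \<cdot>\<^bsub>M\<^esub>
          (Ident M (Ent P d cs) \<otimes>\<^bsub>M\<^esub>
            (tens M (map2 (Str A) cs bss) \<cdot>\<^bsub>M\<^esub>
             zip_iso M (map2 (Ent P) cs bss) (map (tens_o M) (map (map (Car A)) bss)))) \<cdot>\<^bsub>M\<^esub>
          Assoc M (Ent P d cs) (tens_o M (map2 (Ent P) cs bss))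
            (tens_o M (map (tens_o M) (map (map (Car A)) bss)))) \<and>
     (\<forall>c\<in>C. Str A c [c] \<cdot>\<^bsub>M\<^esub> (OUnit P c \<otimes>\<^bsub>M\<^esub> Ident M (tens_o M [Car A c])) =
        RUnit M (Car A c) \<cdot>\<^bsub>M\<^esub> LUnit M (tens_o M [Car A c])) \<and>
     (\<forall>d\<in>C. \<forall>cs\<in>lists C. \<forall>\<sigma>\<in>perms (length cs).
        Str A d (reindex \<sigma> cs) \<cdot>\<^bsub>M\<^esub> (OAct P d cs \<sigma> \<otimes>\<^bsub>M\<^esub> perm_iso M (map (Car A) cs) \<sigma>) =
        Str A d cs)"

record ('c, 'o, 'm) alg_arr =
  ADom :: "('c, 'o, 'm) algebra"
  ACod :: "('c, 'o, 'm) algebra"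
  AMap :: "'c \<Rightarrow> 'm"

definition is_alg_arr :: "('o, 'm, 'z) monoidal_scheme \<Rightarrow> 'c set \<Rightarrow> ('c, 'o, 'm) operad \<Rightarrow>
    ('c, 'o, 'm) alg_arr \<Rightarrow> bool" where
  "is_alg_arr M C P h \<longleftrightarrow>
     is_algebra M C P (ADom h) \<and> is_algebra M C P (ACod h) \<and> AMap h \<in> extensional C \<and>
     (\<forall>c\<in>C. AMap h c \<in> hom M (Car (ADom h) c) (Car (ACod h) c)) \<and>
     (\<forall>d\<in>C. \<forall>cs\<in>lists C.
        AMap h d \<cdot>\<^bsub>M\<^esub> Str (ADom h) d cs =
        Str (ACod h) d cs \<cdot>\<^bsub>M\<^esub> (Ident M (Ent P d cs) \<otimes>\<^bsub>M\<^esub> tens M (map (AMap h) cs)))"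

definition Alg :: "('o, 'm, 'z) monoidal_scheme \<Rightarrow> 'c set \<Rightarrow> ('c, 'o, 'm) operad \<Rightarrow>
    (('c, 'o, 'm) algebra, ('c, 'o, 'm) alg_arr) category" where
  "Alg M C P =
     \<lparr>Obj = {A. is_algebra M C P A},
      Arr = {h. is_alg_arr M C P h},
      Dom = ADom,
      Cod = ACod,
      Ident = (\<lambda>A. \<lparr>ADom = A, ACod = A, AMap = (\<lambda>c\<in>C. Ident M (Car A c))\<rparr>),
      Comp = (\<lambda>k h. \<lparr>ADom = ADom h, ACod = ACod k,
                      AMap = (\<lambda>c\<in>C. AMap k c \<cdot>\<^bsub>M\<^esub> AMap h c)\<rparr>)\<rparr>"


section \<open>Transport along lax monoidal functors\<close>

text \<open>Comparison maps \<open>LMu F x y : F x \<otimes> F y \<rightarrow> F (x \<otimes> y)\<close> and \<open>LEps F : \<one> \<rightarrow> F \<one>\<close>.\<close>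

record ('o, 'm, 'p, 'n) lax_fctr = "('o, 'm, 'p, 'n) fctr" +
  LMu :: "'o \<Rightarrow> 'o \<Rightarrow> 'n"
  LEps :: 'n

text \<open>\<open>tens_o (map F xs) \<rightarrow> F (tens_o xs)\<close>\<close>

primrec lax_tens :: "('o, 'm, 'y) monoidal_scheme \<Rightarrow> ('p, 'n, 'z) monoidal_scheme \<Rightarrow>
    ('o, 'm, 'p, 'n) lax_fctr \<Rightarrow> 'o list \<Rightarrow> 'n" where
  "lax_tens M N F [] = LEps F"
| "lax_tens M N F (x # xs) =
     LMu F x (tens_o M xs) \<cdot>\<^bsub>N\<^esub> (Ident N (Fo F x) \<otimes>\<^bsub>N\<^esub> lax_tens M N F xs)"

definition push_operad :: "('o, 'm, 'y) monoidal_scheme \<Rightarrow> ('p, 'n, 'z) monoidal_scheme \<Rightarrow>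
    ('o, 'm, 'p, 'n) lax_fctr \<Rightarrow> ('c, 'o, 'm) operad \<Rightarrow> ('c, 'p, 'n) operad" where
  "push_operad M N F P =
     \<lparr>Ent = (\<lambda>d cs. Fo F (Ent P d cs)),
      OComp = (\<lambda>d cs bss. Fa F (OComp P d cs bss) \<cdot>\<^bsub>N\<^esub>
        LMu F (Ent P d cs) (tens_o M (map2 (Ent P) cs bss)) \<cdot>\<^bsub>N\<^esub>
        (Ident N (Fo F (Ent P d cs)) \<otimes>\<^bsub>N\<^esub> lax_tens M N F (map2 (Ent P) cs bss))),
      OUnit = (\<lambda>c. Fa F (OUnit P c) \<cdot>\<^bsub>N\<^esub> LEps F),
      OAct = (\<lambda>d cs \<sigma>. Fa F (OAct P d cs \<sigma>))\<rparr>"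

text \<open>The \<open>Q\<close>-algebra induced by a \<open>P\<close>-algebra \<open>A\<close> under a lax monoidal functor \<open>F\<close> and a map of
  operads \<open>\<theta> d cs : Ent Q d cs \<rightarrow> F (Ent P d cs)\<close>, with structure maps
  \<open>Ent Q d cs \<otimes> F A\<^sub>1 \<otimes> \<dots> \<otimes> F A\<^sub>n \<rightarrow> F (Ent P d cs \<otimes> A\<^sub>1 \<otimes> \<dots> \<otimes> A\<^sub>n) \<rightarrow> F A\<close>.\<close>

definition push_algebra :: "('o, 'm, 'y) monoidal_scheme \<Rightarrow> ('p, 'n, 'z) monoidal_scheme \<Rightarrow>
    ('o, 'm, 'p, 'n) lax_fctr \<Rightarrow> 'c set \<Rightarrow> ('c, 'o, 'm) operad \<Rightarrow> ('c \<Rightarrow> 'c list \<Rightarrow> 'n) \<Rightarrow>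
    ('c, 'o, 'm) algebra \<Rightarrow> ('c, 'p, 'n) algebra" where
  "push_algebra M N F C P \<theta> A =
     \<lparr>Car = (\<lambda>c\<in>C. Fo F (Car A c)),
      Str = (\<lambda>d cs. if d \<in> C \<and> cs \<in> lists C
        then Fa F (Str A d cs) \<cdot>\<^bsub>N\<^esub> LMu F (Ent P d cs) (tens_o M (map (Car A) cs)) \<cdot>\<^bsub>N\<^esub>
          (\<theta> d cs \<otimes>\<^bsub>N\<^esub> lax_tens M N F (map (Car A) cs))
        else undefined)\<rparr>"

definition Alg_fctr :: "('o, 'm, 'y) monoidal_scheme \<Rightarrow> ('p, 'n, 'z) monoidal_scheme \<Rightarrow>
    ('o, 'm, 'p, 'n) lax_fctr \<Rightarrow> 'c set \<Rightarrow> ('c, 'o, 'm) operad \<Rightarrow> ('c \<Rightarrow> 'c list \<Rightarrow> 'n) \<Rightarrow>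
    (('c, 'o, 'm) algebra, ('c, 'o, 'm) alg_arr, ('c, 'p, 'n) algebra, ('c, 'p, 'n) alg_arr) fctr"
  where
  "Alg_fctr M N F C P \<theta> =
     \<lparr>Fo = push_algebra M N F C P \<theta>,
      Fa = (\<lambda>h. \<lparr>ADom = push_algebra M N F C P \<theta> (ADom h),
                  ACod = push_algebra M N F C P \<theta> (ACod h),
                  AMap = (\<lambda>c\<in>C. Fa F (AMap h c))\<rparr>)\<rparr>"


section \<open>Arrow categories\<close>

text \<open>A commutative square from \<open>Src s\<close> to \<open>Tgt s\<close>, with component \<open>Sq0 s\<close> on the domains and \<open>Sq1 s\<close>
  on the codomains.\<close>

datatype 'm square = Square (Src: 'm) (Tgt: 'm) (Sq0: 'm) (Sq1: 'm)

definition is_square :: "('o, 'm, 'z) category_scheme \<Rightarrow> 'm square \<Rightarrow> bool" where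
  "is_square M s \<longleftrightarrow> Src s \<in> Arr M \<and> Tgt s \<in> Arr M \<and>
     Sq0 s \<in> hom M (Dom M (Src s)) (Dom M (Tgt s)) \<and>
     Sq1 s \<in> hom M (Cod M (Src s)) (Cod M (Tgt s)) \<and>
     Tgt s \<cdot>\<^bsub>M\<^esub> Sq0 s = Sq1 s \<cdot>\<^bsub>M\<^esub> Src s"

definition arrow_cat :: "('o, 'm, 'z) category_scheme \<Rightarrow> ('m, 'm square) category" where
  "arrow_cat M =
     \<lparr>Obj = Arr M,
      Arr = {s. is_square M s},
      Dom = Src,
      Cod = Tgt,
      Ident = (\<lambda>f. Square f f (Ident M (Dom M f)) (Ident M (Cod M f))),
      Comp = (\<lambda>t s. Square (Src s) (Tgt t) (Sq0 t \<cdot>\<^bsub>M\<^esub> Sq0 s) (Sq1 t \<cdot>\<^bsub>M\<^esub> Sq1 s))\<rparr>"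

definition arrow_tensor :: "('o, 'm, 'z) monoidal_scheme \<Rightarrow> ('m, 'm square) monoidal" where
  "arrow_tensor M =
     \<lparr>Obj = Obj (arrow_cat M), Arr = Arr (arrow_cat M),
      Dom = Dom (arrow_cat M), Cod = Cod (arrow_cat M),
      Ident = Ident (arrow_cat M), Comp = Comp (arrow_cat M),
      Tensor_o = (\<lambda>f g. f \<otimes>\<^bsub>M\<^esub> g),
      Tensor = (\<lambda>s t. Square (Src s \<otimes>\<^bsub>M\<^esub> Src t) (Tgt s \<otimes>\<^bsub>M\<^esub> Tgt t)
        (Sq0 s \<otimes>\<^bsub>M\<^esub> Sq0 t) (Sq1 s \<otimes>\<^bsub>M\<^esub> Sq1 t)),
      Unit = Ident M (Unit M),
      Assoc = (\<lambda>f g h. Square ((f \<otimes>\<^bsub>M\<^esub> g) \<otimes>\<^bsub>M\<^esub> h) (f \<otimes>\<^bsub>M\<^esub> (g \<otimes>\<^bsub>M\<^esub> h))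
        (Assoc M (Dom M f) (Dom M g) (Dom M h)) (Assoc M (Cod M f) (Cod M g) (Cod M h))),
      LUnit = (\<lambda>f. Square (Ident M (Unit M) \<otimes>\<^bsub>M\<^esub> f) f (LUnit M (Dom M f)) (LUnit M (Cod M f))),
      RUnit = (\<lambda>f. Square (f \<otimes>\<^bsub>M\<^esub> Ident M (Unit M)) f (RUnit M (Dom M f)) (RUnit M (Cod M f))),
      Sym = (\<lambda>f g. Square (f \<otimes>\<^bsub>M\<^esub> g) (g \<otimes>\<^bsub>M\<^esub> f)
        (Sym M (Dom M f) (Dom M g)) (Sym M (Cod M f) (Cod M g)))\<rparr>"

text \<open>The domain of the pushout product of \<open>f : X\<^sub>0 \<rightarrow> X\<^sub>1\<close> and \<open>g : Y\<^sub>0 \<rightarrow> Y\<^sub>1\<close> is the pushout of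
  \<open>X\<^sub>0 \<otimes> Y\<^sub>1 \<leftarrow> X\<^sub>0 \<otimes> Y\<^sub>0 \<rightarrow> X\<^sub>1 \<otimes> Y\<^sub>0\<close>; \<open>box_inl\<close> and \<open>box_inr\<close> are its legs.\<close>

definition box_inl :: "('o, 'm, 'z) monoidal_scheme \<Rightarrow> 'm \<Rightarrow> 'm \<Rightarrow> 'm" where
  "box_inl M f g = po_inl M (Ident M (Dom M f) \<otimes>\<^bsub>M\<^esub> g) (f \<otimes>\<^bsub>M\<^esub> Ident M (Dom M g))"

definition box_inr :: "('o, 'm, 'z) monoidal_scheme \<Rightarrow> 'm \<Rightarrow> 'm \<Rightarrow> 'm" where
  "box_inr M f g = po_inr M (Ident M (Dom M f) \<otimes>\<^bsub>M\<^esub> g) (f \<otimes>\<^bsub>M\<^esub> Ident M (Dom M g))"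

definition box_copair :: "('o, 'm, 'z) monoidal_scheme \<Rightarrow> 'm \<Rightarrow> 'm \<Rightarrow> 'm \<Rightarrow> 'm \<Rightarrow> 'm" where
  "box_copair M f g = copair M (Ident M (Dom M f) \<otimes>\<^bsub>M\<^esub> g) (f \<otimes>\<^bsub>M\<^esub> Ident M (Dom M g))"

definition pushout_product :: "('o, 'm, 'z) monoidal_scheme \<Rightarrow> 'm \<Rightarrow> 'm \<Rightarrow> 'm" where
  "pushout_product M f g =
     box_copair M f g (f \<otimes>\<^bsub>M\<^esub> Ident M (Cod M g)) (Ident M (Cod M f) \<otimes>\<^bsub>M\<^esub> g)"

definition L1_obj :: "('o, 'm, 'z) category_scheme \<Rightarrow> 'o \<Rightarrow> 'm" where
  "L1_obj M x = the_arr M (init_obj M) x"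

text \<open>Both \<open>(f \<box> g) \<box> h\<close> and \<open>f \<box> (g \<box> h)\<close> have as domain a colimit with legs from
  \<open>X\<^sub>0 \<otimes> Y\<^sub>1 \<otimes> Z\<^sub>1\<close>, \<open>X\<^sub>1 \<otimes> Y\<^sub>0 \<otimes> Z\<^sub>1\<close> and \<open>X\<^sub>1 \<otimes> Y\<^sub>1 \<otimes> Z\<^sub>0\<close>; the domain component of the associator
  is the map that corresponds to the associators of \<open>M\<close> on the three legs.\<close>

definition box_assoc0 :: "('o, 'm, 'z) monoidal_scheme \<Rightarrow> 'm \<Rightarrow> 'm \<Rightarrow> 'm \<Rightarrow> 'm" where
  "box_assoc0 M f g h =
     (THE u. u \<in> hom M (Dom M (pushout_product M (pushout_product M f g) h))
         (Dom M (pushout_product M f (pushout_product M g h))) \<and>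
       u \<cdot>\<^bsub>M\<^esub> box_inl M (pushout_product M f g) h \<cdot>\<^bsub>M\<^esub> (box_inl M f g \<otimes>\<^bsub>M\<^esub> Ident M (Cod M h)) =
         box_inl M f (pushout_product M g h) \<cdot>\<^bsub>M\<^esub> Assoc M (Dom M f) (Cod M g) (Cod M h) \<and>
       u \<cdot>\<^bsub>M\<^esub> box_inl M (pushout_product M f g) h \<cdot>\<^bsub>M\<^esub> (box_inr M f g \<otimes>\<^bsub>M\<^esub> Ident M (Cod M h)) =
         box_inr M f (pushout_product M g h) \<cdot>\<^bsub>M\<^esub> (Ident M (Cod M f) \<otimes>\<^bsub>M\<^esub> box_inl M g h) \<cdot>\<^bsub>M\<^esub>
           Assoc M (Cod M f) (Dom M g) (Cod M h) \<and>
       u \<cdot>\<^bsub>M\<^esub> box_inr M (pushout_product M f g) h =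
         box_inr M f (pushout_product M g h) \<cdot>\<^bsub>M\<^esub> (Ident M (Cod M f) \<otimes>\<^bsub>M\<^esub> box_inr M g h) \<cdot>\<^bsub>M\<^esub>
           Assoc M (Cod M f) (Cod M g) (Dom M h))"

text \<open>In the unitors, \<open>\<emptyset> \<otimes> X\<close> and \<open>X \<otimes> \<emptyset>\<close> are initial because \<open>\<otimes>\<close> preserves colimits.\<close>

definition arrow_box :: "('o, 'm, 'z) monoidal_scheme \<Rightarrow> ('m, 'm square) monoidal" where
  "arrow_box M =
     \<lparr>Obj = Obj (arrow_cat M), Arr = Arr (arrow_cat M),
      Dom = Dom (arrow_cat M), Cod = Cod (arrow_cat M),
      Ident = Ident (arrow_cat M), Comp = Comp (arrow_cat M),
      Tensor_o = pushout_product M,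
      Tensor = (\<lambda>s t. Square (pushout_product M (Src s) (Src t)) (pushout_product M (Tgt s) (Tgt t))
        (box_copair M (Src s) (Src t)
          (box_inl M (Tgt s) (Tgt t) \<cdot>\<^bsub>M\<^esub> (Sq0 s \<otimes>\<^bsub>M\<^esub> Sq1 t))
          (box_inr M (Tgt s) (Tgt t) \<cdot>\<^bsub>M\<^esub> (Sq1 s \<otimes>\<^bsub>M\<^esub> Sq0 t)))
        (Sq1 s \<otimes>\<^bsub>M\<^esub> Sq1 t)),
      Unit = L1_obj M (Unit M),
      Assoc = (\<lambda>f g h. Square (pushout_product M (pushout_product M f g) h)
        (pushout_product M f (pushout_product M g h))
        (box_assoc0 M f g h) (Assoc M (Cod M f) (Cod M g) (Cod M h))),
      LUnit = (\<lambda>f. Square (pushout_product M (L1_obj M (Unit M)) f) f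
        (box_copair M (L1_obj M (Unit M)) f
          (the_arr M (init_obj M \<otimes>\<^sub>o\<^bsub>M\<^esub> Cod M f) (Dom M f)) (LUnit M (Dom M f)))
        (LUnit M (Cod M f))),
      RUnit = (\<lambda>f. Square (pushout_product M f (L1_obj M (Unit M))) f
        (box_copair M f (L1_obj M (Unit M))
          (RUnit M (Dom M f)) (the_arr M (Cod M f \<otimes>\<^sub>o\<^bsub>M\<^esub> init_obj M) (Dom M f)))
        (RUnit M (Cod M f))),
      Sym = (\<lambda>f g. Square (pushout_product M f g) (pushout_product M g f)
        (box_copair M f g
          (box_inr M g f \<cdot>\<^bsub>M\<^esub> Sym M (Dom M f) (Cod M g))
          (box_inl M g f \<cdot>\<^bsub>M\<^esub> Sym M (Cod M f) (Dom M g)))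
        (Sym M (Cod M f) (Cod M g)))\<rparr>"

definition L0 :: "('o, 'm, 'z) monoidal_scheme \<Rightarrow> ('o, 'm, 'm, 'm square) lax_fctr" where
  "L0 M =
     \<lparr>Fo = Ident M,
      Fa = (\<lambda>m. Square (Ident M (Dom M m)) (Ident M (Cod M m)) m m),
      LMu = (\<lambda>x y. Square (Ident M x \<otimes>\<^bsub>M\<^esub> Ident M y) (Ident M (x \<otimes>\<^sub>o\<^bsub>M\<^esub> y))
        (Ident M (x \<otimes>\<^sub>o\<^bsub>M\<^esub> y)) (Ident M (x \<otimes>\<^sub>o\<^bsub>M\<^esub> y))),
      LEps = Ident (arrow_cat M) (Ident M (Unit M))\<rparr>"

text \<open>For arbitrary choices of pushouts the domain of \<open>L1 x \<box> L1 y\<close> is initial but need not be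
  the chosen initial object.\<close>

definition L1 :: "('o, 'm, 'z) monoidal_scheme \<Rightarrow> ('o, 'm, 'm, 'm square) lax_fctr" where
  "L1 M =
     \<lparr>Fo = L1_obj M,
      Fa = (\<lambda>m. Square (L1_obj M (Dom M m)) (L1_obj M (Cod M m)) (Ident M (init_obj M)) m),
      LMu = (\<lambda>x y. Square (pushout_product M (L1_obj M x) (L1_obj M y)) (L1_obj M (x \<otimes>\<^sub>o\<^bsub>M\<^esub> y))
        (the_arr M (Dom M (pushout_product M (L1_obj M x) (L1_obj M y))) (init_obj M))
        (Ident M (x \<otimes>\<^sub>o\<^bsub>M\<^esub> y))),
      LEps = Ident (arrow_cat M) (L1_obj M (Unit M))\<rparr>"

definition operad_tensor :: "('o, 'm, 'z) monoidal_scheme \<Rightarrow> ('c, 'o, 'm) operad \<Rightarrow>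
    ('c, 'm, 'm square) operad" where
  "operad_tensor M P = push_operad M (arrow_tensor M) (L0 M) P"

definition operad_box :: "('o, 'm, 'z) monoidal_scheme \<Rightarrow> ('c, 'o, 'm) operad \<Rightarrow>
    ('c, 'm, 'm square) operad" where
  "operad_box M P = push_operad M (arrow_box M) (L1 M) P"


section \<open>Cokernel and kernel\<close>

definition to_term :: "('o, 'm, 'z) category_scheme \<Rightarrow> 'o \<Rightarrow> 'm" where
  "to_term M x = the_arr M x (term_obj M)"

definition from_term :: "('o, 'm, 'z) category_scheme \<Rightarrow> 'o \<Rightarrow> 'm" where
  "from_term M x = the_arr M (term_obj M) x"

definition coker_obj :: "('o, 'm, 'z) category_scheme \<Rightarrow> 'm \<Rightarrow> 'm" where
  "coker_obj M f = po_inl M f (to_term M (Dom M f))"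

definition coker_copair :: "('o, 'm, 'z) category_scheme \<Rightarrow> 'm \<Rightarrow> 'm \<Rightarrow> 'm" where
  "coker_copair M f p = copair M f (to_term M (Dom M f)) p (from_term M (Cod M p))"

definition ker_obj :: "('o, 'm, 'z) category_scheme \<Rightarrow> 'm \<Rightarrow> 'm" where
  "ker_obj M f = pb_fst M f (from_term M (Cod M f))"

definition ker_pairing :: "('o, 'm, 'z) category_scheme \<Rightarrow> 'm \<Rightarrow> 'm \<Rightarrow> 'm" where
  "ker_pairing M f p = pairing M f (from_term M (Cod M f)) p (to_term M (Dom M p))"

definition coker_map :: "('o, 'm, 'z) category_scheme \<Rightarrow> 'm square \<Rightarrow> 'm square" where
  "coker_map M s = Square (coker_obj M (Src s)) (coker_obj M (Tgt s))
     (Sq1 s) (coker_copair M (Src s) (coker_obj M (Tgt s) \<cdot>\<^bsub>M\<^esub> Sq1 s))"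

definition ker_map :: "('o, 'm, 'z) category_scheme \<Rightarrow> 'm square \<Rightarrow> 'm square" where
  "ker_map M s = Square (ker_obj M (Src s)) (ker_obj M (Tgt s))
     (ker_pairing M (Tgt s) (Sq0 s \<cdot>\<^bsub>M\<^esub> ker_obj M (Src s))) (Sq0 s)"

definition coker_ker_unit :: "('o, 'm, 'z) category_scheme \<Rightarrow> 'm \<Rightarrow> 'm square" where
  "coker_ker_unit M f = Square f (ker_obj M (coker_obj M f))
     (ker_pairing M (coker_obj M f) f) (Ident M (Cod M f))"

definition coker_ker_counit :: "('o, 'm, 'z) category_scheme \<Rightarrow> 'm \<Rightarrow> 'm square" where
  "coker_ker_counit M g = Square (coker_obj M (ker_obj M g)) g
     (Ident M (Dom M g)) (coker_copair M (ker_obj M g) g)"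

text \<open>The strong monoidal structure of the cokernel: the isomorphisms
  \<open>coker (f \<box> g) \<rightarrow> coker f \<otimes> coker g\<close> and \<open>coker (L1 x) \<rightarrow> L0 x\<close>, the latter with \<open>x = \<one>\<close> for the
  unit.  (With arbitrary choices of pushouts the latter is not an identity.)\<close>

definition coker_delta :: "('o, 'm, 'z) monoidal_scheme \<Rightarrow> 'm \<Rightarrow> 'm \<Rightarrow> 'm square" where
  "coker_delta M f g =
     Square (coker_obj M (pushout_product M f g)) (coker_obj M f \<otimes>\<^bsub>M\<^esub> coker_obj M g)
       (Ident M (Cod M f \<otimes>\<^sub>o\<^bsub>M\<^esub> Cod M g))
       (coker_copair M (pushout_product M f g) (coker_obj M f \<otimes>\<^bsub>M\<^esub> coker_obj M g))"

definition coker_L1 :: "('o, 'm, 'z) monoidal_scheme \<Rightarrow> 'o \<Rightarrow> 'm square" where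
  "coker_L1 M x = Square (coker_obj M (L1_obj M x)) (Ident M x)
     (Ident M x) (coker_copair M (L1_obj M x) (Ident M x))"

definition coker :: "('o, 'm, 'z) monoidal_scheme \<Rightarrow> ('m, 'm square, 'm, 'm square) lax_fctr" where
  "coker M =
     \<lparr>Fo = coker_obj M,
      Fa = coker_map M,
      LMu = (\<lambda>f g. inverse_of (arrow_tensor M) (coker_delta M f g)),
      LEps = inverse_of (arrow_tensor M) (coker_L1 M (Unit M))\<rparr>"

text \<open>The lax monoidal structure that the kernel inherits as the right adjoint of the cokernel.\<close>

definition ker :: "('o, 'm, 'z) monoidal_scheme \<Rightarrow> ('m, 'm square, 'm, 'm square) lax_fctr" where
  "ker M =
     \<lparr>Fo = ker_obj M,
      Fa = ker_map M,
      LMu = (\<lambda>f g.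
        ker_map M ((coker_ker_counit M f \<otimes>\<^bsub>arrow_tensor M\<^esub> coker_ker_counit M g)
          \<cdot>\<^bsub>arrow_tensor M\<^esub> coker_delta M (ker_obj M f) (ker_obj M g))
        \<cdot>\<^bsub>arrow_box M\<^esub> coker_ker_unit M (pushout_product M (ker_obj M f) (ker_obj M g))),
      LEps = ker_map M (coker_L1 M (Unit M))
        \<cdot>\<^bsub>arrow_box M\<^esub> coker_ker_unit M (L1_obj M (Unit M))\<rparr>"


section \<open>The induced functors between categories of algebras\<close>

abbreviation Alg_box :: "('o, 'm, 'z) monoidal_scheme \<Rightarrow> 'c set \<Rightarrow> ('c, 'o, 'm) operad \<Rightarrow>
    (('c, 'm, 'm square) algebra, ('c, 'm, 'm square) alg_arr) category" where
  "Alg_box M C P \<equiv> Alg (arrow_box M) C (operad_box M P)"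

abbreviation Alg_tensor :: "('o, 'm, 'z) monoidal_scheme \<Rightarrow> 'c set \<Rightarrow> ('c, 'o, 'm) operad \<Rightarrow>
    (('c, 'm, 'm square) algebra, ('c, 'm, 'm square) alg_arr) category" where
  "Alg_tensor M C P \<equiv> Alg (arrow_tensor M) C (operad_tensor M P)"

text \<open>The operad maps are the entrywise isomorphism \<open>L0 x \<rightarrow> coker (L1 x)\<close> and the map
  \<open>L1 x \<rightarrow> ker (L0 x)\<close> adjoint to its inverse.\<close>

definition coker_Alg :: "('o, 'm, 'z) monoidal_scheme \<Rightarrow> 'c set \<Rightarrow> ('c, 'o, 'm) operad \<Rightarrow>
    (('c, 'm, 'm square) algebra, ('c, 'm, 'm square) alg_arr,
     ('c, 'm, 'm square) algebra, ('c, 'm, 'm square) alg_arr) fctr" where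
  "coker_Alg M C P = Alg_fctr (arrow_box M) (arrow_tensor M) (coker M) C (operad_box M P)
     (\<lambda>d cs. inverse_of (arrow_tensor M) (coker_L1 M (Ent P d cs)))"

definition ker_Alg :: "('o, 'm, 'z) monoidal_scheme \<Rightarrow> 'c set \<Rightarrow> ('c, 'o, 'm) operad \<Rightarrow>
    (('c, 'm, 'm square) algebra, ('c, 'm, 'm square) alg_arr,
     ('c, 'm, 'm square) algebra, ('c, 'm, 'm square) alg_arr) fctr" where
  "ker_Alg M C P = Alg_fctr (arrow_tensor M) (arrow_box M) (ker M) C (operad_tensor M P)
     (\<lambda>d cs. ker_map M (coker_L1 M (Ent P d cs))
        \<cdot>\<^bsub>arrow_box M\<^esub> coker_ker_unit M (L1_obj M (Ent P d cs)))"

definition unit_Alg :: "('o, 'm, 'z) monoidal_scheme \<Rightarrow> 'c set \<Rightarrow> ('c, 'o, 'm) operad \<Rightarrow>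
    ('c, 'm, 'm square) algebra \<Rightarrow> ('c, 'm, 'm square) alg_arr" where
  "unit_Alg M C P A =
     \<lparr>ADom = A, ACod = Fo (ker_Alg M C P) (Fo (coker_Alg M C P) A),
      AMap = (\<lambda>c\<in>C. coker_ker_unit M (Car A c))\<rparr>"

definition counit_Alg :: "('o, 'm, 'z) monoidal_scheme \<Rightarrow> 'c set \<Rightarrow> ('c, 'o, 'm) operad \<Rightarrow>
    ('c, 'm, 'm square) algebra \<Rightarrow> ('c, 'm, 'm square) alg_arr" where
  "counit_Alg M C P B =
     \<lparr>ADom = Fo (coker_Alg M C P) (Fo (ker_Alg M C P) B), ACod = B,
      AMap = (\<lambda>c\<in>C. coker_ker_counit M (Car B c))\<rparr>"

end

theory Submission
  imports Defs
begin

text \<open>Sending an arrow to its codomain is a strict monoidal functor from the pushout product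
  structure to \<open>M\<close>, and sending it to its domain is one from the tensor structure to \<open>M\<close>. The
  cokernel and the kernel commute with these projections, and their comparison maps project to
  identities. An equation of squares with target \<open>ker g\<close> can be tested on the codomain component,
  because \<open>ker g\<close> is a monomorphism; an equation of squares whose source is a cokernel can be tested on
  the domain component, because cokernels are epimorphisms. As \<open>\<otimes>\<close> preserves colimits,
  \<open>coker f \<otimes> coker g\<close> is a cokernel of the pushout product of \<open>f\<close> and \<open>g\<close>, so sources that are
  tensor products of cokernels are covered as well. Hence the axioms for \<open>coker A\<close> and \<open>ker B\<close>, and
  the compatibility of the unit and the counit with the structure maps, all follow from the
  corresponding statements in \<open>M\<close>.\<close>

text \<open>Both tests are one-sided, and this asymmetry shapes the proof: for the pushout product
  only the target must be a kernel, for the tensor product only the source must be a cokernel. The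
  source of an algebra law also contains operad entries, so on the tensor side these have to be
  cokernels as well: \<open>L0 x\<close> is the identity of \<open>x\<close>, a cokernel of the
  arrow from the initial object. An arbitrary algebra need not meet either condition, but the unit
  \<open>A -> ker (coker A)\<close> ends in a kernel and the counit
  \<open>coker (ker B) -> B\<close> starts at a cokernel, so \<open>A\<close> and \<open>B\<close>
  may be arbitrary. Pointedness supplies zero arrows, which make
  \<open>X\<^sub>1 \<rightarrow> X\<^sub>1 \<amalg> *\<close> a cokernel in the usual sense;
  tensoring preserves the zero object, hence zero arrows and cokernels. A second obstacle is that
  limits and colimits are chosen arbitrarily: \<open>coker (L1 x)\<close> is merely isomorphic to
  \<open>L0 x\<close>, and \<open>L1\<close> is strict only up to an arrow between initial objects.
  On the component that is projected to \<open>M\<close> all these comparison arrows are identities,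
  so the choices become invisible there.\<close>

context category
begin

lemma homD: "f \<in> hom C a b \<Longrightarrow> f \<in> Arr C \<and> Dom C f = a \<and> Cod C f = b \<and> a \<in> Obj C \<and> b \<in> Obj C"
  using dom_obj cod_obj by (auto simp: hom_def)

lemma ident_arr [simp]:
  assumes "a \<in> Obj C"
  shows "Ident C a \<in> Arr C" "Dom C (Ident C a) = a" "Cod C (Ident C a) = a"
  using ident_hom[OF assms] by (auto simp: hom_def)

text \<open>Typing is expressed by equations for \<open>Dom\<close> and \<open>Cod\<close>, so that
  the simplifier can discharge composability conditions; together with \<open>comp_assoc_arr\<close>
  it nests every composite to the right.\<close>

lemma arr_comp [simp]:
  assumes "f \<in> Arr C" "g \<in> Arr C" "Dom C g = Cod C f"
  shows "g \<cdot> f \<in> Arr C" "Dom C (g \<cdot> f) = Dom C f" "Cod C (g \<cdot> f) = Cod C g"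
  using comp_hom[of f "Dom C f" "Cod C f" g "Cod C g"] assms by (auto simp: hom_def)

lemma arr_obj [simp]:
  assumes "f \<in> Arr C" shows "Dom C f \<in> Obj C" "Cod C f \<in> Obj C"
  using assms dom_obj cod_obj by auto

lemma comp_ident [simp]:
  assumes "f \<in> Arr C"
  shows "Dom C f = a \<Longrightarrow> f \<cdot> Ident C a = f" "Cod C f = b \<Longrightarrow> Ident C b \<cdot> f = f"
  using assms comp_ident_right[of f] comp_ident_left[of f] by (auto simp: hom_def)

lemma comp_assoc_arr [simp]:
  assumes "f \<in> Arr C" "g \<in> Arr C" "h \<in> Arr C" "Dom C g = Cod C f" "Dom C h = Cod C g"
  shows "(h \<cdot> g) \<cdot> f = h \<cdot> (g \<cdot> f)"
  using comp_assoc[of f "Dom C f" "Cod C f" g "Cod C g" h "Cod C h"] assms by (auto simp: hom_def)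

lemma inverse_arrows_unique:
  assumes "inverse_arrows C f g" "inverse_arrows C f h"
  shows "g = h"
proof -
  have "g = g \<cdot> (f \<cdot> h)"
    using assms by (auto simp: inverse_arrows_def hom_def)
  also have "\<dots> = (g \<cdot> f) \<cdot> h"
    using assms by (subst comp_assoc_arr) (auto simp: inverse_arrows_def hom_def)
  also have "\<dots> = h"
    using assms by (auto simp: inverse_arrows_def hom_def)
  finally show ?thesis .
qed

lemma inverse_of_eq: "inverse_arrows C f g \<Longrightarrow> inverse_of C f = g"
  unfolding inverse_of_def using inverse_arrows_unique by blast

lemma inverse_arrows_inverse_of: "is_iso C f \<Longrightarrow> inverse_arrows C f (inverse_of C f)"
  using inverse_of_eq by (auto simp: is_iso_def)

lemma inverse_of_hom: "\<lbrakk>is_iso C f; f \<in> hom C a b\<rbrakk> \<Longrightarrow> inverse_of C f \<in> hom C b a"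
  using inverse_arrows_inverse_of[of f] by (auto simp: inverse_arrows_def hom_def)

end


section \<open>Iterated tensor products\<close>

text \<open>Neither naturality nor coherence appears here: equations in the arrow categories are only
  checked after projecting them to \<open>M\<close>, where they hold.\<close>

locale tensor_category = category N for N :: "('o, 'm, 'z) monoidal_scheme" (structure) +
  assumes tensor_obj: "\<lbrakk>a \<in> Obj N; b \<in> Obj N\<rbrakk> \<Longrightarrow> a \<otimes>\<^sub>o b \<in> Obj N"
    and tensor_hom: "\<lbrakk>f \<in> hom N a a'; g \<in> hom N b b'\<rbrakk> \<Longrightarrow> f \<otimes> g \<in> hom N (a \<otimes>\<^sub>o b) (a' \<otimes>\<^sub>o b')"
    and tensor_ident: "\<lbrakk>a \<in> Obj N; b \<in> Obj N\<rbrakk> \<Longrightarrow> Ident N a \<otimes> Ident N b = Ident N (a \<otimes>\<^sub>o b)"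
    and tensor_comp: "\<lbrakk>f \<in> hom N a a'; f' \<in> hom N a' a''; g \<in> hom N b b'; g' \<in> hom N b' b''\<rbrakk>
      \<Longrightarrow> (f' \<cdot> f) \<otimes> (g' \<cdot> g) = (f' \<otimes> g') \<cdot> (f \<otimes> g)"
    and unit_obj: "Unit N \<in> Obj N"
    and assoc_hom: "\<lbrakk>a \<in> Obj N; b \<in> Obj N; c \<in> Obj N\<rbrakk>
      \<Longrightarrow> Assoc N a b c \<in> hom N ((a \<otimes>\<^sub>o b) \<otimes>\<^sub>o c) (a \<otimes>\<^sub>o (b \<otimes>\<^sub>o c))"
    and assoc_iso: "\<lbrakk>a \<in> Obj N; b \<in> Obj N; c \<in> Obj N\<rbrakk> \<Longrightarrow> is_iso N (Assoc N a b c)"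
    and lunit_hom: "a \<in> Obj N \<Longrightarrow> LUnit N a \<in> hom N (Unit N \<otimes>\<^sub>o a) a"
    and runit_hom: "a \<in> Obj N \<Longrightarrow> RUnit N a \<in> hom N (a \<otimes>\<^sub>o Unit N) a"
    and sym_hom: "\<lbrakk>a \<in> Obj N; b \<in> Obj N\<rbrakk> \<Longrightarrow> Sym N a b \<in> hom N (a \<otimes>\<^sub>o b) (b \<otimes>\<^sub>o a)"

lemma (in symmetric_monoidal) tensor_category_axioms: "tensor_category M"
  by unfold_locales
    (fact tensor_obj tensor_hom tensor_ident tensor_comp unit_obj assoc_hom assoc_iso
      lunit_hom runit_hom sym_hom)+

context tensor_category
begin

lemma tens_o_obj: "set xs \<subseteq> Obj N \<Longrightarrow> tens_o N xs \<in> Obj N"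
  by (induction xs) (auto simp: unit_obj tensor_obj)

lemma tens_o_map_obj: "(\<And>k. k \<in> set ks \<Longrightarrow> X k \<in> Obj N) \<Longrightarrow> tens_o N (map X ks) \<in> Obj N"
  by (rule tens_o_obj) auto

text \<open>One index list for both families lets the lemma apply to lists built by
  \<open>map2\<close>, which are maps over a \<open>zip\<close>.\<close>

lemma tens_hom: "(\<And>k. k \<in> set ks \<Longrightarrow> F k \<in> hom N (X k) (Y k)) \<Longrightarrow>
    tens N (map F ks) \<in> hom N (tens_o N (map X ks)) (tens_o N (map Y ks))"
  by (induction ks) (auto simp: unit_obj ident_hom intro!: tensor_hom)

lemma tens_ident: "(\<And>k. k \<in> set ks \<Longrightarrow> X k \<in> Obj N) \<Longrightarrow>
    tens N (map (\<lambda>k. Ident N (X k)) ks) = Ident N (tens_o N (map X ks))"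
  by (induction ks) (auto simp: tensor_ident tens_o_map_obj)

lemma tens_comp:
  "\<lbrakk>\<And>k. k \<in> set ks \<Longrightarrow> F k \<in> hom N (X k) (Y k); \<And>k. k \<in> set ks \<Longrightarrow> G k \<in> hom N (Y k) (Z k)\<rbrakk> \<Longrightarrow>
    tens N (map (\<lambda>k. G k \<cdot> F k) ks) = tens N (map G ks) \<cdot> tens N (map F ks)"
proof (induction ks)
  case Nil
  then show ?case by (simp add: unit_obj)
next
  case (Cons k ks)
  then show ?case
    using tens_hom[of ks F X Y] tens_hom[of ks G Y Z]
    by (auto intro!: tensor_comp[of _ "X k" "Y k" _ "Z k"])
qed

text \<open>The inverse associator inside \<open>left_swap\<close> is what the assumption
  \<open>assoc_iso\<close> of the locale is for.\<close>

lemma left_swap_hom: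
  assumes "x \<in> Obj N" "y \<in> Obj N" "z \<in> Obj N"
  shows "left_swap N x y z \<in> hom N (x \<otimes>\<^sub>o (y \<otimes>\<^sub>o z)) (y \<otimes>\<^sub>o (x \<otimes>\<^sub>o z))"
proof -
  have "inverse_of N (Assoc N x y z) \<in> hom N (x \<otimes>\<^sub>o (y \<otimes>\<^sub>o z)) ((x \<otimes>\<^sub>o y) \<otimes>\<^sub>o z)"
    using assms by (intro inverse_of_hom assoc_iso assoc_hom)
  then show ?thesis
    unfolding left_swap_def using assms
    by (blast intro: comp_hom tensor_hom assoc_hom ident_hom sym_hom)
qed

lemma interchange_hom:
  assumes "a \<in> Obj N" "b \<in> Obj N" "c \<in> Obj N" "d \<in> Obj N"
  shows "interchange N a b c d \<in>
    hom N ((a \<otimes>\<^sub>o b) \<otimes>\<^sub>o (c \<otimes>\<^sub>o d)) ((a \<otimes>\<^sub>o c) \<otimes>\<^sub>o (b \<otimes>\<^sub>o d))"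
proof -
  have "inverse_of N (Assoc N a c (b \<otimes>\<^sub>o d)) \<in> hom N (a \<otimes>\<^sub>o (c \<otimes>\<^sub>o (b \<otimes>\<^sub>o d))) ((a \<otimes>\<^sub>o c) \<otimes>\<^sub>o (b \<otimes>\<^sub>o d))"
    using assms by (intro inverse_of_hom assoc_iso assoc_hom tensor_obj)
  then show ?thesis
    unfolding interchange_def using assms
    by (blast intro: comp_hom tensor_hom assoc_hom ident_hom left_swap_hom tensor_obj)
qed

lemma append_iso_hom:
  "\<lbrakk>set xs \<subseteq> Obj N; set ys \<subseteq> Obj N\<rbrakk> \<Longrightarrow>
    append_iso N xs ys \<in> hom N (tens_o N xs \<otimes>\<^sub>o tens_o N ys) (tens_o N (xs @ ys))"
proof (induction xs)
  case Nil
  then show ?case by (simp add: lunit_hom tens_o_obj)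
next
  case (Cons x xs)
  then have "tens_o N xs \<in> Obj N" "tens_o N ys \<in> Obj N" "x \<in> Obj N"
    by (auto intro: tens_o_obj)
  with Cons show ?case
    by simp (blast intro: comp_hom tensor_hom assoc_hom ident_hom)
qed

lemma concat_iso_hom:
  "\<Union> (set ` set xss) \<subseteq> Obj N \<Longrightarrow>
    concat_iso N xss \<in> hom N (tens_o N (map (tens_o N) xss)) (tens_o N (concat xss))"
proof (induction xss)
  case Nil
  then show ?case by (simp add: unit_obj ident_hom)
next
  case (Cons xs xss)
  then have "tens_o N xs \<in> Obj N" "append_iso N xs (concat xss) \<in>
      hom N (tens_o N xs \<otimes>\<^sub>o tens_o N (concat xss)) (tens_o N (xs @ concat xss))"
    by (auto intro!: tens_o_obj append_iso_hom)
  with Cons show ?case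
    by simp (blast intro: comp_hom tensor_hom ident_hom)
qed

lemma zip_iso_hom:
  "\<lbrakk>length xs = length ys; set xs \<subseteq> Obj N; set ys \<subseteq> Obj N\<rbrakk> \<Longrightarrow>
    zip_iso N xs ys \<in> hom N (tens_o N xs \<otimes>\<^sub>o tens_o N ys) (tens_o N (map2 (Tensor_o N) xs ys))"
proof (induction xs ys rule: list_induct2)
  case Nil
  then show ?case by (simp add: unit_obj lunit_hom)
next
  case (Cons x xs y ys)
  then have "tens_o N xs \<in> Obj N" "tens_o N ys \<in> Obj N" "x \<in> Obj N" "y \<in> Obj N"
    by (auto intro: tens_o_obj)
  with Cons show ?case
    by simp (blast intro: comp_hom tensor_hom ident_hom interchange_hom tensor_obj)
qed

lemma bring_to_front_hom:
  "\<lbrakk>j \<in> set ks; \<And>k. k \<in> set ks \<Longrightarrow> X k \<in> Obj N\<rbrakk> \<Longrightarrow>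
    bring_to_front N X j ks \<in>
      hom N (tens_o N (map X ks)) (X j \<otimes>\<^sub>o tens_o N (map X (remove1 j ks)))"
proof (induction ks)
  case (Cons k ks)
  have obj: "X k \<in> Obj N" "X j \<in> Obj N" "tens_o N (map X ks) \<in> Obj N"
      "tens_o N (map X (remove1 j ks)) \<in> Obj N"
    using Cons.prems set_remove1_subset[of j ks] by (auto intro!: tens_o_map_obj)
  show ?case
  proof (cases "k = j")
    case True
    with obj show ?thesis by (simp add: ident_hom tensor_obj)
  next
    case False
    with Cons have "bring_to_front N X j ks \<in>
      hom N (tens_o N (map X ks)) (X j \<otimes>\<^sub>o tens_o N (map X (remove1 j ks)))"
      by auto
    with False obj show ?thesis
      by simp (blast intro: comp_hom tensor_hom ident_hom left_swap_hom)
  qed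
qed simp

lemma label_iso_hom:
  "\<lbrakk>distinct js; distinct ks; set js = set ks; \<And>k. k \<in> set ks \<Longrightarrow> X k \<in> Obj N\<rbrakk> \<Longrightarrow>
    label_iso N X js ks \<in> hom N (tens_o N (map X ks)) (tens_o N (map X js))"
proof (induction js arbitrary: ks)
  case Nil
  then show ?case by (simp add: unit_obj ident_hom)
next
  case (Cons j js)
  have j: "j \<in> set ks" "X j \<in> Obj N"
    using Cons.prems by auto
  have "label_iso N X js (remove1 j ks) \<in>
      hom N (tens_o N (map X (remove1 j ks))) (tens_o N (map X js))"
    using Cons.prems by (intro Cons.IH) auto
  moreover have "bring_to_front N X j ks \<in>
      hom N (tens_o N (map X ks)) (X j \<otimes>\<^sub>o tens_o N (map X (remove1 j ks)))"
    using Cons.prems j by (intro bring_to_front_hom) auto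
  ultimately show ?case
    using j by simp (blast intro: comp_hom tensor_hom ident_hom)
qed

lemma perm_iso_hom:
  assumes "\<sigma> \<in> perms (length xs)" "set xs \<subseteq> Obj N"
  shows "perm_iso N xs \<sigma> \<in> hom N (tens_o N xs) (tens_o N (reindex \<sigma> xs))"
proof -
  \<comment> \<open>The list \<open>xs\<close> is written as the map of its entries over its
    positions, since \<open>label_iso\<close> permutes labelled factors.\<close>
  have "label_iso N (\<lambda>i. xs ! i) \<sigma> [0..<length xs] \<in>
      hom N (tens_o N (map (\<lambda>i. xs ! i) [0..<length xs])) (tens_o N (map (\<lambda>i. xs ! i) \<sigma>))"
    using assms by (intro label_iso_hom) (auto simp: perms_def)
  then show ?thesis
    by (simp add: perm_iso_def reindex_def map_nth)
qed

end


text \<open>\<open>perm_iso\<close> labels factors by \<open>\<lambda>i. xs ! i\<close> on all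
  natural numbers, but \<open>U (xs ! i)\<close> and \<open>map U xs ! i\<close> agree only at
  positions inside the list. The set \<open>A\<close> of relevant labels stays fixed while the
  induction shortens the lists.\<close>

lemma label_iso_cong:
  "\<lbrakk>set js \<subseteq> A; set ks \<subseteq> A; \<And>k. k \<in> A \<Longrightarrow> X k = Y k\<rbrakk> \<Longrightarrow>
    label_iso M X js ks = label_iso M Y js ks"
proof (induction js arbitrary: ks)
  case (Cons j js)
  \<comment> \<open>A nested induction on the source list: \<open>bring_to_front\<close> recurses on
    \<open>ks\<close>, whereas \<open>label_iso\<close> recurses on the target list.\<close>
  have "bring_to_front M X j ks = bring_to_front M Y j ks"
    using Cons.prems(2)
  proof (induction ks)
    case (Cons k ks)
    then have "map X ks = map Y ks" "map X (remove1 j ks) = map Y (remove1 j ks)" "X k = Y k" "X j = Y j"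
      using \<open>\<And>k. k \<in> A \<Longrightarrow> X k = Y k\<close> \<open>set (j # js) \<subseteq> A\<close> set_remove1_subset[of j ks] by auto
    with Cons show ?case by (auto simp del: map_eq_conv)
  qed simp
  with Cons show ?case
    using set_remove1_subset[of j ks] by auto
qed simp

section \<open>Strict monoidal functors\<close>

text \<open>Instances are \<open>Cod M\<close> with \<open>Sq1\<close>, \<open>Dom M\<close> with
  \<open>Sq0\<close>, and the identity of \<open>M\<close>. Demanding equalities, not isomorphisms,
  makes every coherence map built from the structure project exactly to its counterpart in
  \<open>M\<close>.\<close>

locale strict_functor = N: tensor_category N + M: tensor_category M
  for N :: "('p, 'n, 'y) monoidal_scheme" and M :: "('o, 'm, 'z) monoidal_scheme" +
  fixes U :: "'p \<Rightarrow> 'o" and T :: "'n \<Rightarrow> 'm"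
  assumes T_hom: "s \<in> hom N a b \<Longrightarrow> T s \<in> hom M (U a) (U b)"
    and T_comp: "\<lbrakk>s \<in> hom N a b; t \<in> hom N b c\<rbrakk> \<Longrightarrow> T (t \<cdot>\<^bsub>N\<^esub> s) = T t \<cdot>\<^bsub>M\<^esub> T s"
    and T_ident: "x \<in> Obj N \<Longrightarrow> T (Ident N x) = Ident M (U x)"
    and U_tensor: "\<lbrakk>x \<in> Obj N; y \<in> Obj N\<rbrakk> \<Longrightarrow> U (x \<otimes>\<^sub>o\<^bsub>N\<^esub> y) = U x \<otimes>\<^sub>o\<^bsub>M\<^esub> U y"
    and T_tensor: "\<lbrakk>s \<in> hom N a b; t \<in> hom N c d\<rbrakk> \<Longrightarrow> T (s \<otimes>\<^bsub>N\<^esub> t) = T s \<otimes>\<^bsub>M\<^esub> T t"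
    and U_unit: "U (Unit N) = Unit M"
    and T_assoc: "\<lbrakk>x \<in> Obj N; y \<in> Obj N; z \<in> Obj N\<rbrakk> \<Longrightarrow>
      T (Assoc N x y z) = Assoc M (U x) (U y) (U z)"
    and T_lunit: "x \<in> Obj N \<Longrightarrow> T (LUnit N x) = LUnit M (U x)"
    and T_runit: "x \<in> Obj N \<Longrightarrow> T (RUnit N x) = RUnit M (U x)"
    and T_sym: "\<lbrakk>x \<in> Obj N; y \<in> Obj N\<rbrakk> \<Longrightarrow> T (Sym N x y) = Sym M (U x) (U y)"
begin

lemma U_obj: "x \<in> Obj N \<Longrightarrow> U x \<in> Obj M"
  using T_hom[OF N.ident_hom] M.homD by blast

text \<open>Functors preserve pairs of mutually inverse arrows, and uniqueness of inverses carries
  this over to the chosen \<open>inverse_of\<close>.\<close>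

lemma T_inverse:
  assumes "is_iso N f" "f \<in> Arr N"
  shows "T (inverse_of N f) = inverse_of M (T f)"
proof -
  let ?a = "Dom N f" and ?b = "Cod N f"
  have f: "f \<in> hom N ?a ?b" and g: "inverse_of N f \<in> hom N ?b ?a"
    and eq: "inverse_of N f \<cdot>\<^bsub>N\<^esub> f = Ident N ?a" "f \<cdot>\<^bsub>N\<^esub> inverse_of N f = Ident N ?b"
    using N.inverse_arrows_inverse_of[OF assms(1)] assms(2)
    by (auto simp: inverse_arrows_def hom_def)
  have "inverse_arrows M (T f) (T (inverse_of N f))"
    using T_hom[OF f] T_hom[OF g] T_comp[OF f g] T_comp[OF g f] N.homD[OF f]
    by (auto simp: inverse_arrows_def hom_def eq T_ident)
  then show ?thesis
    by (simp add: M.inverse_of_eq)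
qed

lemma U_tens_o: "set xs \<subseteq> Obj N \<Longrightarrow> U (tens_o N xs) = tens_o M (map U xs)"
  by (induction xs) (auto simp: U_unit U_tensor N.tens_o_obj)

lemma T_tens: "(\<And>k. k \<in> set ks \<Longrightarrow> F k \<in> hom N (X k) (Y k)) \<Longrightarrow>
    T (tens N (map F ks)) = tens M (map (\<lambda>k. T (F k)) ks)"
proof (induction ks)
  case Nil
  then show ?case by (simp add: N.unit_obj T_ident U_unit)
next
  case (Cons k ks)
  then have "T (F k \<otimes>\<^bsub>N\<^esub> tens N (map F ks)) = T (F k) \<otimes>\<^bsub>M\<^esub> T (tens N (map F ks))"
    by (intro T_tensor[of _ "X k" "Y k" _ "tens_o N (map X ks)" "tens_o N (map Y ks)"] N.tens_hom)
      auto
  with Cons show ?case by simp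
qed

lemma T_left_swap:
  assumes [simp]: "x \<in> Obj N" "y \<in> Obj N" "z \<in> Obj N"
  shows "T (left_swap N x y z) = left_swap M (U x) (U y) (U z)"
proof -
  have inv: "inverse_of N (Assoc N x y z) \<in>
      hom N (x \<otimes>\<^sub>o\<^bsub>N\<^esub> (y \<otimes>\<^sub>o\<^bsub>N\<^esub> z)) ((x \<otimes>\<^sub>o\<^bsub>N\<^esub> y) \<otimes>\<^sub>o\<^bsub>N\<^esub> z)"
    by (intro N.inverse_of_hom N.assoc_iso N.assoc_hom) auto
  have sw: "Sym N x y \<otimes>\<^bsub>N\<^esub> Ident N z \<in> hom N ((x \<otimes>\<^sub>o\<^bsub>N\<^esub> y) \<otimes>\<^sub>o\<^bsub>N\<^esub> z) ((y \<otimes>\<^sub>o\<^bsub>N\<^esub> x) \<otimes>\<^sub>o\<^bsub>N\<^esub> z)"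
    by (intro N.tensor_hom N.sym_hom N.ident_hom) auto
  have as: "Assoc N x y z \<in> Arr N"
    using N.assoc_hom[of x y z] by (simp add: hom_def)
  show ?thesis
    unfolding left_swap_def
    using T_comp[OF N.comp_hom[OF inv sw] N.assoc_hom] T_comp[OF inv sw]
      T_tensor[OF N.sym_hom N.ident_hom] T_inverse[OF N.assoc_iso as]
    by (simp add: T_ident T_assoc T_sym)
qed

lemma T_interchange:
  assumes [simp]: "a \<in> Obj N" "b \<in> Obj N" "c \<in> Obj N" "d \<in> Obj N"
  shows "T (interchange N a b c d) = interchange M (U a) (U b) (U c) (U d)"
proof -
  have [simp]: "c \<otimes>\<^sub>o\<^bsub>N\<^esub> d \<in> Obj N" "b \<otimes>\<^sub>o\<^bsub>N\<^esub> d \<in> Obj N"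
    by (auto intro: N.tensor_obj)
  have inv: "inverse_of N (Assoc N a c (b \<otimes>\<^sub>o\<^bsub>N\<^esub> d)) \<in>
      hom N (a \<otimes>\<^sub>o\<^bsub>N\<^esub> (c \<otimes>\<^sub>o\<^bsub>N\<^esub> (b \<otimes>\<^sub>o\<^bsub>N\<^esub> d))) ((a \<otimes>\<^sub>o\<^bsub>N\<^esub> c) \<otimes>\<^sub>o\<^bsub>N\<^esub> (b \<otimes>\<^sub>o\<^bsub>N\<^esub> d))"
    by (intro N.inverse_of_hom N.assoc_iso N.assoc_hom) auto
  have sw: "Ident N a \<otimes>\<^bsub>N\<^esub> left_swap N b c d \<in>
      hom N (a \<otimes>\<^sub>o\<^bsub>N\<^esub> (b \<otimes>\<^sub>o\<^bsub>N\<^esub> (c \<otimes>\<^sub>o\<^bsub>N\<^esub> d))) (a \<otimes>\<^sub>o\<^bsub>N\<^esub> (c \<otimes>\<^sub>o\<^bsub>N\<^esub> (b \<otimes>\<^sub>o\<^bsub>N\<^esub> d)))"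
    by (intro N.tensor_hom N.left_swap_hom N.ident_hom) auto
  have as1: "Assoc N a b (c \<otimes>\<^sub>o\<^bsub>N\<^esub> d) \<in>
      hom N ((a \<otimes>\<^sub>o\<^bsub>N\<^esub> b) \<otimes>\<^sub>o\<^bsub>N\<^esub> (c \<otimes>\<^sub>o\<^bsub>N\<^esub> d)) (a \<otimes>\<^sub>o\<^bsub>N\<^esub> (b \<otimes>\<^sub>o\<^bsub>N\<^esub> (c \<otimes>\<^sub>o\<^bsub>N\<^esub> d)))"
    by (intro N.assoc_hom) auto
  have as: "Assoc N a c (b \<otimes>\<^sub>o\<^bsub>N\<^esub> d) \<in> Arr N"
    using N.assoc_hom[of a c "b \<otimes>\<^sub>o\<^bsub>N\<^esub> d"] by (simp add: hom_def)
  show ?thesis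
    unfolding interchange_def
    using T_comp[OF N.comp_hom[OF as1 sw] inv] T_comp[OF as1 sw]
      T_tensor[OF N.ident_hom N.left_swap_hom, of a b c d] T_inverse[OF N.assoc_iso as]
    by (simp add: T_ident T_assoc T_left_swap U_tensor)
qed

lemma T_append_iso:
  "\<lbrakk>set xs \<subseteq> Obj N; set ys \<subseteq> Obj N\<rbrakk> \<Longrightarrow>
    T (append_iso N xs ys) = append_iso M (map U xs) (map U ys)"
proof (induction xs)
  case Nil
  then show ?case by (simp add: T_lunit N.tens_o_obj U_tens_o)
next
  case (Cons x xs)
  then have obj: "tens_o N xs \<in> Obj N" "tens_o N ys \<in> Obj N" "x \<in> Obj N"
    and xs: "set xs \<subseteq> Obj N" "set ys \<subseteq> Obj N"
    by (auto intro: N.tens_o_obj)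
  note app = N.append_iso_hom[OF xs] and id = N.ident_hom[OF obj(3)]
  show ?case
    using T_comp[OF N.assoc_hom[OF obj(3,1,2)] N.tensor_hom[OF id app]] T_tensor[OF id app]
      Cons.IH xs obj
    by (simp add: T_ident T_assoc U_tens_o)
qed

lemma T_concat_iso:
  "\<Union> (set ` set xss) \<subseteq> Obj N \<Longrightarrow> T (concat_iso N xss) = concat_iso M (map (map U) xss)"
proof (induction xss)
  case Nil
  then show ?case by (simp add: N.unit_obj T_ident U_unit)
next
  case (Cons xs xss)
  then have sub: "set xs \<subseteq> Obj N" "set (concat xss) \<subseteq> Obj N" "\<Union> (set ` set xss) \<subseteq> Obj N"
    by auto
  note app = N.append_iso_hom[OF sub(1,2)] and id = N.ident_hom[OF N.tens_o_obj[OF sub(1)]]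
    and con = N.concat_iso_hom[OF sub(3)]
  show ?case
    using T_comp[OF N.tensor_hom[OF id con] app] T_tensor[OF id con] Cons.IH sub
    by (simp add: T_ident T_append_iso U_tens_o N.tens_o_obj map_concat)
qed

lemma T_zip_iso:
  "\<lbrakk>length xs = length ys; set xs \<subseteq> Obj N; set ys \<subseteq> Obj N\<rbrakk> \<Longrightarrow>
    T (zip_iso N xs ys) = zip_iso M (map U xs) (map U ys)"
proof (induction xs ys rule: list_induct2)
  case Nil
  then show ?case by (simp add: N.unit_obj T_lunit U_unit)
next
  case (Cons x xs y ys)
  then have obj: "tens_o N xs \<in> Obj N" "tens_o N ys \<in> Obj N" "x \<in> Obj N" "y \<in> Obj N"
    and sub: "set xs \<subseteq> Obj N" "set ys \<subseteq> Obj N"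
    by (auto intro: N.tens_o_obj)
  note id = N.ident_hom[OF N.tensor_obj[OF obj(3,4)]]
    and zip = N.zip_iso_hom[OF Cons.hyps sub]
    and inter = N.interchange_hom[OF obj(3,1,4,2)]
  show ?case
    using T_comp[OF inter N.tensor_hom[OF id zip]] T_tensor[OF id zip] Cons.IH sub obj
    by (simp add: T_ident T_interchange U_tens_o U_tensor N.tensor_obj)
qed

lemma T_bring_to_front:
  "\<lbrakk>j \<in> set ks; \<And>k. k \<in> set ks \<Longrightarrow> X k \<in> Obj N\<rbrakk> \<Longrightarrow>
    T (bring_to_front N X j ks) = bring_to_front M (\<lambda>i. U (X i)) j ks"
proof (induction ks)
  case (Cons k ks)
  have obj: "X k \<in> Obj N" "X j \<in> Obj N" "tens_o N (map X ks) \<in> Obj N"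
      "tens_o N (map X (remove1 j ks)) \<in> Obj N"
    and sub: "set (map X ks) \<subseteq> Obj N" "set (map X (remove1 j ks)) \<subseteq> Obj N"
    using Cons.prems set_remove1_subset[of j ks] by (auto intro!: N.tens_o_map_obj)
  show ?case
  proof (cases "k = j")
    case True
    with obj show ?thesis
      using U_tens_o[OF sub(1)] by (simp add: T_ident N.tensor_obj U_tensor comp_def)
  next
    case False
    with Cons have btf: "bring_to_front N X j ks \<in>
        hom N (tens_o N (map X ks)) (X j \<otimes>\<^sub>o\<^bsub>N\<^esub> tens_o N (map X (remove1 j ks)))"
      by (intro N.bring_to_front_hom) auto
    note id = N.ident_hom[OF obj(1)] and sw = N.left_swap_hom[OF obj(1,2,4)]
    show ?thesis
      using False Cons T_comp[OF N.tensor_hom[OF id btf] sw] T_tensor[OF id btf] obj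
        U_tens_o[OF sub(2)]
      by (simp add: T_ident T_left_swap comp_def)
  qed
qed simp

lemma T_label_iso:
  "\<lbrakk>distinct js; distinct ks; set js = set ks; \<And>k. k \<in> set ks \<Longrightarrow> X k \<in> Obj N\<rbrakk> \<Longrightarrow>
    T (label_iso N X js ks) = label_iso M (\<lambda>i. U (X i)) js ks"
proof (induction js arbitrary: ks)
  case Nil
  then show ?case by (simp add: N.unit_obj T_ident U_unit)
next
  case (Cons j js)
  have j: "j \<in> set ks" "X j \<in> Obj N"
    using Cons.prems by auto
  have lab: "label_iso N X js (remove1 j ks) \<in>
      hom N (tens_o N (map X (remove1 j ks))) (tens_o N (map X js))"
    using Cons.prems by (intro N.label_iso_hom) auto
  have btf: "bring_to_front N X j ks \<in>
      hom N (tens_o N (map X ks)) (X j \<otimes>\<^sub>o\<^bsub>N\<^esub> tens_o N (map X (remove1 j ks)))"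
    using Cons.prems j by (intro N.bring_to_front_hom) auto
  have IH: "T (label_iso N X js (remove1 j ks)) = label_iso M (\<lambda>i. U (X i)) js (remove1 j ks)"
    using Cons.prems by (intro Cons.IH) auto
  note id = N.ident_hom[OF j(2)]
  show ?case
    using T_comp[OF btf N.tensor_hom[OF id lab]] T_tensor[OF id lab] IH j Cons.prems
    by (simp add: T_ident T_bring_to_front)
qed

lemma T_perm_iso:
  assumes "\<sigma> \<in> perms (length xs)" "set xs \<subseteq> Obj N"
  shows "T (perm_iso N xs \<sigma>) = perm_iso M (map U xs) \<sigma>"
proof -
  have "T (perm_iso N xs \<sigma>) = label_iso M (\<lambda>i. U (xs ! i)) \<sigma> [0..<length xs]"
    unfolding perm_iso_def using assms by (intro T_label_iso) (auto simp: perms_def)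
  also have "\<dots> = perm_iso M (map U xs) \<sigma>"
    unfolding perm_iso_def length_map using assms
    by (intro label_iso_cong[where A = "{0..<length xs}"]) (auto simp: perms_def)
  finally show ?thesis .
qed

end

section \<open>Algebras\<close>

text \<open>Through this interface the pushed operads in the arrow categories enter; their types
  come from \<open>push_operad_over\<close>.\<close>

locale typed_operad = tensor_category N
  for N :: "('o, 'm, 'z) monoidal_scheme" (structure) and C :: "'c set"
    and Q :: "('c, 'o, 'm) operad" +
  assumes ent_obj: "\<lbrakk>d \<in> C; cs \<in> lists C\<rbrakk> \<Longrightarrow> Ent Q d cs \<in> Obj N"
    and ocomp_hom: "\<lbrakk>d \<in> C; cs \<in> lists C; bss \<in> lists (lists C); length bss = length cs\<rbrakk>
      \<Longrightarrow> OComp Q d cs bss \<in>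
        hom N (Ent Q d cs \<otimes>\<^sub>o tens_o N (map2 (Ent Q) cs bss)) (Ent Q d (concat bss))"
    and ounit_hom: "c \<in> C \<Longrightarrow> OUnit Q c \<in> hom N (Unit N) (Ent Q c [c])"
    and oact_hom: "\<lbrakk>d \<in> C; cs \<in> lists C; \<sigma> \<in> perms (length cs)\<rbrakk>
      \<Longrightarrow> OAct Q d cs \<sigma> \<in> hom N (Ent Q d cs) (Ent Q d (reindex \<sigma> cs))"

lemma (in colored_operad) typed_operad_axioms: "typed_operad M C P"
proof -
  interpret tensor_category M by (rule tensor_category_axioms)
  show ?thesis
    by unfold_locales (fact ent_obj ocomp_hom ounit_hom oact_hom)+
qed

text \<open>The two sides of each algebra equation get separate names so that each can be typed and
  projected to \<open>M\<close> on its own before the equation is reflected.\<close>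

definition assoc_lhs :: "('o, 'm, 'z) monoidal_scheme \<Rightarrow> ('c, 'o, 'm) operad \<Rightarrow> ('c \<Rightarrow> 'o) \<Rightarrow>
    ('c \<Rightarrow> 'c list \<Rightarrow> 'm) \<Rightarrow> 'c \<Rightarrow> 'c list \<Rightarrow> 'c list list \<Rightarrow> 'm" where
  "assoc_lhs N Q X m d cs bss =
     m d (concat bss) \<cdot>\<^bsub>N\<^esub> (OComp Q d cs bss \<otimes>\<^bsub>N\<^esub> concat_iso N (map (map X) bss))"

definition assoc_rhs :: "('o, 'm, 'z) monoidal_scheme \<Rightarrow> ('c, 'o, 'm) operad \<Rightarrow> ('c \<Rightarrow> 'o) \<Rightarrow>
    ('c \<Rightarrow> 'c list \<Rightarrow> 'm) \<Rightarrow> 'c \<Rightarrow> 'c list \<Rightarrow> 'c list list \<Rightarrow> 'm" where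
  "assoc_rhs N Q X m d cs bss =
     m d cs \<cdot>\<^bsub>N\<^esub>
       (Ident N (Ent Q d cs) \<otimes>\<^bsub>N\<^esub>
         (tens N (map2 m cs bss) \<cdot>\<^bsub>N\<^esub>
          zip_iso N (map2 (Ent Q) cs bss) (map (tens_o N) (map (map X) bss)))) \<cdot>\<^bsub>N\<^esub>
       Assoc N (Ent Q d cs) (tens_o N (map2 (Ent Q) cs bss))
         (tens_o N (map (tens_o N) (map (map X) bss)))"

definition unit_lhs :: "('o, 'm, 'z) monoidal_scheme \<Rightarrow> ('c, 'o, 'm) operad \<Rightarrow> ('c \<Rightarrow> 'o) \<Rightarrow>
    ('c \<Rightarrow> 'c list \<Rightarrow> 'm) \<Rightarrow> 'c \<Rightarrow> 'm" where
  "unit_lhs N Q X m c = m c [c] \<cdot>\<^bsub>N\<^esub> (OUnit Q c \<otimes>\<^bsub>N\<^esub> Ident N (tens_o N [X c]))"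

definition unit_rhs :: "('o, 'm, 'z) monoidal_scheme \<Rightarrow> ('c \<Rightarrow> 'o) \<Rightarrow> 'c \<Rightarrow> 'm" where
  "unit_rhs N X c = RUnit N (X c) \<cdot>\<^bsub>N\<^esub> LUnit N (tens_o N [X c])"

definition act_lhs :: "('o, 'm, 'z) monoidal_scheme \<Rightarrow> ('c, 'o, 'm) operad \<Rightarrow> ('c \<Rightarrow> 'o) \<Rightarrow>
    ('c \<Rightarrow> 'c list \<Rightarrow> 'm) \<Rightarrow> 'c \<Rightarrow> 'c list \<Rightarrow> nat list \<Rightarrow> 'm" where
  "act_lhs N Q X m d cs \<sigma> =
     m d (reindex \<sigma> cs) \<cdot>\<^bsub>N\<^esub> (OAct Q d cs \<sigma> \<otimes>\<^bsub>N\<^esub> perm_iso N (map X cs) \<sigma>)"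

definition alg_typed :: "('o, 'm, 'z) monoidal_scheme \<Rightarrow> 'c set \<Rightarrow> ('c, 'o, 'm) operad \<Rightarrow>
    ('c \<Rightarrow> 'o) \<Rightarrow> ('c \<Rightarrow> 'c list \<Rightarrow> 'm) \<Rightarrow> bool" where
  "alg_typed N C Q X m \<longleftrightarrow> (\<forall>c\<in>C. X c \<in> Obj N) \<and>
     (\<forall>d\<in>C. \<forall>cs\<in>lists C. m d cs \<in> hom N (Ent Q d cs \<otimes>\<^sub>o\<^bsub>N\<^esub> tens_o N (map X cs)) (X d))"

text \<open>The laws speak of bare functions \<open>X\<close> and \<open>m\<close> because they are
  also needed for the projections \<open>U (Car A c)\<close> and \<open>T (Str A d cs)\<close>,
  which need not obey the convention about \<open>undefined\<close> outside
  \<open>C\<close>.\<close>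

definition alg_laws :: "('o, 'm, 'z) monoidal_scheme \<Rightarrow> 'c set \<Rightarrow> ('c, 'o, 'm) operad \<Rightarrow>
    ('c \<Rightarrow> 'o) \<Rightarrow> ('c \<Rightarrow> 'c list \<Rightarrow> 'm) \<Rightarrow> bool" where
  "alg_laws N C Q X m \<longleftrightarrow>
     (\<forall>d\<in>C. \<forall>cs\<in>lists C. \<forall>bss\<in>lists (lists C). length bss = length cs \<longrightarrow>
        assoc_lhs N Q X m d cs bss = assoc_rhs N Q X m d cs bss) \<and>
     (\<forall>c\<in>C. unit_lhs N Q X m c = unit_rhs N X c) \<and>
     (\<forall>d\<in>C. \<forall>cs\<in>lists C. \<forall>\<sigma>\<in>perms (length cs). act_lhs N Q X m d cs \<sigma> = m d cs)"

lemma is_algebra_iff: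
  "is_algebra N C Q A \<longleftrightarrow>
     Car A \<in> extensional C \<and>
     (\<forall>d cs. \<not> (d \<in> C \<and> cs \<in> lists C) \<longrightarrow> Str A d cs = undefined) \<and>
     alg_typed N C Q (Car A) (Str A) \<and> alg_laws N C Q (Car A) (Str A)"
  unfolding is_algebra_def alg_typed_def alg_laws_def assoc_lhs_def assoc_rhs_def
    unit_lhs_def unit_rhs_def act_lhs_def
  by blast

text \<open>Nested uses of \<open>map2\<close> become one map over \<open>zip cs bss\<close>, the
  form in which the target of \<open>zip_iso\<close> and the source of \<open>tens\<close> are
  recognised as the same object.\<close>

lemma map2_eqs:
  assumes "length bss = length cs"
  shows "map2 g (map2 f cs bss) (map h bss) = map (\<lambda>(c, bs). g (f c bs) (h bs)) (zip cs bss)"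
    and "map (\<lambda>(c, bs). p c) (zip cs bss) = map p cs"
  using assms[symmetric] by (induction cs bss rule: list_induct2) auto

lemma reindex_lists:
  "\<lbrakk>\<sigma> \<in> perms (length xs); xs \<in> lists X\<rbrakk> \<Longrightarrow> reindex \<sigma> xs \<in> lists X"
  by (auto simp: perms_def reindex_def)

lemma map_reindex: "\<sigma> \<in> perms (length xs) \<Longrightarrow> map f (reindex \<sigma> xs) = reindex \<sigma> (map f xs)"
  by (auto simp: perms_def reindex_def)

lemma alg_typedD:
  assumes "alg_typed N C Q X m"
  shows "c \<in> C \<Longrightarrow> X c \<in> Obj N"
    and "\<lbrakk>d \<in> C; cs \<in> lists C\<rbrakk> \<Longrightarrow> m d cs \<in> hom N (Ent Q d cs \<otimes>\<^sub>o\<^bsub>N\<^esub> tens_o N (map X cs)) (X d)"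
  using assms by (auto simp: alg_typed_def)

context typed_operad
begin

text \<open>The constituents of the associativity equation are typed once, because these facts are
  needed both for the types of the two sides and for their projections.\<close>

lemma assoc_parts:
  assumes X: "alg_typed N C Q X m"
    and d: "d \<in> C" "cs \<in> lists C" "bss \<in> lists (lists C)" "length bss = length cs"
  shows "OComp Q d cs bss \<in>
      hom N (Ent Q d cs \<otimes>\<^sub>o tens_o N (map2 (Ent Q) cs bss)) (Ent Q d (concat bss))" (is ?P1)
    and "concat_iso N (map (map X) bss) \<in>
      hom N (tens_o N (map (tens_o N) (map (map X) bss))) (tens_o N (map X (concat bss)))" (is ?P2)
    and "m d (concat bss) \<in> hom N (Ent Q d (concat bss) \<otimes>\<^sub>o tens_o N (map X (concat bss))) (X d)" (is ?P3)
    and "m d cs \<in> hom N (Ent Q d cs \<otimes>\<^sub>o tens_o N (map X cs)) (X d)" (is ?P4)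
    and "tens N (map2 m cs bss) \<in>
      hom N (tens_o N (map (\<lambda>(c, bs). Ent Q c bs \<otimes>\<^sub>o tens_o N (map X bs)) (zip cs bss)))
        (tens_o N (map X cs))" (is ?P5)
    and "zip_iso N (map2 (Ent Q) cs bss) (map (tens_o N) (map (map X) bss)) \<in>
      hom N (tens_o N (map2 (Ent Q) cs bss) \<otimes>\<^sub>o tens_o N (map (tens_o N) (map (map X) bss)))
        (tens_o N (map (\<lambda>(c, bs). Ent Q c bs \<otimes>\<^sub>o tens_o N (map X bs)) (zip cs bss)))" (is ?P6)
    and "Ent Q d cs \<in> Obj N" (is ?P7)
    and "set (map2 (Ent Q) cs bss) \<subseteq> Obj N" (is ?P8)
    and "set (map (tens_o N) (map (map X) bss)) \<subseteq> Obj N" (is ?P9)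
    and "\<Union> (set ` set (map (map X) bss)) \<subseteq> Obj N" (is ?P10)
    and "\<And>k. k \<in> set (zip cs bss) \<Longrightarrow> (case k of (c, bs) \<Rightarrow> m c bs) \<in>
      hom N (case k of (c, bs) \<Rightarrow> Ent Q c bs \<otimes>\<^sub>o tens_o N (map X bs)) (case k of (c, bs) \<Rightarrow> X c)"
proof -
  have con: "concat bss \<in> lists C"
    using d unfolding in_lists_conv_set by auto
  have elts: "c \<in> C \<and> bs \<in> lists C" if "(c, bs) \<in> set (zip cs bss)" for c bs
    using that d by (auto dest: set_zip_leftD set_zip_rightD)
  have obj: "X c \<in> Obj N" if "c \<in> C" for c
    using X that by (auto simp: alg_typed_def)
  have str: "m e as \<in> hom N (Ent Q e as \<otimes>\<^sub>o tens_o N (map X as)) (X e)"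
    if "e \<in> C" "as \<in> lists C" for e as
    using X that by (auto simp: alg_typed_def)
  show ?P1 using d by (rule ocomp_hom)
  show 10: ?P10 using d obj by fastforce
  show ?P2 using concat_iso_hom[OF 10] by (simp add: map_concat)
  show ?P3 using str d con by blast
  show ?P4 using str d by blast
  show k: "(case k of (c, bs) \<Rightarrow> m c bs) \<in>
      hom N (case k of (c, bs) \<Rightarrow> Ent Q c bs \<otimes>\<^sub>o tens_o N (map X bs)) (case k of (c, bs) \<Rightarrow> X c)"
    if "k \<in> set (zip cs bss)" for k
  proof (cases k)
    case (Pair c bs)
    then show ?thesis using that elts str by auto
  qed
  show ?P5
    using tens_hom[of "zip cs bss" "\<lambda>(c, bs). m c bs"
        "\<lambda>(c, bs). Ent Q c bs \<otimes>\<^sub>o tens_o N (map X bs)" "\<lambda>(c, bs). X c", OF k]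
      map2_eqs(2)[OF d(4), of X]
    by simp
  show 8: ?P8 using elts ent_obj by fastforce
  have "tens_o N (map X bs) \<in> Obj N" if "bs \<in> set bss" for bs
    using 10 that by (intro tens_o_obj) (simp add: UN_subset_iff)
  then show 9: ?P9 by auto
  show ?P6
    using zip_iso_hom[OF _ 8 9] d(4)
      map2_eqs(1)[OF d(4), of "Tensor_o N" "Ent Q" "\<lambda>bs. tens_o N (map X bs)"]
    by (simp add: comp_def)
  show ?P7 using d ent_obj by blast
qed

lemma assoc_sides_hom:
  assumes "alg_typed N C Q X m"
    and "d \<in> C" "cs \<in> lists C" "bss \<in> lists (lists C)" "length bss = length cs"
  shows "assoc_lhs N Q X m d cs bss \<in> hom N ((Ent Q d cs \<otimes>\<^sub>o tens_o N (map2 (Ent Q) cs bss)) \<otimes>\<^sub>o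
      tens_o N (map (tens_o N) (map (map X) bss))) (X d)"
    and "assoc_rhs N Q X m d cs bss \<in> hom N ((Ent Q d cs \<otimes>\<^sub>o tens_o N (map2 (Ent Q) cs bss)) \<otimes>\<^sub>o
      tens_o N (map (tens_o N) (map (map X) bss))) (X d)"
proof -
  note p = assoc_parts[OF assms]
  show "assoc_lhs N Q X m d cs bss \<in> hom N ((Ent Q d cs \<otimes>\<^sub>o tens_o N (map2 (Ent Q) cs bss)) \<otimes>\<^sub>o
      tens_o N (map (tens_o N) (map (map X) bss))) (X d)"
    unfolding assoc_lhs_def by (rule comp_hom[OF tensor_hom[OF p(1,2)] p(3)])
  show "assoc_rhs N Q X m d cs bss \<in> hom N ((Ent Q d cs \<otimes>\<^sub>o tens_o N (map2 (Ent Q) cs bss)) \<otimes>\<^sub>o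
      tens_o N (map (tens_o N) (map (map X) bss))) (X d)"
    unfolding assoc_rhs_def
    by (rule comp_hom[OF comp_hom[OF assoc_hom[OF p(7) tens_o_obj[OF p(8)] tens_o_obj[OF p(9)]]
        tensor_hom[OF ident_hom[OF p(7)] comp_hom[OF p(6,5)]]] p(4)])
qed

lemma unit_sides_hom:
  assumes X: "alg_typed N C Q X m" and c: "c \<in> C"
  shows "unit_lhs N Q X m c \<in> hom N (Unit N \<otimes>\<^sub>o tens_o N [X c]) (X c)"
    and "unit_rhs N X c \<in> hom N (Unit N \<otimes>\<^sub>o tens_o N [X c]) (X c)"
proof -
  have obj: "X c \<in> Obj N" "tens_o N [X c] \<in> Obj N" and m: "m c [c] \<in>
      hom N (Ent Q c [c] \<otimes>\<^sub>o tens_o N [X c]) (X c)"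
    using alg_typedD[OF X] c alg_typedD(2)[OF X c, of "[c]"] by (auto simp: tensor_obj unit_obj)
  show "unit_lhs N Q X m c \<in> hom N (Unit N \<otimes>\<^sub>o tens_o N [X c]) (X c)"
    unfolding unit_lhs_def by (rule comp_hom[OF tensor_hom[OF ounit_hom[OF c] ident_hom[OF obj(2)]] m])
  show "unit_rhs N X c \<in> hom N (Unit N \<otimes>\<^sub>o tens_o N [X c]) (X c)"
    unfolding unit_rhs_def using comp_hom[OF lunit_hom[OF obj(2)]] runit_hom[OF obj(1)] by simp
qed

lemma act_sides_hom:
  assumes X: "alg_typed N C Q X m" and d: "d \<in> C" "cs \<in> lists C" "\<sigma> \<in> perms (length cs)"
  shows "act_lhs N Q X m d cs \<sigma> \<in> hom N (Ent Q d cs \<otimes>\<^sub>o tens_o N (map X cs)) (X d)"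
    and "perm_iso N (map X cs) \<sigma> \<in> hom N (tens_o N (map X cs)) (tens_o N (map X (reindex \<sigma> cs)))"
proof -
  have "set (map X cs) \<subseteq> Obj N"
    using X d by (auto simp: alg_typed_def)
  then show perm: "perm_iso N (map X cs) \<sigma> \<in>
      hom N (tens_o N (map X cs)) (tens_o N (map X (reindex \<sigma> cs)))"
    using perm_iso_hom[of \<sigma> "map X cs"] d by (simp add: map_reindex)
  have m: "m d (reindex \<sigma> cs) \<in> hom N (Ent Q d (reindex \<sigma> cs) \<otimes>\<^sub>o tens_o N (map X (reindex \<sigma> cs))) (X d)"
    using X d reindex_lists[OF d(3,2)] by (auto simp: alg_typed_def)
  show "act_lhs N Q X m d cs \<sigma> \<in> hom N (Ent Q d cs \<otimes>\<^sub>o tens_o N (map X cs)) (X d)"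
    unfolding act_lhs_def by (rule comp_hom[OF tensor_hom[OF oact_hom[OF d] perm] m])
qed

section \<open>The category of algebras\<close>

lemma alg_arrD:
  assumes "is_alg_arr N C Q h"
  shows "is_algebra N C Q (ADom h)" "is_algebra N C Q (ACod h)" "AMap h \<in> extensional C"
    and "c \<in> C \<Longrightarrow> AMap h c \<in> hom N (Car (ADom h) c) (Car (ACod h) c)"
    and "\<lbrakk>d \<in> C; cs \<in> lists C\<rbrakk> \<Longrightarrow> AMap h d \<cdot> Str (ADom h) d cs =
        Str (ACod h) d cs \<cdot> (Ident N (Ent Q d cs) \<otimes> tens N (map (AMap h) cs))"
  using assms by (auto simp: is_alg_arr_def)

lemma algebraD:
  assumes "is_algebra N C Q A"
  shows "Car A \<in> extensional C" "alg_typed N C Q (Car A) (Str A)" "alg_laws N C Q (Car A) (Str A)"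
    and "c \<in> C \<Longrightarrow> Car A c \<in> Obj N"
    and "\<lbrakk>d \<in> C; cs \<in> lists C\<rbrakk> \<Longrightarrow>
      Str A d cs \<in> hom N (Ent Q d cs \<otimes>\<^sub>o tens_o N (map (Car A) cs)) (Car A d)"
  using assms by (auto simp: is_algebra_iff alg_typed_def)

lemma alg_ident:
  assumes A: "is_algebra N C Q A"
  shows "is_alg_arr N C Q \<lparr>ADom = A, ACod = A, AMap = (\<lambda>c\<in>C. Ident N (Car A c))\<rparr>"
proof -
  have "Ident N (Car A d) \<cdot> Str A d cs =
      Str A d cs \<cdot> (Ident N (Ent Q d cs) \<otimes> tens N (map (\<lambda>c\<in>C. Ident N (Car A c)) cs))"
    if d: "d \<in> C" "cs \<in> lists C" for d cs
  proof -
    have "tens N (map (\<lambda>c\<in>C. Ident N (Car A c)) cs) = tens N (map (\<lambda>c. Ident N (Car A c)) cs)"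
      using d by (intro arg_cong[of _ _ "tens N"] map_cong) auto
    also have "\<dots> = Ident N (tens_o N (map (Car A) cs))"
      using d algebraD(4)[OF A] by (intro tens_ident) auto
    finally have "Ident N (Ent Q d cs) \<otimes> tens N (map (\<lambda>c\<in>C. Ident N (Car A c)) cs) =
        Ident N (Ent Q d cs \<otimes>\<^sub>o tens_o N (map (Car A) cs))"
      using d algebraD(4)[OF A] ent_obj by (auto intro!: tensor_ident tens_o_map_obj)
    then show ?thesis
      using comp_ident_left comp_ident_right algebraD(5)[OF A d] by simp
  qed
  then show ?thesis
    using A algebraD(4)[OF A] by (auto simp: is_alg_arr_def ident_hom)
qed

text \<open>The homomorphism squares of \<open>h\<close> and \<open>k\<close> are pasted, and
  functoriality of the iterated tensor product merges the two maps on the inputs.\<close>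

lemma alg_comp:
  assumes h: "is_alg_arr N C Q h" and k: "is_alg_arr N C Q k" and hk: "ACod h = ADom k"
  shows "is_alg_arr N C Q \<lparr>ADom = ADom h, ACod = ACod k, AMap = (\<lambda>c\<in>C. AMap k c \<cdot> AMap h c)\<rparr>"
proof -
  have "(AMap k d \<cdot> AMap h d) \<cdot> Str (ADom h) d cs = Str (ACod k) d cs \<cdot>
      (Ident N (Ent Q d cs) \<otimes> tens N (map (\<lambda>c\<in>C. AMap k c \<cdot> AMap h c) cs))"
    if d: "d \<in> C" "cs \<in> lists C" for d cs
  proof -
    have elt: "c \<in> C" if "c \<in> set cs" for c using that d by auto
    let ?A = "ADom h" and ?B = "ADom k" and ?D = "ACod k" and ?e = "Ent Q d cs"
    note H = alg_arrD(4)[OF h] and K = alg_arrD(4)[OF k]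
    have th: "tens N (map (AMap h) cs) \<in> hom N (tens_o N (map (Car ?A) cs)) (tens_o N (map (Car ?B) cs))"
      using H elt hk by (intro tens_hom) auto
    have tk: "tens N (map (AMap k) cs) \<in> hom N (tens_o N (map (Car ?B) cs)) (tens_o N (map (Car ?D) cs))"
      using K elt by (intro tens_hom) auto
    have sA: "Str ?A d cs \<in> hom N (?e \<otimes>\<^sub>o tens_o N (map (Car ?A) cs)) (Car ?A d)"
      and sB: "Str ?B d cs \<in> hom N (?e \<otimes>\<^sub>o tens_o N (map (Car ?B) cs)) (Car ?B d)"
      and sD: "Str ?D d cs \<in> hom N (?e \<otimes>\<^sub>o tens_o N (map (Car ?D) cs)) (Car ?D d)"
      using algebraD(5) alg_arrD(1,2) h k d by blast+
    note e = ident_hom[OF ent_obj[OF d]]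
    note ih = tensor_hom[OF e th] and ik = tensor_hom[OF e tk]
    have "tens N (map (\<lambda>c\<in>C. AMap k c \<cdot> AMap h c) cs) = tens N (map (\<lambda>c. AMap k c \<cdot> AMap h c) cs)"
      using elt by (intro arg_cong[of _ _ "tens N"] map_cong) auto
    also have "\<dots> = tens N (map (AMap k) cs) \<cdot> tens N (map (AMap h) cs)"
      using H K elt hk by (intro tens_comp) auto
    finally have "Ident N ?e \<otimes> tens N (map (\<lambda>c\<in>C. AMap k c \<cdot> AMap h c) cs) =
        (Ident N ?e \<otimes> tens N (map (AMap k) cs)) \<cdot> (Ident N ?e \<otimes> tens N (map (AMap h) cs))"
      using tensor_comp[OF e e th tk] ent_obj[OF d] by simp
    then have "Str ?D d cs \<cdot> (Ident N ?e \<otimes> tens N (map (\<lambda>c\<in>C. AMap k c \<cdot> AMap h c) cs)) =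
        (Str ?D d cs \<cdot> (Ident N ?e \<otimes> tens N (map (AMap k) cs))) \<cdot> (Ident N ?e \<otimes> tens N (map (AMap h) cs))"
      using comp_assoc[OF ih ik sD] by simp
    also have "\<dots> = (AMap k d \<cdot> Str ?B d cs) \<cdot> (Ident N ?e \<otimes> tens N (map (AMap h) cs))"
      using alg_arrD(5)[OF k d] by simp
    also have "\<dots> = AMap k d \<cdot> (AMap h d \<cdot> Str ?A d cs)"
      using comp_assoc[OF ih sB K[OF d(1)]] alg_arrD(5)[OF h d] hk by simp
    also have "\<dots> = (AMap k d \<cdot> AMap h d) \<cdot> Str ?A d cs"
      using comp_assoc[OF sA H[OF d(1)]] K[OF d(1)] hk by simp
    finally show ?thesis by simp
  qed
  then show ?thesis
    using h k hk comp_hom by (fastforce simp: is_alg_arr_def)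
qed

text \<open>Since \<open>AMap\<close> is extensional, its values on \<open>C\<close> determine
  it.\<close>

lemma alg_arr_eqI:
  fixes h k :: "('c, 'o, 'm) alg_arr"
  assumes "is_alg_arr N C Q h" "is_alg_arr N C Q k" "ADom h = ADom k" "ACod h = ACod k"
    "\<And>c. c \<in> C \<Longrightarrow> AMap h c = AMap k c"
  shows "h = k"
proof -
  have "AMap h = AMap k"
    using assms alg_arrD(3) by (intro extensionalityI[of _ C]) auto
  with assms show ?thesis by simp
qed

lemma Alg_simps [simp]:
  "Obj (Alg N C Q) = {A. is_algebra N C Q A}"
  "Arr (Alg N C Q) = {h. is_alg_arr N C Q h}"
  "Dom (Alg N C Q) = ADom"
  "Cod (Alg N C Q) = ACod"
  "Ident (Alg N C Q) A = \<lparr>ADom = A, ACod = A, AMap = (\<lambda>c\<in>C. Ident N (Car A c))\<rparr>"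
  "k \<cdot>\<^bsub>Alg N C Q\<^esub> h = \<lparr>ADom = ADom h, ACod = ACod k, AMap = (\<lambda>c\<in>C. AMap k c \<cdot> AMap h c)\<rparr>"
  by (auto simp: Alg_def)

lemma hom_Alg: "h \<in> hom (Alg N C Q) A B \<longleftrightarrow> is_alg_arr N C Q h \<and> ADom h = A \<and> ACod h = B"
  by (simp add: hom_def)

lemma category_Alg: "category (Alg N C Q)"
proof
  show "Dom (Alg N C Q) f \<in> Obj (Alg N C Q)" "Cod (Alg N C Q) f \<in> Obj (Alg N C Q)"
    if "f \<in> Arr (Alg N C Q)" for f
    using that by (simp_all add: is_alg_arr_def)
  show id: "Ident (Alg N C Q) a \<in> hom (Alg N C Q) a a" if "a \<in> Obj (Alg N C Q)" for a
    using that by (simp add: hom_Alg alg_ident)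
  show comp: "g \<cdot>\<^bsub>Alg N C Q\<^esub> f \<in> hom (Alg N C Q) a c"
    if "f \<in> hom (Alg N C Q) a b" "g \<in> hom (Alg N C Q) b c" for f g a b c
    using that by (auto simp: hom_Alg alg_comp)
  show "f \<cdot>\<^bsub>Alg N C Q\<^esub> Ident (Alg N C Q) a = f" if "f \<in> hom (Alg N C Q) a b" for f a b
  proof (rule alg_arr_eqI)
    have f: "is_alg_arr N C Q f" "ADom f = a" "ACod f = b"
      using that by (auto simp: hom_Alg)
    then show "is_alg_arr N C Q (f \<cdot>\<^bsub>Alg N C Q\<^esub> Ident (Alg N C Q) a)" "is_alg_arr N C Q f"
      using comp[OF id that] alg_arrD(1,2)[OF f(1)] unfolding hom_Alg by auto
    show "AMap (f \<cdot>\<^bsub>Alg N C Q\<^esub> Ident (Alg N C Q) a) c = AMap f c" if "c \<in> C" for c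
      using alg_arrD(4)[OF f(1) that] f that comp_ident_right by auto
  qed (use that in \<open>auto simp: hom_Alg\<close>)
  show "Ident (Alg N C Q) b \<cdot>\<^bsub>Alg N C Q\<^esub> f = f" if "f \<in> hom (Alg N C Q) a b" for f a b
  proof (rule alg_arr_eqI)
    have f: "is_alg_arr N C Q f" "ADom f = a" "ACod f = b"
      using that by (auto simp: hom_Alg)
    then show "is_alg_arr N C Q (Ident (Alg N C Q) b \<cdot>\<^bsub>Alg N C Q\<^esub> f)" "is_alg_arr N C Q f"
      using comp[OF that id] alg_arrD(1,2)[OF f(1)] unfolding hom_Alg by auto
    show "AMap (Ident (Alg N C Q) b \<cdot>\<^bsub>Alg N C Q\<^esub> f) c = AMap f c" if "c \<in> C" for c
      using alg_arrD(4)[OF f(1) that] f that comp_ident_left by auto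
  qed (use that in \<open>auto simp: hom_Alg\<close>)
  show "(h \<cdot>\<^bsub>Alg N C Q\<^esub> g) \<cdot>\<^bsub>Alg N C Q\<^esub> f = h \<cdot>\<^bsub>Alg N C Q\<^esub> (g \<cdot>\<^bsub>Alg N C Q\<^esub> f)"
    if "f \<in> hom (Alg N C Q) a b" "g \<in> hom (Alg N C Q) b c" "h \<in> hom (Alg N C Q) c d"
    for f g h a b c d
  proof (rule alg_arr_eqI)
    have f: "is_alg_arr N C Q f" "ADom f = a" "ACod f = b"
      and g: "is_alg_arr N C Q g" "ADom g = b" "ACod g = c"
      and h: "is_alg_arr N C Q h" "ADom h = c" "ACod h = d"
      using that by (auto simp: hom_Alg)
    show "is_alg_arr N C Q ((h \<cdot>\<^bsub>Alg N C Q\<^esub> g) \<cdot>\<^bsub>Alg N C Q\<^esub> f)"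
      "is_alg_arr N C Q (h \<cdot>\<^bsub>Alg N C Q\<^esub> (g \<cdot>\<^bsub>Alg N C Q\<^esub> f))"
      using comp[OF that(1) comp[OF that(2,3)]] comp[OF comp[OF that(1,2)] that(3)]
      unfolding hom_Alg by auto
    show "AMap ((h \<cdot>\<^bsub>Alg N C Q\<^esub> g) \<cdot>\<^bsub>Alg N C Q\<^esub> f) e = AMap (h \<cdot>\<^bsub>Alg N C Q\<^esub> (g \<cdot>\<^bsub>Alg N C Q\<^esub> f)) e"
      if "e \<in> C" for e
      using alg_arrD(4)[OF f(1) that] alg_arrD(4)[OF g(1) that] alg_arrD(4)[OF h(1) that]
        f g h that comp_assoc by auto
  qed auto
qed

end

section \<open>Projecting algebra laws to the base category and reflecting them\<close>

locale strict_operad_functor =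
  strict_functor N M U T + Q: typed_operad N C Q + P: typed_operad M C P
  for N :: "('p, 'n, 'y) monoidal_scheme" and M :: "('o, 'm, 'z) monoidal_scheme"
    and U :: "'p \<Rightarrow> 'o" and T :: "'n \<Rightarrow> 'm" and C :: "'c set"
    and Q :: "('c, 'p, 'n) operad" and P :: "('c, 'o, 'm) operad" +
  assumes U_ent: "\<lbrakk>d \<in> C; cs \<in> lists C\<rbrakk> \<Longrightarrow> U (Ent Q d cs) = Ent P d cs"
    and T_ocomp: "\<lbrakk>d \<in> C; cs \<in> lists C; bss \<in> lists (lists C); length bss = length cs\<rbrakk>
      \<Longrightarrow> T (OComp Q d cs bss) = OComp P d cs bss"
    and T_ounit: "c \<in> C \<Longrightarrow> T (OUnit Q c) = OUnit P c"
    and T_oact: "\<lbrakk>d \<in> C; cs \<in> lists C; \<sigma> \<in> perms (length cs)\<rbrakk>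
      \<Longrightarrow> T (OAct Q d cs \<sigma>) = OAct P d cs \<sigma>"
begin

lemma map_U_ent:
  assumes "cs \<in> lists C" "bss \<in> lists (lists C)"
  shows "map U (map2 (Ent Q) cs bss) = map2 (Ent P) cs bss"
proof -
  have "U (Ent Q c bs) = Ent P c bs" if "(c, bs) \<in> set (zip cs bss)" for c bs
    using that assms by (intro U_ent) (auto dest: set_zip_leftD set_zip_rightD)
  then show ?thesis by auto
qed

context
  fixes X m
  assumes X: "alg_typed N C Q X m"
begin

abbreviation (input) "X' \<equiv> \<lambda>c. U (X c)"
abbreviation (input) "m' \<equiv> \<lambda>d cs. T (m d cs)"

lemma T_assoc_lhs:
  assumes d: "d \<in> C" "cs \<in> lists C" "bss \<in> lists (lists C)" "length bss = length cs"
  shows "T (assoc_lhs N Q X m d cs bss) = assoc_lhs M P X' m' d cs bss"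
proof -
  note p = Q.assoc_parts[OF X d]
  show ?thesis
    unfolding assoc_lhs_def
    using T_comp[OF N.tensor_hom[OF p(1,2)] p(3)] T_tensor[OF p(1,2)] T_ocomp[OF d]
      T_concat_iso[OF p(10)]
    by (simp add: comp_def)
qed

lemma T_assoc_rhs:
  assumes d: "d \<in> C" "cs \<in> lists C" "bss \<in> lists (lists C)" "length bss = length cs"
  shows "T (assoc_rhs N Q X m d cs bss) = assoc_rhs M P X' m' d cs bss"
proof -
  note p = Q.assoc_parts[OF X d]
  note e = N.ident_hom[OF p(7)] and o1 = N.tens_o_obj[OF p(8)] and o2 = N.tens_o_obj[OF p(9)]
  note zt = N.comp_hom[OF p(6,5)]
  note as = N.assoc_hom[OF p(7) o1 o2]
  have blocks: "map U (map (tens_o N) (map (map X) bss)) = map (tens_o M) (map (map X') bss)"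
  proof -
    have "U (tens_o N (map X bs)) = tens_o M (map X' bs)" if "bs \<in> set bss" for bs
      using p(10) that by (subst U_tens_o) (auto simp: comp_def)
    then show ?thesis by simp
  qed
  have "T (tens N (map2 m cs bss)) = tens M (map2 m' cs bss)"
    using T_tens[of "zip cs bss" "\<lambda>(c, bs). m c bs"
        "\<lambda>(c, bs). Ent Q c bs \<otimes>\<^sub>o\<^bsub>N\<^esub> tens_o N (map X bs)" "\<lambda>(c, bs). X c"] p(11)
    by (simp add: case_prod_unfold)
  then have tz: "T (tens N (map2 m cs bss) \<cdot>\<^bsub>N\<^esub>
        zip_iso N (map2 (Ent Q) cs bss) (map (tens_o N) (map (map X) bss))) =
      tens M (map2 m' cs bss) \<cdot>\<^bsub>M\<^esub>
        zip_iso M (map2 (Ent P) cs bss) (map (tens_o M) (map (map X') bss))"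
    using T_comp[OF p(6,5)] T_zip_iso[OF _ p(8,9)] d(4)
    by (simp only: map_U_ent[OF d(2,3)] blocks) simp
  have ta: "T (Assoc N (Ent Q d cs) (tens_o N (map2 (Ent Q) cs bss))
        (tens_o N (map (tens_o N) (map (map X) bss)))) =
      Assoc M (Ent P d cs) (tens_o M (map2 (Ent P) cs bss))
        (tens_o M (map (tens_o M) (map (map X') bss)))"
    by (simp only: T_assoc[OF p(7) o1 o2] U_ent[OF d(1,2)] U_tens_o[OF p(8)] U_tens_o[OF p(9)]
        map_U_ent[OF d(2,3)] blocks)
  show ?thesis
    unfolding assoc_rhs_def
    by (simp only: T_comp[OF N.comp_hom[OF as N.tensor_hom[OF e zt]] p(4)]
        T_comp[OF as N.tensor_hom[OF e zt]] T_tensor[OF e zt] tz ta T_ident[OF p(7)] U_ent[OF d(1,2)])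
qed

lemma T_unit_lhs:
  assumes c: "c \<in> C"
  shows "T (unit_lhs N Q X m c) = unit_lhs M P X' m' c"
proof -
  have sub: "set [X c] \<subseteq> Obj N" and m: "m c [c] \<in> hom N (Ent Q c [c] \<otimes>\<^sub>o\<^bsub>N\<^esub> tens_o N [X c]) (X c)"
    using alg_typedD[OF X] c alg_typedD(2)[OF X c, of "[c]"] by auto
  note e = N.ident_hom[OF N.tens_o_obj[OF sub]]
  show ?thesis
    unfolding unit_lhs_def
    using T_comp[OF N.tensor_hom[OF Q.ounit_hom[OF c] e] m] T_tensor[OF Q.ounit_hom[OF c] e]
      T_ident[OF N.tens_o_obj[OF sub]] U_tens_o[OF sub] T_ounit[OF c]
    by simp
qed

lemma T_unit_rhs:
  assumes c: "c \<in> C"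
  shows "T (unit_rhs N X c) = unit_rhs M X' c"
proof -
  have sub: "set [X c] \<subseteq> Obj N" and obj: "X c \<in> Obj N"
    using X c by (auto simp: alg_typed_def)
  have r: "RUnit N (X c) \<in> hom N (tens_o N [X c]) (X c)"
    using N.runit_hom[OF obj] by simp
  show ?thesis
    unfolding unit_rhs_def
    using T_comp[OF N.lunit_hom[OF N.tens_o_obj[OF sub]] r] U_tens_o[OF sub]
      T_lunit[OF N.tens_o_obj[OF sub]] T_runit[OF obj]
    by simp
qed

lemma T_act_lhs:
  assumes d: "d \<in> C" "cs \<in> lists C" "\<sigma> \<in> perms (length cs)"
  shows "T (act_lhs N Q X m d cs \<sigma>) = act_lhs M P X' m' d cs \<sigma>"
proof -
  note perm = Q.act_sides_hom(2)[OF X d]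
  have sub: "set (map X cs) \<subseteq> Obj N"
    using X d by (auto simp: alg_typed_def)
  have m: "m d (reindex \<sigma> cs) \<in>
      hom N (Ent Q d (reindex \<sigma> cs) \<otimes>\<^sub>o\<^bsub>N\<^esub> tens_o N (map X (reindex \<sigma> cs))) (X d)"
    using X d reindex_lists[OF d(3,2)] by (auto simp: alg_typed_def)
  have "T (perm_iso N (map X cs) \<sigma>) = perm_iso M (map X' cs) \<sigma>"
    using T_perm_iso[OF _ sub] d by (simp add: comp_def)
  then show ?thesis
    unfolding act_lhs_def
    using T_comp[OF N.tensor_hom[OF Q.oact_hom[OF d] perm] m] T_tensor[OF Q.oact_hom[OF d] perm]
      T_oact[OF d]
    by simp
qed

lemma T_alg_laws:
  assumes "alg_laws N C Q X m"
  shows "alg_laws M C P X' m'"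
  using assms T_assoc_lhs T_assoc_rhs T_unit_lhs T_unit_rhs T_act_lhs
  by (simp add: alg_laws_def)

end

end

text \<open>For the pushout product, \<open>E\<close> will consist of all arrows and \<open>F\<close> of the monomorphisms; for the
  tensor product, \<open>E\<close> will consist of the cokernels and \<open>F\<close> of all arrows.\<close>

locale reflecting_functor = strict_operad_functor N M U T C Q P
  for N :: "('p, 'n, 'y) monoidal_scheme" and M :: "('o, 'm, 'z) monoidal_scheme"
    and U :: "'p \<Rightarrow> 'o" and T :: "'n \<Rightarrow> 'm" and C :: "'c set"
    and Q :: "('c, 'p, 'n) operad" and P :: "('c, 'o, 'm) operad" +
  fixes E F :: "'p set"
  assumes E_obj: "E \<subseteq> Obj N"
    and E_tensor: "\<lbrakk>a \<in> E; b \<in> E\<rbrakk> \<Longrightarrow> a \<otimes>\<^sub>o\<^bsub>N\<^esub> b \<in> E"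
    and E_unit: "Unit N \<in> E"
    and E_ent: "\<lbrakk>d \<in> C; cs \<in> lists C\<rbrakk> \<Longrightarrow> Ent Q d cs \<in> E"
    and faithful: "\<lbrakk>s \<in> hom N a b; t \<in> hom N a b; a \<in> E; b \<in> F; T s = T t\<rbrakk> \<Longrightarrow> s = t"
begin

lemma E_tens_o: "set xs \<subseteq> E \<Longrightarrow> tens_o N xs \<in> E"
  by (induction xs) (auto simp: E_unit E_tensor)

text \<open>The source of each law is a tensor product of units, entries and carriers and therefore
  lies in \<open>E\<close>, while its target is a carrier and lies in \<open>F\<close>; so
  \<open>faithful\<close> lifts the projected laws.\<close>

lemma is_algebraI:
  assumes ext: "Car A \<in> extensional C" "\<And>d cs. \<not> (d \<in> C \<and> cs \<in> lists C) \<Longrightarrow> Str A d cs = undefined"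
    and typed: "alg_typed N C Q (Car A) (Str A)"
    and laws: "alg_laws M C P (\<lambda>c. U (Car A c)) (\<lambda>d cs. T (Str A d cs))"
    and EF: "\<And>c. c \<in> C \<Longrightarrow> Car A c \<in> E" "\<And>c. c \<in> C \<Longrightarrow> Car A c \<in> F"
  shows "is_algebra N C Q A"
proof -
  have E_map: "tens_o N (map (Car A) cs) \<in> E" if "cs \<in> lists C" for cs
    using that EF(1) by (intro E_tens_o) auto
  have "alg_laws N C Q (Car A) (Str A)"
    unfolding alg_laws_def
  proof (intro conjI ballI impI)
    fix d cs bss assume d: "d \<in> C" "cs \<in> lists C" "bss \<in> lists (lists C)" "length bss = length cs"
    have "tens_o N (map (tens_o N) (map (map (Car A)) bss)) \<in> E"
      using E_map d by (intro E_tens_o) auto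
    moreover have "Ent Q c bs \<in> E" if "(c, bs) \<in> set (zip cs bss)" for c bs
      using that d by (intro E_ent) (auto dest: set_zip_leftD set_zip_rightD)
    then have "tens_o N (map2 (Ent Q) cs bss) \<in> E"
      by (intro E_tens_o) auto
    ultimately have "(Ent Q d cs \<otimes>\<^sub>o\<^bsub>N\<^esub> tens_o N (map2 (Ent Q) cs bss)) \<otimes>\<^sub>o\<^bsub>N\<^esub>
        tens_o N (map (tens_o N) (map (map (Car A)) bss)) \<in> E"
      using d by (intro E_tensor E_ent)
    then show "assoc_lhs N Q (Car A) (Str A) d cs bss = assoc_rhs N Q (Car A) (Str A) d cs bss"
      using Q.assoc_sides_hom[OF typed d] faithful EF(2) d laws
      by (simp add: T_assoc_lhs[OF typed d] T_assoc_rhs[OF typed d] alg_laws_def)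
  next
    fix c assume c: "c \<in> C"
    have "Unit N \<otimes>\<^sub>o\<^bsub>N\<^esub> tens_o N [Car A c] \<in> E"
      using c EF(1) by (intro E_tensor E_unit E_tens_o) auto
    then show "unit_lhs N Q (Car A) (Str A) c = unit_rhs N (Car A) c"
      using Q.unit_sides_hom[OF typed c] faithful EF(2) c laws
      by (simp add: T_unit_lhs[OF typed c] T_unit_rhs[OF typed c] alg_laws_def del: tens_o.simps)
  next
    fix d cs \<sigma> assume d: "d \<in> C" "cs \<in> lists C" "\<sigma> \<in> perms (length cs)"
    have "Ent Q d cs \<otimes>\<^sub>o\<^bsub>N\<^esub> tens_o N (map (Car A) cs) \<in> E"
      using d by (intro E_tensor E_ent E_map)
    then show "act_lhs N Q (Car A) (Str A) d cs \<sigma> = Str A d cs"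
      using Q.act_sides_hom(1)[OF typed d] faithful EF(2) d laws alg_typedD(2)[OF typed d(1,2)]
      by (simp add: T_act_lhs[OF typed d] alg_laws_def)
  qed
  with ext typed show ?thesis
    by (auto simp: is_algebra_iff)
qed

lemma T_alg_arr:
  assumes X: "alg_typed N C Q X m" and Y: "alg_typed N C Q Y n"
    and h: "\<And>c. c \<in> C \<Longrightarrow> h c \<in> hom N (X c) (Y c)" and d: "d \<in> C" "cs \<in> lists C"
  shows "h d \<cdot>\<^bsub>N\<^esub> m d cs \<in> hom N (Ent Q d cs \<otimes>\<^sub>o\<^bsub>N\<^esub> tens_o N (map X cs)) (Y d)"
    and "n d cs \<cdot>\<^bsub>N\<^esub> (Ident N (Ent Q d cs) \<otimes>\<^bsub>N\<^esub> tens N (map h cs)) \<in>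
      hom N (Ent Q d cs \<otimes>\<^sub>o\<^bsub>N\<^esub> tens_o N (map X cs)) (Y d)"
    and "T (h d \<cdot>\<^bsub>N\<^esub> m d cs) = T (h d) \<cdot>\<^bsub>M\<^esub> T (m d cs)"
    and "T (n d cs \<cdot>\<^bsub>N\<^esub> (Ident N (Ent Q d cs) \<otimes>\<^bsub>N\<^esub> tens N (map h cs))) =
      T (n d cs) \<cdot>\<^bsub>M\<^esub> (Ident M (Ent P d cs) \<otimes>\<^bsub>M\<^esub> tens M (map (\<lambda>c. T (h c)) cs))"
proof -
  have th: "tens N (map h cs) \<in> hom N (tens_o N (map X cs)) (tens_o N (map Y cs))"
    using h d by (intro N.tens_hom) auto
  have T_th: "T (tens N (map h cs)) = tens M (map (\<lambda>c. T (h c)) cs)"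
    using h d by (intro T_tens) auto
  note e = N.ident_hom[OF Q.ent_obj[OF d]]
  note mh = alg_typedD(2)[OF X d] and nh = alg_typedD(2)[OF Y d]
  show "h d \<cdot>\<^bsub>N\<^esub> m d cs \<in> hom N (Ent Q d cs \<otimes>\<^sub>o\<^bsub>N\<^esub> tens_o N (map X cs)) (Y d)"
    using N.comp_hom[OF mh h] d by blast
  show "n d cs \<cdot>\<^bsub>N\<^esub> (Ident N (Ent Q d cs) \<otimes>\<^bsub>N\<^esub> tens N (map h cs)) \<in>
      hom N (Ent Q d cs \<otimes>\<^sub>o\<^bsub>N\<^esub> tens_o N (map X cs)) (Y d)"
    by (rule N.comp_hom[OF N.tensor_hom[OF e th] nh])
  show "T (h d \<cdot>\<^bsub>N\<^esub> m d cs) = T (h d) \<cdot>\<^bsub>M\<^esub> T (m d cs)"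
    using T_comp[OF mh h] d by blast
  show "T (n d cs \<cdot>\<^bsub>N\<^esub> (Ident N (Ent Q d cs) \<otimes>\<^bsub>N\<^esub> tens N (map h cs))) =
      T (n d cs) \<cdot>\<^bsub>M\<^esub> (Ident M (Ent P d cs) \<otimes>\<^bsub>M\<^esub> tens M (map (\<lambda>c. T (h c)) cs))"
    using T_comp[OF N.tensor_hom[OF e th] nh] T_tensor[OF e th] T_th T_ident[OF Q.ent_obj[OF d]]
      U_ent[OF d]
    by simp
qed

text \<open>The homomorphism equation starts at a tensor product of carriers of \<open>A\<close> and
  ends in a carrier of \<open>B\<close>, so the two conditions concern different algebras. This is
  what admits an arbitrary algebra at one end of the unit and of the counit.\<close>

lemma is_alg_arrI:
  assumes A: "is_algebra N C Q A" and B: "is_algebra N C Q B"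
    and h: "h \<in> extensional C" "\<And>c. c \<in> C \<Longrightarrow> h c \<in> hom N (Car A c) (Car B c)"
    and eq: "\<And>d cs. \<lbrakk>d \<in> C; cs \<in> lists C\<rbrakk> \<Longrightarrow> T (h d) \<cdot>\<^bsub>M\<^esub> T (Str A d cs) =
      T (Str B d cs) \<cdot>\<^bsub>M\<^esub> (Ident M (Ent P d cs) \<otimes>\<^bsub>M\<^esub> tens M (map (\<lambda>c. T (h c)) cs))"
    and EF: "\<And>c. c \<in> C \<Longrightarrow> Car A c \<in> E" "\<And>c. c \<in> C \<Longrightarrow> Car B c \<in> F"
  shows "is_alg_arr N C Q \<lparr>ADom = A, ACod = B, AMap = h\<rparr>"
proof -
  have "h d \<cdot>\<^bsub>N\<^esub> Str A d cs = Str B d cs \<cdot>\<^bsub>N\<^esub> (Ident N (Ent Q d cs) \<otimes>\<^bsub>N\<^esub> tens N (map h cs))"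
    if d: "d \<in> C" "cs \<in> lists C" for d cs
  proof -
    have "Ent Q d cs \<otimes>\<^sub>o\<^bsub>N\<^esub> tens_o N (map (Car A) cs) \<in> E"
      using d EF(1) by (intro E_tensor E_ent E_tens_o) auto
    then show ?thesis
      using T_alg_arr[OF Q.algebraD(2)[OF A] Q.algebraD(2)[OF B] h(2) d] faithful EF(2) d eq by simp
  qed
  with A B h show ?thesis
    by (simp add: is_alg_arr_def)
qed

text \<open>The form used for the unit and the counit: when the components project to identities,
  the homomorphism equation reduces to equality of the projected structure maps.\<close>

lemma is_alg_arr_identI:
  assumes A: "is_algebra N C Q A" and B: "is_algebra N C Q B"
    and h: "h \<in> extensional C" "\<And>c. c \<in> C \<Longrightarrow> h c \<in> hom N (Car A c) (Car B c)"
    and T_h: "\<And>c. c \<in> C \<Longrightarrow> T (h c) = Ident M (U (Car A c))"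
    and T_Str: "\<And>d cs. \<lbrakk>d \<in> C; cs \<in> lists C\<rbrakk> \<Longrightarrow> T (Str A d cs) = T (Str B d cs)"
    and EF: "\<And>c. c \<in> C \<Longrightarrow> Car A c \<in> E" "\<And>c. c \<in> C \<Longrightarrow> Car B c \<in> F"
  shows "is_alg_arr N C Q \<lparr>ADom = A, ACod = B, AMap = h\<rparr>"
proof (rule is_alg_arrI[OF A B h _ EF])
  fix d cs assume d: "d \<in> C" "cs \<in> lists C"
  have obj: "U (Car A c) \<in> Obj M" if "c \<in> C" for c
    using Q.algebraD(4)[OF A that] by (rule U_obj)
  have sub: "set (map (Car A) cs) \<subseteq> Obj N"
    using d Q.algebraD(4)[OF A] by auto
  have eobj: "Ent P d cs \<in> Obj M"
    by (rule P.ent_obj[OF d])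
  have tobj: "tens_o M (map (\<lambda>c. U (Car A c)) cs) \<in> Obj M"
    using d obj by (intro M.tens_o_map_obj) auto
  have m: "T (Str A d cs) \<in> hom M (Ent P d cs \<otimes>\<^sub>o\<^bsub>M\<^esub> tens_o M (map (\<lambda>c. U (Car A c)) cs)) (U (Car A d))"
    using T_hom[OF Q.algebraD(5)[OF A d]] U_tensor[OF Q.ent_obj[OF d] N.tens_o_obj[OF sub]]
      U_ent[OF d] U_tens_o[OF sub]
    by (simp add: comp_def)
  have "tens M (map (\<lambda>c. T (h c)) cs) = tens M (map (\<lambda>c. Ident M (U (Car A c))) cs)"
    using d T_h by (intro arg_cong[of _ _ "tens M"] map_cong) auto
  also have "\<dots> = Ident M (tens_o M (map (\<lambda>c. U (Car A c)) cs))"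
    using d obj by (intro M.tens_ident) auto
  finally show "T (h d) \<cdot>\<^bsub>M\<^esub> T (Str A d cs) =
      T (Str B d cs) \<cdot>\<^bsub>M\<^esub> (Ident M (Ent P d cs) \<otimes>\<^bsub>M\<^esub> tens M (map (\<lambda>c. T (h c)) cs))"
    using M.comp_ident_left[OF m] M.comp_ident_right[OF m] T_h[OF d(1)] T_Str[OF d]
      M.tensor_ident[OF eobj tobj]
    by simp
qed

end


section \<open>Lax monoidal functors over \<open>M\<close>\<close>

text \<open>There are four instances: \<open>L0\<close> and \<open>L1\<close>, with the identity of
  \<open>M\<close> as first projection, and \<open>coker\<close> and \<open>ker\<close>.\<close>

locale lax_over = S1: strict_functor N1 M U1 T1 + S2: strict_functor N2 M U2 T2 +
    L: is_functor N1 N2 L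
  for N1 :: "('p, 'n, 'x) monoidal_scheme" and N2 :: "('q, 'k, 'y) monoidal_scheme"
    and M :: "('o, 'm, 'z) monoidal_scheme"
    and U1 :: "'p \<Rightarrow> 'o" and T1 :: "'n \<Rightarrow> 'm" and U2 :: "'q \<Rightarrow> 'o" and T2 :: "'k \<Rightarrow> 'm"
    and L :: "('p, 'n, 'q, 'k) lax_fctr" +
  assumes mu_hom: "\<lbrakk>x \<in> Obj N1; y \<in> Obj N1\<rbrakk> \<Longrightarrow>
      LMu L x y \<in> hom N2 (Fo L x \<otimes>\<^sub>o\<^bsub>N2\<^esub> Fo L y) (Fo L (x \<otimes>\<^sub>o\<^bsub>N1\<^esub> y))"
    and eps_hom: "LEps L \<in> hom N2 (Unit N2) (Fo L (Unit N1))"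
    and U_L: "x \<in> Obj N1 \<Longrightarrow> U2 (Fo L x) = U1 x"
    and T_L: "s \<in> hom N1 a b \<Longrightarrow> T2 (Fa L s) = T1 s"
    and T_mu: "\<lbrakk>x \<in> Obj N1; y \<in> Obj N1\<rbrakk> \<Longrightarrow> T2 (LMu L x y) = Ident M (U1 x \<otimes>\<^sub>o\<^bsub>M\<^esub> U1 y)"
    and T_eps: "T2 (LEps L) = Ident M (Unit M)"
begin

lemma lax_tens_hom:
  "set xs \<subseteq> Obj N1 \<Longrightarrow>
    lax_tens N1 N2 L xs \<in> hom N2 (tens_o N2 (map (Fo L) xs)) (Fo L (tens_o N1 xs))"
proof (induction xs)
  case Nil
  then show ?case by (simp add: eps_hom)
next
  case (Cons x xs)
  then have "x \<in> Obj N1" "tens_o N1 xs \<in> Obj N1"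
    by (auto intro: S1.N.tens_o_obj)
  with Cons show ?case
    by simp (blast intro: S2.N.comp_hom S2.N.tensor_hom S2.N.ident_hom mu_hom L.obj_map)
qed

lemma T_lax_tens: "set xs \<subseteq> Obj N1 \<Longrightarrow> T2 (lax_tens N1 N2 L xs) = Ident M (tens_o M (map U1 xs))"
proof (induction xs)
  case Nil
  then show ?case by (simp add: T_eps)
next
  case (Cons x xs)
  then have x: "x \<in> Obj N1" and xs: "set xs \<subseteq> Obj N1" and t: "tens_o N1 xs \<in> Obj N1"
    by (auto intro: S1.N.tens_o_obj)
  have Ux: "U1 x \<in> Obj M" "tens_o M (map U1 xs) \<in> Obj M"
    using x xs by (auto intro!: S1.M.tens_o_obj S1.U_obj)
  note id = S2.N.ident_hom[OF L.obj_map[OF x]]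
  have "T2 (lax_tens N1 N2 L (x # xs)) =
      Ident M (U1 x \<otimes>\<^sub>o\<^bsub>M\<^esub> tens_o M (map U1 xs)) \<cdot>\<^bsub>M\<^esub> Ident M (U1 x \<otimes>\<^sub>o\<^bsub>M\<^esub> tens_o M (map U1 xs))"
    using S2.T_comp[OF S2.N.tensor_hom[OF id lax_tens_hom[OF xs]] mu_hom[OF x t]]
      S2.T_tensor[OF id lax_tens_hom[OF xs]] Cons.IH[OF xs] T_mu[OF x t] S2.T_ident[OF L.obj_map[OF x]]
      U_L[OF x] S1.U_tens_o[OF xs] S1.M.tensor_ident[OF Ux]
    by simp
  then show ?case
    using S1.M.tensor_obj[OF Ux] by simp
qed

text \<open>In a pushed composition or unit the comparison maps project to identities and drop out.
  Applied to \<open>L1\<close> and \<open>L0\<close>, starting from \<open>P\<close> over itself,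
  this places \<open>operad_box\<close> and \<open>operad_tensor\<close> over
  \<open>P\<close>.\<close>

lemma push_operad_over:
  fixes Q :: "('c, 'p, 'n) operad"
  assumes "strict_operad_functor N1 M U1 T1 C Q P"
  shows "strict_operad_functor N2 M U2 T2 C (push_operad N1 N2 L Q) P"
proof -
  interpret O: strict_operad_functor N1 M U1 T1 C Q P by fact
  have sub: "set (map2 (Ent Q) cs bss) \<subseteq> Obj N1" if "cs \<in> lists C" "bss \<in> lists (lists C)" for cs bss
  proof -
    have "Ent Q c bs \<in> Obj N1" if "(c, bs) \<in> set (zip cs bss)" for c bs
      using that \<open>cs \<in> lists C\<close> \<open>bss \<in> lists (lists C)\<close>
      by (intro O.Q.ent_obj) (auto dest: set_zip_leftD set_zip_rightD)
    then show ?thesis by auto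
  qed
  have map_Fo: "map (Fo L) (map2 (Ent Q) cs bss) = map2 (\<lambda>d cs. Fo L (Ent Q d cs)) cs bss" for cs bss
    by auto
  define R where "R = push_operad N1 N2 L Q"
  have comp: "OComp R d cs bss \<in>
        hom N2 (Ent R d cs \<otimes>\<^sub>o\<^bsub>N2\<^esub> tens_o N2 (map2 (Ent R) cs bss)) (Ent R d (concat bss))"
      "T2 (OComp R d cs bss) = OComp P d cs bss"
    if d: "d \<in> C" "cs \<in> lists C" "bss \<in> lists (lists C)" "length bss = length cs" for d cs bss
  proof -
    note e = O.Q.ent_obj[OF d(1,2)] and s = sub[OF d(2,3)]
    note t = S1.N.tens_o_obj[OF s]
    note id = S2.N.ident_hom[OF L.obj_map[OF e]]
    note lt = S2.N.tensor_hom[OF id lax_tens_hom[OF s]]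
    note mu = mu_hom[OF e t] and oc = O.Q.ocomp_hom[OF d]
    note all = S2.N.comp_hom[OF S2.N.comp_hom[OF lt mu] L.hom_map[OF oc]]
    show "OComp R d cs bss \<in>
        hom N2 (Ent R d cs \<otimes>\<^sub>o\<^bsub>N2\<^esub> tens_o N2 (map2 (Ent R) cs bss)) (Ent R d (concat bss))"
      using all unfolding R_def push_operad_def by (simp add: map_Fo del: map_map)
    have Pobj: "Ent P d cs \<in> Obj M" "tens_o M (map2 (Ent P) cs bss) \<in> Obj M"
      using O.P.ent_obj[OF d(1,2)] S1.U_obj[OF t, unfolded S1.U_tens_o[OF s] O.map_U_ent[OF d(2,3)]]
      by auto
    have "T2 (OComp R d cs bss) = T2 (Fa L (OComp Q d cs bss)) \<cdot>\<^bsub>M\<^esub>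
        (T2 (LMu L (Ent Q d cs) (tens_o N1 (map2 (Ent Q) cs bss))) \<cdot>\<^bsub>M\<^esub>
        (T2 (Ident N2 (Fo L (Ent Q d cs))) \<otimes>\<^bsub>M\<^esub> T2 (lax_tens N1 N2 L (map2 (Ent Q) cs bss))))"
      unfolding R_def push_operad_def
      by (simp only: operad.simps S2.T_comp[OF S2.N.comp_hom[OF lt mu] L.hom_map[OF oc]]
          S2.T_comp[OF lt mu] S2.T_tensor[OF id lax_tens_hom[OF s]])
    also have "\<dots> = OComp P d cs bss \<cdot>\<^bsub>M\<^esub>
        (Ident M (Ent P d cs \<otimes>\<^sub>o\<^bsub>M\<^esub> tens_o M (map2 (Ent P) cs bss)) \<cdot>\<^bsub>M\<^esub>
         Ident M (Ent P d cs \<otimes>\<^sub>o\<^bsub>M\<^esub> tens_o M (map2 (Ent P) cs bss)))"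
      by (simp only: T_L[OF oc] O.T_ocomp[OF d] T_mu[OF e t] S2.T_ident[OF L.obj_map[OF e]] U_L[OF e]
          T_lax_tens[OF s] O.map_U_ent[OF d(2,3)] O.U_ent[OF d(1,2)] S1.U_tens_o[OF s]
          S1.M.tensor_ident[OF Pobj])
    also have "\<dots> = OComp P d cs bss"
      using S1.M.tensor_obj[OF Pobj] S1.M.comp_ident_right[OF O.P.ocomp_hom[OF d]] by simp
    finally show "T2 (OComp R d cs bss) = OComp P d cs bss" .
  qed
  show ?thesis
    unfolding R_def[symmetric]
  proof unfold_locales
    fix d cs assume d: "d \<in> C" "cs \<in> lists C"
    show "Ent R d cs \<in> Obj N2" "U2 (Ent R d cs) = Ent P d cs"
      using O.Q.ent_obj[OF d] by (auto simp: R_def push_operad_def L.obj_map U_L O.U_ent[OF d])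
  next
    fix c assume c: "c \<in> C"
    note ou = O.Q.ounit_hom[OF c]
    show "OUnit R c \<in> hom N2 (Unit N2) (Ent R c [c])"
      using S2.N.comp_hom[OF eps_hom L.hom_map[OF ou]] by (simp add: R_def push_operad_def)
    show "T2 (OUnit R c) = OUnit P c"
      using S2.T_comp[OF eps_hom L.hom_map[OF ou]] T_L[OF ou] T_eps O.T_ounit[OF c]
        S1.M.comp_ident_right[OF O.P.ounit_hom[OF c]]
      by (simp add: R_def push_operad_def)
  next
    fix d cs \<sigma> assume d: "d \<in> C" "cs \<in> lists C" "\<sigma> \<in> perms (length cs)"
    show "OAct R d cs \<sigma> \<in> hom N2 (Ent R d cs) (Ent R d (reindex \<sigma> cs))"
      "T2 (OAct R d cs \<sigma>) = OAct P d cs \<sigma>"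
      using O.Q.oact_hom[OF d] T_L O.T_oact[OF d] by (auto simp: R_def push_operad_def L.hom_map)
  qed (use comp in auto)
qed

end

text \<open>Carriers of a pushed algebra occur in the sources and in the targets of its laws, so the
  image of \<open>L\<close> has to lie in both \<open>E\<close> and \<open>F\<close>.\<close>

locale algebra_functor = lax_over N1 N2 M U1 T1 U2 T2 L +
    O1: strict_operad_functor N1 M U1 T1 C Q1 P + O2: reflecting_functor N2 M U2 T2 C Q2 P E F
  for N1 :: "('p, 'n, 'x) monoidal_scheme" and N2 :: "('q, 'k, 'y) monoidal_scheme"
    and M :: "('o, 'm, 'z) monoidal_scheme"
    and U1 :: "'p \<Rightarrow> 'o" and T1 :: "'n \<Rightarrow> 'm" and U2 :: "'q \<Rightarrow> 'o" and T2 :: "'k \<Rightarrow> 'm"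
    and L :: "('p, 'n, 'q, 'k) lax_fctr"
    and C :: "'c set" and Q1 :: "('c, 'p, 'n) operad" and Q2 :: "('c, 'q, 'k) operad"
    and P :: "('c, 'o, 'm) operad" and E F :: "'q set" +
  fixes \<theta> :: "'c \<Rightarrow> 'c list \<Rightarrow> 'k"
  assumes theta_hom: "\<lbrakk>d \<in> C; cs \<in> lists C\<rbrakk> \<Longrightarrow> \<theta> d cs \<in> hom N2 (Ent Q2 d cs) (Fo L (Ent Q1 d cs))"
    and T_theta: "\<lbrakk>d \<in> C; cs \<in> lists C\<rbrakk> \<Longrightarrow> T2 (\<theta> d cs) = Ident M (Ent P d cs)"
    and L_EF: "x \<in> Obj N1 \<Longrightarrow> Fo L x \<in> E \<inter> F"
begin

abbreviation "push \<equiv> push_algebra N1 N2 L C Q1 \<theta>"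

context
  fixes A
  assumes A: "is_algebra N1 C Q1 A"
begin

lemma map_Car_push: "cs \<in> lists C \<Longrightarrow> map (Car (push A)) cs = map (Fo L) (map (Car A) cs)"
  by (auto simp: push_algebra_def)

text \<open>The factors \<open>\<theta>\<close>, \<open>LMu\<close> and \<open>lax_tens\<close> of a
  pushed structure map all project to identities, which leaves only the projection of
  \<open>Str A d cs\<close>.\<close>

lemma
  assumes d: "d \<in> C" "cs \<in> lists C"
  shows Str_push_hom:
      "Str (push A) d cs \<in> hom N2 (Ent Q2 d cs \<otimes>\<^sub>o\<^bsub>N2\<^esub> tens_o N2 (map (Car (push A)) cs)) (Car (push A) d)"
    and T_Str_push: "T2 (Str (push A) d cs) = T1 (Str A d cs)"
proof -
  have sub: "set (map (Car A) cs) \<subseteq> Obj N1"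
    using O1.Q.algebraD(4)[OF A] d by auto
  note m = O1.Q.algebraD(5)[OF A d] and t = S1.N.tens_o_obj[OF sub] and e = O1.Q.ent_obj[OF d]
  note lt = S2.N.tensor_hom[OF theta_hom[OF d] lax_tens_hom[OF sub]] and mu = mu_hom[OF e t]
  show "Str (push A) d cs \<in> hom N2 (Ent Q2 d cs \<otimes>\<^sub>o\<^bsub>N2\<^esub> tens_o N2 (map (Car (push A)) cs)) (Car (push A) d)"
    using S2.N.comp_hom[OF S2.N.comp_hom[OF lt mu] L.hom_map[OF m]] d
    by (simp add: map_Car_push[OF d(2)] del: map_map) (simp add: push_algebra_def)
  have Pobj: "Ent P d cs \<in> Obj M" "tens_o M (map U1 (map (Car A) cs)) \<in> Obj M"
    using O1.P.ent_obj[OF d] S1.U_obj[OF t] S1.U_tens_o[OF sub] by auto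
  have Tm: "T1 (Str A d cs) \<in>
      hom M (Ent P d cs \<otimes>\<^sub>o\<^bsub>M\<^esub> tens_o M (map U1 (map (Car A) cs))) (U1 (Car A d))"
    using S1.T_hom[OF m] S1.U_tensor[OF e t] S1.U_tens_o[OF sub] O1.U_ent[OF d] by simp
  have "T2 (Str (push A) d cs) = T2 (Fa L (Str A d cs)) \<cdot>\<^bsub>M\<^esub>
      (T2 (LMu L (Ent Q1 d cs) (tens_o N1 (map (Car A) cs))) \<cdot>\<^bsub>M\<^esub>
       (T2 (\<theta> d cs) \<otimes>\<^bsub>M\<^esub> T2 (lax_tens N1 N2 L (map (Car A) cs))))"
    using S2.T_comp[OF S2.N.comp_hom[OF lt mu] L.hom_map[OF m]] S2.T_comp[OF lt mu]
      S2.T_tensor[OF theta_hom[OF d] lax_tens_hom[OF sub]] d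
    by (simp add: push_algebra_def)
  also have "\<dots> = T1 (Str A d cs) \<cdot>\<^bsub>M\<^esub> (Ident M (Ent P d cs \<otimes>\<^sub>o\<^bsub>M\<^esub> tens_o M (map U1 (map (Car A) cs))) \<cdot>\<^bsub>M\<^esub>
      Ident M (Ent P d cs \<otimes>\<^sub>o\<^bsub>M\<^esub> tens_o M (map U1 (map (Car A) cs))))"
    by (simp only: T_L[OF m] T_mu[OF e t] T_theta[OF d] T_lax_tens[OF sub] O1.U_ent[OF d]
        S1.U_tens_o[OF sub] S1.M.tensor_ident[OF Pobj])
  also have "\<dots> = T1 (Str A d cs)"
    using S1.M.tensor_obj[OF Pobj] S1.M.comp_ident_right[OF Tm] by simp
  finally show "T2 (Str (push A) d cs) = T1 (Str A d cs)" .
qed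

lemma Car_push: "c \<in> C \<Longrightarrow> Car (push A) c = Fo L (Car A c)"
  by (simp add: push_algebra_def)

lemma Car_push_EF: "c \<in> C \<Longrightarrow> Car (push A) c \<in> E" "c \<in> C \<Longrightarrow> Car (push A) c \<in> F"
  using L_EF O1.Q.algebraD(4)[OF A] by (auto simp: Car_push)

text \<open>The given and the pushed data have the same projections to \<open>M\<close>. The laws of
  \<open>A\<close> are carried down by \<open>T_alg_laws\<close> and lifted again by
  \<open>is_algebraI\<close>.\<close>

lemma push_algebra: "is_algebra N2 C Q2 (push A)"
proof (rule O2.is_algebraI)
  show "Car (push A) \<in> extensional C"
    by (simp add: push_algebra_def)
  show "Str (push A) d cs = undefined" if "\<not> (d \<in> C \<and> cs \<in> lists C)" for d cs
    using that by (auto simp: push_algebra_def)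
  show typed: "alg_typed N2 C Q2 (Car (push A)) (Str (push A))"
    using Str_push_hom Car_push_EF(1) O2.E_obj by (auto simp: alg_typed_def)
  have U: "U2 (Car (push A) c) = U1 (Car A c)" if "c \<in> C" for c
    using that O1.Q.algebraD(4)[OF A] by (simp add: Car_push U_L)
  have mapU: "map (\<lambda>c. U2 (Car (push A) c)) cs = map (\<lambda>c. U1 (Car A c)) cs" if "cs \<in> lists C" for cs
    using U that by auto
  have mapmapU: "map (map (\<lambda>c. U2 (Car (push A) c))) bss = map (map (\<lambda>c. U1 (Car A c))) bss"
    if "bss \<in> lists (lists C)" for bss
    using mapU that by (intro map_cong) auto
  have mapT: "map2 (\<lambda>d cs. T2 (Str (push A) d cs)) cs bss = map2 (\<lambda>d cs. T1 (Str A d cs)) cs bss"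
    if "cs \<in> lists C" "bss \<in> lists (lists C)" for cs bss
  proof -
    have "T2 (Str (push A) c bs) = T1 (Str A c bs)" if "(c, bs) \<in> set (zip cs bss)" for c bs
      using that \<open>cs \<in> lists C\<close> \<open>bss \<in> lists (lists C)\<close>
      by (intro T_Str_push) (auto dest: set_zip_leftD set_zip_rightD)
    then show ?thesis by auto
  qed
  have con: "concat bss \<in> lists C" if "bss \<in> lists (lists C)" for bss
    using that unfolding in_lists_conv_set by auto
  have "alg_laws M C P (\<lambda>c. U1 (Car A c)) (\<lambda>d cs. T1 (Str A d cs))"
    using O1.T_alg_laws O1.Q.algebraD[OF A] by blast
  then show "alg_laws M C P (\<lambda>c. U2 (Car (push A) c)) (\<lambda>d cs. T2 (Str (push A) d cs))"
    unfolding alg_laws_def assoc_lhs_def assoc_rhs_def unit_lhs_def unit_rhs_def act_lhs_def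
    by (simp add: mapU mapmapU mapT T_Str_push con U reindex_lists del: map_map)
qed (use Car_push_EF in auto)

end

text \<open>The homomorphism equation of the pushed map is reflected in the same way as the algebra
  laws, because its projection is that of the equation for \<open>h\<close>. Preservation of
  identities and composites is inherited from \<open>L\<close> at each color.\<close>

lemma is_functor_Alg: "is_functor (Alg N1 C Q1) (Alg N2 C Q2) (Alg_fctr N1 N2 L C Q1 \<theta>)"
proof -
  interpret A1: category "Alg N1 C Q1" by (rule O1.Q.category_Alg)
  interpret A2: category "Alg N2 C Q2" by (rule O2.Q.category_Alg)
  have arr: "is_alg_arr N2 C Q2 \<lparr>ADom = push (ADom h), ACod = push (ACod h), AMap = (\<lambda>c\<in>C. Fa L (AMap h c))\<rparr>"
    if h: "is_alg_arr N1 C Q1 h" for h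
  proof (rule O2.is_alg_arrI)
    note A = O1.Q.alg_arrD(1)[OF h] and B = O1.Q.alg_arrD(2)[OF h] and hh = O1.Q.alg_arrD(4)[OF h]
    show "is_algebra N2 C Q2 (push (ADom h))" "is_algebra N2 C Q2 (push (ACod h))"
      using A B by (auto intro: push_algebra)
    show "(\<lambda>c\<in>C. Fa L (AMap h c)) c \<in> hom N2 (Car (push (ADom h)) c) (Car (push (ACod h)) c)"
      if "c \<in> C" for c
      using that L.hom_map[OF hh[OF that]] Car_push[OF A that] Car_push[OF B that] by simp
    show "Car (push (ADom h)) c \<in> E" "Car (push (ACod h)) c \<in> F" if "c \<in> C" for c
      using Car_push_EF A B that by auto
    fix d cs assume d: "d \<in> C" "cs \<in> lists C"
    have TL: "T2 (Fa L (AMap h c)) = T1 (AMap h c)" if "c \<in> C" for c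
      using T_L[OF hh[OF that]] .
    then have mapT: "map (\<lambda>c. T2 ((\<lambda>c\<in>C. Fa L (AMap h c)) c)) cs = map (\<lambda>c. T1 (AMap h c)) cs"
      using d by auto
    have "T1 (AMap h d) \<cdot>\<^bsub>M\<^esub> T1 (Str (ADom h) d cs) =
        T1 (Str (ACod h) d cs) \<cdot>\<^bsub>M\<^esub> (Ident M (Ent P d cs) \<otimes>\<^bsub>M\<^esub> tens M (map (\<lambda>c. T1 (AMap h c)) cs))"
    proof -
      note mA = O1.Q.algebraD(5)[OF A d] and mB = O1.Q.algebraD(5)[OF B d]
      note e = S1.N.ident_hom[OF O1.Q.ent_obj[OF d]]
      have th: "tens N1 (map (AMap h) cs) \<in>
          hom N1 (tens_o N1 (map (Car (ADom h)) cs)) (tens_o N1 (map (Car (ACod h)) cs))"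
        using hh d by (intro S1.N.tens_hom) auto
      have "T1 (tens N1 (map (AMap h) cs)) = tens M (map (\<lambda>c. T1 (AMap h c)) cs)"
        using hh d by (intro S1.T_tens) auto
      then show ?thesis
        using S1.T_comp[OF mA hh[OF d(1)]] S1.T_comp[OF S1.N.tensor_hom[OF e th] mB]
          S1.T_tensor[OF e th] O1.Q.alg_arrD(5)[OF h d] S1.T_ident[OF O1.Q.ent_obj[OF d]]
          O1.U_ent[OF d]
        by simp
    qed
    then show "T2 ((\<lambda>c\<in>C. Fa L (AMap h c)) d) \<cdot>\<^bsub>M\<^esub> T2 (Str (push (ADom h)) d cs) =
        T2 (Str (push (ACod h)) d cs) \<cdot>\<^bsub>M\<^esub>
        (Ident M (Ent P d cs) \<otimes>\<^bsub>M\<^esub> tens M (map (\<lambda>c. T2 ((\<lambda>c\<in>C. Fa L (AMap h c)) c)) cs))"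
      by (simp only: mapT T_Str_push[OF A d] T_Str_push[OF B d] restrict_apply'[OF d(1)] TL[OF d(1)])
  qed auto
  show ?thesis
  proof
    show "Fo (Alg_fctr N1 N2 L C Q1 \<theta>) a \<in> Obj (Alg N2 C Q2)" if "a \<in> Obj (Alg N1 C Q1)" for a
      using that by (simp add: Alg_fctr_def push_algebra)
    show "Fa (Alg_fctr N1 N2 L C Q1 \<theta>) f \<in>
        hom (Alg N2 C Q2) (Fo (Alg_fctr N1 N2 L C Q1 \<theta>) a) (Fo (Alg_fctr N1 N2 L C Q1 \<theta>) b)"
      if "f \<in> hom (Alg N1 C Q1) a b" for f a b
      using that arr by (auto simp: O1.Q.hom_Alg O2.Q.hom_Alg Alg_fctr_def)
    show "Fa (Alg_fctr N1 N2 L C Q1 \<theta>) (Ident (Alg N1 C Q1) a) =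
        Ident (Alg N2 C Q2) (Fo (Alg_fctr N1 N2 L C Q1 \<theta>) a)" if "a \<in> Obj (Alg N1 C Q1)" for a
      using that O1.Q.algebraD(4)[of a]
      by (auto simp: Alg_fctr_def L.ident_map Car_push restrict_def fun_eq_iff)
    show "Fa (Alg_fctr N1 N2 L C Q1 \<theta>) (g \<cdot>\<^bsub>Alg N1 C Q1\<^esub> f) =
        Fa (Alg_fctr N1 N2 L C Q1 \<theta>) g \<cdot>\<^bsub>Alg N2 C Q2\<^esub> Fa (Alg_fctr N1 N2 L C Q1 \<theta>) f"
      if f: "f \<in> hom (Alg N1 C Q1) a b" and g: "g \<in> hom (Alg N1 C Q1) b c" for f g a b c
    proof -
      have "Fa L (AMap g x \<cdot>\<^bsub>N1\<^esub> AMap f x) = Fa L (AMap g x) \<cdot>\<^bsub>N2\<^esub> Fa L (AMap f x)" if "x \<in> C" for x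
        using f g that O1.Q.alg_arrD(4) L.comp_map unfolding O1.Q.hom_Alg by metis
      then show ?thesis
        by (auto simp: Alg_fctr_def restrict_def fun_eq_iff)
    qed
  qed
qed

end

text \<open>Composition, identities and the induced functors act color by color, so naturality and
  the triangle identities are those of the underlying adjunction. What has to be supplied is that
  the entrywise unit and counit are homomorphisms.\<close>

lemma adjunction_Alg:
  fixes N1 :: "('p, 'n, 'x) monoidal_scheme" and N2 :: "('q, 'k, 'y) monoidal_scheme"
    and Q1 :: "('c, 'p, 'n) operad" and Q2 :: "('c, 'q, 'k) operad"
  assumes "adjunction N1 N2 L R \<eta> \<epsilon>"
    and "typed_operad N1 C Q1" and "typed_operad N2 C Q2"
    and LA: "is_functor (Alg N1 C Q1) (Alg N2 C Q2) (Alg_fctr N1 N2 L C Q1 \<theta>)"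
    and RA: "is_functor (Alg N2 C Q2) (Alg N1 C Q1) (Alg_fctr N2 N1 R C Q2 \<psi>)"
    and push: "push1 = push_algebra N1 N2 L C Q1 \<theta>" "push2 = push_algebra N2 N1 R C Q2 \<psi>"
    and unit: "\<And>A. is_algebra N1 C Q1 A \<Longrightarrow> is_alg_arr N1 C Q1
      \<lparr>ADom = A, ACod = push2 (push1 A), AMap = (\<lambda>c\<in>C. \<eta> (Car A c))\<rparr>"
    and counit: "\<And>B. is_algebra N2 C Q2 B \<Longrightarrow> is_alg_arr N2 C Q2
      \<lparr>ADom = push1 (push2 B), ACod = B, AMap = (\<lambda>c\<in>C. \<epsilon> (Car B c))\<rparr>"
  shows "adjunction (Alg N1 C Q1) (Alg N2 C Q2) (Alg_fctr N1 N2 L C Q1 \<theta>) (Alg_fctr N2 N1 R C Q2 \<psi>)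
    (\<lambda>A. \<lparr>ADom = A, ACod = push2 (push1 A), AMap = (\<lambda>c\<in>C. \<eta> (Car A c))\<rparr>)
    (\<lambda>B. \<lparr>ADom = push1 (push2 B), ACod = B, AMap = (\<lambda>c\<in>C. \<epsilon> (Car B c))\<rparr>)"
proof -
  interpret adj: adjunction N1 N2 L R \<eta> \<epsilon> by fact
  interpret O1: typed_operad N1 C Q1 by fact
  interpret O2: typed_operad N2 C Q2 by fact
  interpret LA: is_functor "Alg N1 C Q1" "Alg N2 C Q2" "Alg_fctr N1 N2 L C Q1 \<theta>" by fact
  interpret RA: is_functor "Alg N2 C Q2" "Alg N1 C Q1" "Alg_fctr N2 N1 R C Q2 \<psi>" by fact
  have Car: "Car (push1 A) c = Fo L (Car A c)" "Car (push2 B) c = Fo R (Car B c)" if "c \<in> C" for A B c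
    using that by (simp_all add: push push_algebra_def)
  note defs = Alg_fctr_def push[symmetric]
  have ext: "(\<lambda>c\<in>C. f c) = (\<lambda>c\<in>C. g c)" if "\<And>c. c \<in> C \<Longrightarrow> f c = g c" for f g :: "'c \<Rightarrow> 'b"
    using that by auto
  show ?thesis
  proof unfold_locales
    fix A assume "A \<in> Obj (Alg N1 C Q1)"
    then have A: "is_algebra N1 C Q1 A" by simp
    show "\<lparr>ADom = A, ACod = push2 (push1 A), AMap = (\<lambda>c\<in>C. \<eta> (Car A c))\<rparr> \<in>
        hom (Alg N1 C Q1) A (Fo (Alg_fctr N2 N1 R C Q2 \<psi>) (Fo (Alg_fctr N1 N2 L C Q1 \<theta>) A))"
      using unit[OF A] by (simp add: O1.hom_Alg defs)
    show "\<lparr>ADom = push1 (push2 (Fo (Alg_fctr N1 N2 L C Q1 \<theta>) A)), ACod = Fo (Alg_fctr N1 N2 L C Q1 \<theta>) A,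
          AMap = (\<lambda>c\<in>C. \<epsilon> (Car (Fo (Alg_fctr N1 N2 L C Q1 \<theta>) A) c))\<rparr> \<cdot>\<^bsub>Alg N2 C Q2\<^esub>
        Fa (Alg_fctr N1 N2 L C Q1 \<theta>) \<lparr>ADom = A, ACod = push2 (push1 A), AMap = (\<lambda>c\<in>C. \<eta> (Car A c))\<rparr> =
        Ident (Alg N2 C Q2) (Fo (Alg_fctr N1 N2 L C Q1 \<theta>) A)"
      using adj.triangle_left O1.algebraD(4)[OF A] by (auto simp: defs Car intro!: ext)
  next
    fix B assume "B \<in> Obj (Alg N2 C Q2)"
    then have B: "is_algebra N2 C Q2 B" by simp
    show "\<lparr>ADom = push1 (push2 B), ACod = B, AMap = (\<lambda>c\<in>C. \<epsilon> (Car B c))\<rparr> \<in>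
        hom (Alg N2 C Q2) (Fo (Alg_fctr N1 N2 L C Q1 \<theta>) (Fo (Alg_fctr N2 N1 R C Q2 \<psi>) B)) B"
      using counit[OF B] by (simp add: O2.hom_Alg defs)
    show "Fa (Alg_fctr N2 N1 R C Q2 \<psi>) \<lparr>ADom = push1 (push2 B), ACod = B, AMap = (\<lambda>c\<in>C. \<epsilon> (Car B c))\<rparr>
        \<cdot>\<^bsub>Alg N1 C Q1\<^esub> \<lparr>ADom = Fo (Alg_fctr N2 N1 R C Q2 \<psi>) B,
          ACod = push2 (push1 (Fo (Alg_fctr N2 N1 R C Q2 \<psi>) B)),
          AMap = (\<lambda>c\<in>C. \<eta> (Car (Fo (Alg_fctr N2 N1 R C Q2 \<psi>) B) c))\<rparr> =
        Ident (Alg N1 C Q1) (Fo (Alg_fctr N2 N1 R C Q2 \<psi>) B)"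
      using adj.triangle_right O2.algebraD(4)[OF B] by (auto simp: defs Car intro!: ext)
  next
    fix f A B assume "f \<in> hom (Alg N1 C Q1) A B"
    then have f: "is_alg_arr N1 C Q1 f" "ADom f = A" "ACod f = B" by (auto simp: O1.hom_Alg)
    show "\<lparr>ADom = B, ACod = push2 (push1 B), AMap = (\<lambda>c\<in>C. \<eta> (Car B c))\<rparr> \<cdot>\<^bsub>Alg N1 C Q1\<^esub> f =
        Fa (Alg_fctr N2 N1 R C Q2 \<psi>) (Fa (Alg_fctr N1 N2 L C Q1 \<theta>) f) \<cdot>\<^bsub>Alg N1 C Q1\<^esub>
        \<lparr>ADom = A, ACod = push2 (push1 A), AMap = (\<lambda>c\<in>C. \<eta> (Car A c))\<rparr>"
      using adj.unit_natural[OF O1.alg_arrD(4)[OF f(1)]] f by (auto simp: defs intro!: ext)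
  next
    fix g A B assume "g \<in> hom (Alg N2 C Q2) A B"
    then have g: "is_alg_arr N2 C Q2 g" "ADom g = A" "ACod g = B" by (auto simp: O2.hom_Alg)
    show "\<lparr>ADom = push1 (push2 B), ACod = B, AMap = (\<lambda>c\<in>C. \<epsilon> (Car B c))\<rparr> \<cdot>\<^bsub>Alg N2 C Q2\<^esub>
        Fa (Alg_fctr N1 N2 L C Q1 \<theta>) (Fa (Alg_fctr N2 N1 R C Q2 \<psi>) g) =
        g \<cdot>\<^bsub>Alg N2 C Q2\<^esub> \<lparr>ADom = push1 (push2 A), ACod = A, AMap = (\<lambda>c\<in>C. \<epsilon> (Car A c))\<rparr>"
      using adj.counit_natural[OF O2.alg_arrD(4)[OF g(1)]] g by (auto simp: defs intro!: ext)
  qed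
qed

section \<open>Pushouts, pullbacks and zero objects from limits and colimits\<close>

lemma pushout_universal:
  assumes "is_pushout C f g p q" "p' \<in> hom C (Cod C f) z" "q' \<in> hom C (Cod C g) z"
    "p' \<cdot>\<^bsub>C\<^esub> f = q' \<cdot>\<^bsub>C\<^esub> g"
  shows "\<exists>!u. u \<in> hom C (Cod C p) z \<and> u \<cdot>\<^bsub>C\<^esub> p = p' \<and> u \<cdot>\<^bsub>C\<^esub> q = q'"
  using assms unfolding is_pushout_def by blast

lemma pullback_universal:
  assumes "is_pullback C f g p q" "p' \<in> hom C z (Dom C f)" "q' \<in> hom C z (Dom C g)"
    "f \<cdot>\<^bsub>C\<^esub> p' = g \<cdot>\<^bsub>C\<^esub> q'"
  shows "\<exists>!u. u \<in> hom C z (Dom C p) \<and> p \<cdot>\<^bsub>C\<^esub> u = p' \<and> q \<cdot>\<^bsub>C\<^esub> u = q'"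
  using assms unfolding is_pullback_def by blast

text \<open>Small categories have their objects and arrows in \<open>'i\<close>, so spans and
  cospans must be encoded there: \<open>a\<close>, \<open>b\<close>, \<open>c\<close> are the
  objects, \<open>u\<close> and \<open>v\<close> the two non-identity arrows.\<close>

locale span_shape =
  fixes a b c u v :: 'i
  assumes dist: "distinct [a, b, c, u, v]"
begin

text \<open>Each object doubles as its own identity. In a composable pair at least one factor is an
  identity, so \<open>Comp\<close> returns the other one.\<close>

definition span_cat :: "('i, 'i) category" where
  "span_cat = \<lparr>Obj = {a, b, c}, Arr = {a, b, c, u, v},
     Dom = (\<lambda>x. if x \<in> {u, v} then a else x),
     Cod = (\<lambda>x. if x = u then b else if x = v then c else x),
     Ident = (\<lambda>x. x), Comp = (\<lambda>g f. if f \<in> {a, b, c} then g else f)\<rparr>"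

definition cospan_cat :: "('i, 'i) category" where
  "cospan_cat = \<lparr>Obj = {a, b, c}, Arr = {a, b, c, u, v},
     Dom = (\<lambda>x. if x = u then b else if x = v then c else x),
     Cod = (\<lambda>x. if x \<in> {u, v} then a else x),
     Ident = (\<lambda>x. x), Comp = (\<lambda>g f. if f \<in> {a, b, c} then g else f)\<rparr>"

text \<open>Serves both shapes: \<open>e\<close> is \<open>Cod C\<close> for a span and
  \<open>Dom C\<close> for a cospan, and \<open>x\<close> is the object shared by \<open>f\<close>
  and \<open>g\<close>.\<close>

definition diagram :: "('o, 'm, 'z) category_scheme \<Rightarrow> ('m \<Rightarrow> 'o) \<Rightarrow> 'o \<Rightarrow> 'm \<Rightarrow> 'm \<Rightarrow>
    ('i, 'i, 'o, 'm) fctr" where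
  "diagram C e x f g = (let F = (\<lambda>j. if j = b then e f else if j = c then e g else x) in
     \<lparr>Fo = F, Fa = (\<lambda>j. if j = u then f else if j = v then g else Ident C (F j))\<rparr>)"

lemma category_span: "category span_cat"
proof (unfold_locales, goal_cases)
  case (7 f x y g z h w)
  then show ?case by (simp add: span_cat_def)
qed (use dist in \<open>auto simp: span_cat_def hom_def\<close>)

lemma category_cospan: "category cospan_cat"
proof (unfold_locales, goal_cases)
  case (7 f x y g z h w)
  then show ?case by (simp add: cospan_cat_def)
qed (use dist in \<open>auto simp: cospan_cat_def hom_def\<close>)

lemma functor_span:
  assumes "category C" "f \<in> Arr C" "g \<in> Arr C" "Dom C f = Dom C g"
  shows "is_functor span_cat C (diagram C (Cod C) (Dom C f) f g)"
proof -
  interpret C: category C by fact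
  interpret J: category span_cat by (rule category_span)
  show ?thesis
    using dist assms
    by unfold_locales (auto simp: span_cat_def diagram_def Let_def hom_def)
qed

lemma functor_cospan:
  assumes "category C" "f \<in> Arr C" "g \<in> Arr C" "Cod C f = Cod C g"
  shows "is_functor cospan_cat C (diagram C (Dom C) (Cod C f) f g)"
proof -
  interpret C: category C by fact
  interpret J: category cospan_cat by (rule category_cospan)
  show ?thesis
    using dist assms
    by unfold_locales (auto simp: cospan_cat_def diagram_def Let_def hom_def)
qed

context
  fixes C :: "('o, 'm, 'z) category_scheme" and D :: "('i, 'i, 'o, 'm, 'w) fctr_scheme" and f g
  assumes cat: "category C" and arr: "f \<in> Arr C" "g \<in> Arr C" "Dom C f = Dom C g"
    and D: "Fo D a = Dom C f" "Fo D b = Cod C f" "Fo D c = Cod C g"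
      "Fa D a = Ident C (Dom C f)" "Fa D b = Ident C (Cod C f)" "Fa D c = Ident C (Cod C g)"
      "Fa D u = f" "Fa D v = g"
begin

interpretation C: category C by (rule cat)

text \<open>The diagram \<open>D\<close> is given by its values and need not be a literal
  \<open>diagram\<close>, because \<open>preserves_pushout\<close> also meets the image of a diagram
  under a functor.\<close>

lemma cocone_span_iff:
  "is_cocone span_cat C D K \<iota> \<longleftrightarrow> K \<in> Obj C \<and> \<iota> b \<in> hom C (Cod C f) K \<and> \<iota> c \<in> hom C (Cod C g) K \<and>
     \<iota> b \<cdot>\<^bsub>C\<^esub> f = \<iota> a \<and> \<iota> c \<cdot>\<^bsub>C\<^esub> g = \<iota> a"
proof
  show "K \<in> Obj C \<and> \<iota> b \<in> hom C (Cod C f) K \<and> \<iota> c \<in> hom C (Cod C g) K \<and>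
      \<iota> b \<cdot>\<^bsub>C\<^esub> f = \<iota> a \<and> \<iota> c \<cdot>\<^bsub>C\<^esub> g = \<iota> a" if "is_cocone span_cat C D K \<iota>"
    using that dist arr D by (auto simp: is_cocone_def span_cat_def)
next
  assume co: "K \<in> Obj C \<and> \<iota> b \<in> hom C (Cod C f) K \<and> \<iota> c \<in> hom C (Cod C g) K \<and>
      \<iota> b \<cdot>\<^bsub>C\<^esub> f = \<iota> a \<and> \<iota> c \<cdot>\<^bsub>C\<^esub> g = \<iota> a"
  then have "\<iota> a \<in> hom C (Dom C f) K"
    using arr C.comp_hom[of f "Dom C f" "Cod C f" "\<iota> b" K] by (simp add: hom_def)
  with co show "is_cocone span_cat C D K \<iota>"
    using dist arr D C.comp_ident_right by (auto simp: is_cocone_def span_cat_def)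
qed

lemma colimit_imp_pushout:
  assumes "is_colimit span_cat C D K \<iota>"
  shows "is_pushout C f g (\<iota> b) (\<iota> c)"
proof -
  have co: "K \<in> Obj C" "\<iota> b \<in> hom C (Cod C f) K" "\<iota> c \<in> hom C (Cod C g) K"
     "\<iota> b \<cdot>\<^bsub>C\<^esub> f = \<iota> a" "\<iota> c \<cdot>\<^bsub>C\<^esub> g = \<iota> a"
    using assms by (auto simp: is_colimit_def cocone_span_iff)
  have "\<exists>!m. m \<in> hom C K z \<and> m \<cdot>\<^bsub>C\<^esub> \<iota> b = p \<and> m \<cdot>\<^bsub>C\<^esub> \<iota> c = q"
    if pq: "p \<in> hom C (Cod C f) z" "q \<in> hom C (Cod C g) z" "p \<cdot>\<^bsub>C\<^esub> f = q \<cdot>\<^bsub>C\<^esub> g" for z p q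
  proof -
    let ?k = "\<lambda>j. if j = b then p else if j = c then q else p \<cdot>\<^bsub>C\<^esub> f"
    have "is_cocone span_cat C D z ?k"
      using pq dist by (auto simp: cocone_span_iff dest: C.homD)
    then have "\<exists>!m. m \<in> hom C K z \<and> (\<forall>j\<in>Obj span_cat. m \<cdot>\<^bsub>C\<^esub> \<iota> j = ?k j)"
      using assms by (simp add: is_colimit_def)
    \<comment> \<open>The equation at the vertex \<open>a\<close> follows from the one at
      \<open>b\<close>, so the universal property only tests the two legs.\<close>
    moreover have "(\<forall>j\<in>Obj span_cat. m \<cdot>\<^bsub>C\<^esub> \<iota> j = ?k j) \<longleftrightarrow> m \<cdot>\<^bsub>C\<^esub> \<iota> b = p \<and> m \<cdot>\<^bsub>C\<^esub> \<iota> c = q"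
      if m: "m \<in> hom C K z" for m
    proof -
      have "m \<cdot>\<^bsub>C\<^esub> \<iota> a = (m \<cdot>\<^bsub>C\<^esub> \<iota> b) \<cdot>\<^bsub>C\<^esub> f"
        using co m arr by (simp add: co(4)[symmetric] hom_def)
      then show ?thesis
        using dist by (auto simp: span_cat_def)
    qed
    ultimately show ?thesis by metis
  qed
  then show ?thesis
    using co arr by (auto simp: is_pushout_def hom_def)
qed

lemma pushout_imp_colimit:
  assumes "is_pushout C f g p q"
  shows "is_colimit span_cat C D (Cod C p) (\<lambda>j. if j = b then p else if j = c then q else p \<cdot>\<^bsub>C\<^esub> f)"
    (is "is_colimit _ _ _ _ ?k")
proof -
  have "is_cocone span_cat C D (Cod C p) ?k"
    using assms dist by (auto simp: cocone_span_iff is_pushout_def hom_def)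
  moreover have "\<exists>!m. m \<in> hom C (Cod C p) z \<and> (\<forall>j\<in>Obj span_cat. m \<cdot>\<^bsub>C\<^esub> ?k j = \<iota> j)"
    if \<iota>: "is_cocone span_cat C D z \<iota>" for z \<iota>
  proof -
    have co: "\<iota> b \<in> hom C (Cod C f) z" "\<iota> c \<in> hom C (Cod C g) z" "\<iota> b \<cdot>\<^bsub>C\<^esub> f = \<iota> a" "\<iota> c \<cdot>\<^bsub>C\<^esub> g = \<iota> a"
      using \<iota> by (auto simp: cocone_span_iff)
    then have "\<exists>!m. m \<in> hom C (Cod C p) z \<and> m \<cdot>\<^bsub>C\<^esub> p = \<iota> b \<and> m \<cdot>\<^bsub>C\<^esub> q = \<iota> c"
      by (intro pushout_universal[OF assms]) auto
    moreover have "(\<forall>j\<in>Obj span_cat. m \<cdot>\<^bsub>C\<^esub> ?k j = \<iota> j) \<longleftrightarrow> m \<cdot>\<^bsub>C\<^esub> p = \<iota> b \<and> m \<cdot>\<^bsub>C\<^esub> q = \<iota> c"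
      if m: "m \<in> hom C (Cod C p) z" for m
    proof -
      have "m \<cdot>\<^bsub>C\<^esub> (p \<cdot>\<^bsub>C\<^esub> f) = (m \<cdot>\<^bsub>C\<^esub> p) \<cdot>\<^bsub>C\<^esub> f"
        using assms m arr by (simp add: hom_def is_pushout_def)
      then show ?thesis
        using dist co by (auto simp: span_cat_def)
    qed
    ultimately show ?thesis by metis
  qed
  ultimately show ?thesis by (auto simp: is_colimit_def)
qed

end

lemma limit_imp_pullback:
  fixes C :: "('o, 'm, 'z) category_scheme"
  assumes cat: "category C" and arr: "f \<in> Arr C" "g \<in> Arr C" "Cod C f = Cod C g"
    and lim: "is_limit cospan_cat C (diagram C (Dom C) (Cod C f) f g) K \<pi>"
  shows "is_pullback C f g (\<pi> b) (\<pi> c)"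
proof -
  interpret C: category C by fact
  let ?D = "diagram C (Dom C) (Cod C f) f g"
  have cone: "is_cone cospan_cat C ?D L \<iota> \<longleftrightarrow> L \<in> Obj C \<and> \<iota> b \<in> hom C L (Dom C f) \<and>
      \<iota> c \<in> hom C L (Dom C g) \<and> f \<cdot>\<^bsub>C\<^esub> \<iota> b = \<iota> a \<and> g \<cdot>\<^bsub>C\<^esub> \<iota> c = \<iota> a" for L \<iota>
  proof
    show "L \<in> Obj C \<and> \<iota> b \<in> hom C L (Dom C f) \<and> \<iota> c \<in> hom C L (Dom C g) \<and>
        f \<cdot>\<^bsub>C\<^esub> \<iota> b = \<iota> a \<and> g \<cdot>\<^bsub>C\<^esub> \<iota> c = \<iota> a" if "is_cone cospan_cat C ?D L \<iota>"
      using that dist arr by (auto simp: is_cone_def cospan_cat_def diagram_def)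
  next
    assume co: "L \<in> Obj C \<and> \<iota> b \<in> hom C L (Dom C f) \<and> \<iota> c \<in> hom C L (Dom C g) \<and>
        f \<cdot>\<^bsub>C\<^esub> \<iota> b = \<iota> a \<and> g \<cdot>\<^bsub>C\<^esub> \<iota> c = \<iota> a"
    then have "\<iota> a \<in> hom C L (Cod C f)"
      using arr C.comp_hom[of "\<iota> b" L "Dom C f" f "Cod C f"] by (simp add: hom_def)
    with co show "is_cone cospan_cat C ?D L \<iota>"
      using dist arr C.comp_ident_left by (auto simp: is_cone_def cospan_cat_def diagram_def)
  qed
  have co: "K \<in> Obj C" "\<pi> b \<in> hom C K (Dom C f)" "\<pi> c \<in> hom C K (Dom C g)"
     "f \<cdot>\<^bsub>C\<^esub> \<pi> b = \<pi> a" "g \<cdot>\<^bsub>C\<^esub> \<pi> c = \<pi> a"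
    using lim by (auto simp: is_limit_def cone)
  have "\<exists>!m. m \<in> hom C z K \<and> \<pi> b \<cdot>\<^bsub>C\<^esub> m = p \<and> \<pi> c \<cdot>\<^bsub>C\<^esub> m = q"
    if pq: "p \<in> hom C z (Dom C f)" "q \<in> hom C z (Dom C g)" "f \<cdot>\<^bsub>C\<^esub> p = g \<cdot>\<^bsub>C\<^esub> q" for z p q
  proof -
    let ?k = "\<lambda>j. if j = b then p else if j = c then q else f \<cdot>\<^bsub>C\<^esub> p"
    have "is_cone cospan_cat C ?D z ?k"
      using pq dist by (auto simp: cone dest: C.homD)
    then have "\<exists>!m. m \<in> hom C z K \<and> (\<forall>j\<in>Obj cospan_cat. \<pi> j \<cdot>\<^bsub>C\<^esub> m = ?k j)"
      using lim by (simp add: is_limit_def)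
    moreover have "(\<forall>j\<in>Obj cospan_cat. \<pi> j \<cdot>\<^bsub>C\<^esub> m = ?k j) \<longleftrightarrow> \<pi> b \<cdot>\<^bsub>C\<^esub> m = p \<and> \<pi> c \<cdot>\<^bsub>C\<^esub> m = q"
      if m: "m \<in> hom C z K" for m
    proof -
      have "\<pi> a \<cdot>\<^bsub>C\<^esub> m = f \<cdot>\<^bsub>C\<^esub> (\<pi> b \<cdot>\<^bsub>C\<^esub> m)"
        using co m arr by (simp add: co(4)[symmetric] hom_def)
      then show ?thesis
        using dist by (auto simp: cospan_cat_def)
    qed
    ultimately show ?thesis by metis
  qed
  then show ?thesis
    using co arr by (auto simp: is_pullback_def hom_def)
qed

text \<open>The square is read as a colimit over the span shape, carried along by \<open>F\<close>,
  and read back as a pushout.\<close>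

lemma preserves_pushout:
  assumes F: "is_functor A B F" and pres: "preserves_colimits TYPE('i) A B F"
    and po: "is_pushout A f g p q"
  shows "is_pushout B (Fa F f) (Fa F g) (Fa F p) (Fa F q)"
proof -
  interpret F: is_functor A B F by fact
  have arr: "f \<in> Arr A" "g \<in> Arr A" "Dom A f = Dom A g"
    using po by (auto simp: is_pushout_def)
  have Farr: "Fa F h \<in> hom B (Fo F (Dom A h)) (Fo F (Cod A h))" if "h \<in> Arr A" for h
    using F.hom_map[of h] that by (simp add: hom_def)
  let ?D = "diagram A (Cod A) (Dom A f) f g"
  let ?k = "\<lambda>j. if j = b then p else if j = c then q else p \<cdot>\<^bsub>A\<^esub> f"
  have "is_colimit span_cat A ?D (Cod A p) ?k"
    by (rule pushout_imp_colimit[OF F.A.category_axioms arr _ _ _ _ _ _ _ _ po])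
      (use dist in \<open>auto simp: diagram_def Let_def\<close>)
  then have "is_colimit span_cat B \<lparr>Fo = (\<lambda>j. Fo F (Fo ?D j)), Fa = (\<lambda>u. Fa F (Fa ?D u))\<rparr>
      (Fo F (Cod A p)) (\<lambda>j. Fa F (?k j))"
    using pres functor_span[OF F.A.category_axioms arr] unfolding preserves_colimits_def by blast
  then have "is_pushout B (Fa F f) (Fa F g) (Fa F (?k b)) (Fa F (?k c))"
    by (rule colimit_imp_pushout[rotated -1, OF _ F.B.category_axioms])
      (use dist arr Farr[of f] Farr[of g] in
        \<open>auto simp: diagram_def Let_def hom_def F.ident_map\<close>)
  then show ?thesis
    using dist by auto
qed

end

text \<open>This is where the infinity of the universe enters: some five of its elements can be
  listed without repetition.\<close>

lemma ex_span_shape: "\<exists>a b c u v :: 'i :: infinite. span_shape a b c u v"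
proof -
  obtain S :: "'i set" where S: "finite S" "card S = 5"
    using infinite_arbitrarily_large[OF infinite_UNIV, of 5] by blast
  then obtain xs where xs: "set xs = S" "distinct xs"
    using finite_distinct_list by blast
  then have "length xs = Suc (Suc (Suc (Suc (Suc 0))))"
    using S distinct_card[of xs] by simp
  then obtain a b c u v where "xs = [a, b, c, u, v]"
    by (auto simp: length_Suc_conv)
  with xs show ?thesis
    unfolding span_shape_def by blast
qed

definition empty_cat :: "('i, 'i) category" where
  "empty_cat = \<lparr>Obj = {}, Arr = {}, Dom = undefined, Cod = undefined, Ident = undefined,
     Comp = undefined\<rparr>"

lemma initial_iff_colimit: "is_colimit empty_cat C D a \<iota> \<longleftrightarrow> is_initial C a"
  by (simp add: is_colimit_def is_initial_def is_cocone_def empty_cat_def Ball_def)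

lemma functor_empty: "category C \<Longrightarrow> is_functor empty_cat C D"
  by (simp add: is_functor_def is_functor_axioms_def category_def empty_cat_def hom_def)

text \<open>An initial object is a colimit over the empty shape, on which any diagram is vacuously a
  functor; hence \<open>undefined\<close> can serve as diagram and as cocone.\<close>

lemma preserves_initial:
  fixes A :: "('o, 'm, 'y) category_scheme"
  assumes "category A" "preserves_colimits TYPE('i) A B F" "is_initial A a"
  shows "is_initial B (Fo F a)"
proof -
  let ?D = "undefined :: ('i, 'i, 'o, 'm) fctr"
  have "is_functor empty_cat A ?D" "is_colimit empty_cat A ?D a undefined"
    using assms by (simp_all add: functor_empty initial_iff_colimit)
  then have "is_colimit empty_cat B \<lparr>Fo = (\<lambda>j. Fo F (Fo ?D j)), Fa = (\<lambda>u. Fa F (Fa ?D u))\<rparr>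
      (Fo F a) (\<lambda>j. Fa F (undefined j))"
    using assms(2)[unfolded preserves_colimits_def, rule_format, of empty_cat ?D a undefined] by blast
  then show ?thesis
    by (simp only: initial_iff_colimit)
qed

section \<open>Initial and terminal objects\<close>

context category
begin

lemma initial_arr_eq: "\<lbrakk>is_initial C a; f \<in> hom C a b; g \<in> hom C a b\<rbrakk> \<Longrightarrow> f = g"
  using homD[of f a b] unfolding is_initial_def by blast

lemma terminal_arr_eq: "\<lbrakk>is_terminal C b; f \<in> hom C a b; g \<in> hom C a b\<rbrakk> \<Longrightarrow> f = g"
  using homD[of f a b] unfolding is_terminal_def by blast

text \<open>Two maps out of \<open>b\<close> agree after precomposition with \<open>f\<close>, and
  the section \<open>g\<close> cancels \<open>f\<close>. The lemma serves twice: for the isomorphism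
  provided by pointedness and for passing between two terminal objects.\<close>

lemma initial_iso:
  assumes a: "is_initial C a" and fg: "f \<in> hom C a b" "g \<in> hom C b a" "f \<cdot> g = Ident C b"
  shows "is_initial C b"
proof -
  have "\<exists>!h. h \<in> hom C b z" if z: "z \<in> Obj C" for z
  proof -
    obtain h where h: "h \<in> hom C a z"
      using a z by (auto simp: is_initial_def)
    have "k = l" if kl: "k \<in> hom C b z" "l \<in> hom C b z" for k l
    proof -
      have "k \<cdot> f = l \<cdot> f"
        using a comp_hom[OF fg(1)] kl by (blast intro: initial_arr_eq)
      then have "(k \<cdot> f) \<cdot> g = (l \<cdot> f) \<cdot> g" by simp
      then show ?thesis
        using comp_assoc[OF fg(2,1)] kl comp_ident_right fg(3) by simp
    qed
    then show ?thesis
      using comp_hom[OF fg(2) h] by blast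
  qed
  then show ?thesis
    using homD[OF fg(1)] by (auto simp: is_initial_def)
qed

end


section \<open>Pointed monoidal categories\<close>

text \<open>The universe \<open>'i\<close> disappears here: from now on only pushouts, pullbacks,
  the zero object and their behaviour under tensoring are visible. \<open>initial_term\<close>
  concerns the chosen terminal object, the one from which cokernels and kernels are formed.\<close>

locale pointed_monoidal = symmetric_monoidal M for M :: "('o, 'm, 'z) monoidal_scheme" (structure) +
  assumes ex_pushout: "\<lbrakk>f \<in> Arr M; g \<in> Arr M; Dom M f = Dom M g\<rbrakk> \<Longrightarrow> \<exists>p q. is_pushout M f g p q"
    and ex_pullback: "\<lbrakk>f \<in> Arr M; g \<in> Arr M; Cod M f = Cod M g\<rbrakk> \<Longrightarrow> \<exists>p q. is_pullback M f g p q"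
    and initial_init: "is_initial M (init_obj M)"
    and terminal_term: "is_terminal M (term_obj M)"
    and initial_term: "is_initial M (term_obj M)"
    and tensor_left_pushout: "\<lbrakk>x \<in> Obj M; is_pushout M f g p q\<rbrakk> \<Longrightarrow>
      is_pushout M (Ident M x \<otimes> f) (Ident M x \<otimes> g) (Ident M x \<otimes> p) (Ident M x \<otimes> q)"
    and tensor_right_pushout: "\<lbrakk>x \<in> Obj M; is_pushout M f g p q\<rbrakk> \<Longrightarrow>
      is_pushout M (f \<otimes> Ident M x) (g \<otimes> Ident M x) (p \<otimes> Ident M x) (q \<otimes> Ident M x)"
    and tensor_left_initial: "\<lbrakk>x \<in> Obj M; is_initial M a\<rbrakk> \<Longrightarrow> is_initial M (x \<otimes>\<^sub>o a)"
    and tensor_right_initial: "\<lbrakk>x \<in> Obj M; is_initial M a\<rbrakk> \<Longrightarrow> is_initial M (a \<otimes>\<^sub>o x)"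

lemma pointed_monoidalI:
  fixes M :: "('o, 'm, 'z) monoidal_scheme"
  assumes M: "symmetric_monoidal M"
    and comp: "complete_cat TYPE('i::infinite) M" "cocomplete_cat TYPE('i) M"
    and ptd: "pointed M"
    and pres: "tensor_preserves_colimits TYPE('i) M"
  shows "pointed_monoidal M"
proof -
  interpret symmetric_monoidal M by fact
  obtain a b c u v :: 'i where "span_shape a b c u v"
    using ex_span_shape by blast
  then interpret span_shape a b c u v .
  have left: "is_functor M M (tensor_left M x)" and right: "is_functor M M (tensor_right M x)"
    if x: "x \<in> Obj M" for x
  proof -
    note id = ident_hom[OF x]
    \<comment> \<open>The identity of the fixed factor is written as a composite so that
      \<open>tensor_comp\<close> yields preservation of composition.\<close>
    have split: "Ident M x = Ident M x \<cdot>\<^bsub>M\<^esub> Ident M x"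
      using x by simp
    show "is_functor M M (tensor_left M x)"
      using x tensor_hom[OF id] tensor_comp[OF id id] split
      by unfold_locales (auto simp: tensor_left_def tensor_obj tensor_ident)
    show "is_functor M M (tensor_right M x)"
      using x tensor_hom[OF _ id] tensor_comp[OF _ _ id id] split
      by unfold_locales (auto simp: tensor_right_def tensor_obj tensor_ident)
  qed
  have pl: "preserves_colimits TYPE('i) M M (tensor_left M x)"
    and pr: "preserves_colimits TYPE('i) M M (tensor_right M x)" if "x \<in> Obj M" for x
    using pres that by (auto simp: tensor_preserves_colimits_def)
  obtain i t k where it: "is_initial M i" "is_terminal M t" "k \<in> hom M i t" "is_iso M k"
    using ptd by (auto simp: pointed_def)
  have init: "is_initial M (init_obj M)"
    unfolding init_obj_def using it(1) by (rule someI)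
  have tm: "is_terminal M (term_obj M)"
    unfolding term_obj_def using it(2) by (rule someI)
  have "is_initial M t"
    using it inverse_arrows_inverse_of[OF it(4)]
    by (intro initial_iso[of i k t "inverse_of M k"]) (auto simp: inverse_arrows_def hom_def)
  \<comment> \<open>\<open>term_obj M\<close> may differ from the terminal object \<open>t\<close>
    of the pointedness assumption; initiality is transported along the arrows between them.\<close>
  moreover obtain l m where lm: "l \<in> hom M t (term_obj M)" "m \<in> hom M (term_obj M) t"
    using it(2) tm unfolding is_terminal_def by blast
  moreover have "l \<cdot>\<^bsub>M\<^esub> m = Ident M (term_obj M)"
    using terminal_arr_eq[OF tm] comp_hom[OF lm(2,1)] ident_hom[of "term_obj M"] homD[OF lm(2)]
    by blast
  ultimately have term_init: "is_initial M (term_obj M)"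
    by (rule initial_iso)
  show ?thesis
  proof unfold_locales
    fix f g assume fg: "f \<in> Arr M" "g \<in> Arr M"
    show "\<exists>p q. is_pushout M f g p q" if eq: "Dom M f = Dom M g"
    proof -
      obtain K \<iota> where "is_colimit span_cat M (diagram M (Cod M) (Dom M f) f g) K \<iota>"
        using comp(2) functor_span[OF category_axioms fg eq] unfolding cocomplete_cat_def by blast
      then have "is_pushout M f g (\<iota> b) (\<iota> c)"
        by (rule colimit_imp_pushout[rotated -1, OF _ category_axioms fg eq])
          (use dist in \<open>auto simp: diagram_def Let_def\<close>)
      then show ?thesis by blast
    qed
    show "\<exists>p q. is_pullback M f g p q" if "Cod M f = Cod M g"
      using comp(1) functor_cospan[OF category_axioms fg that]
        limit_imp_pullback[OF category_axioms fg that]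
      unfolding complete_cat_def by blast
  next
    fix x f g p q assume x: "x \<in> Obj M" and po: "is_pushout M f g p q"
    show "is_pushout M (Ident M x \<otimes>\<^bsub>M\<^esub> f) (Ident M x \<otimes>\<^bsub>M\<^esub> g) (Ident M x \<otimes>\<^bsub>M\<^esub> p) (Ident M x \<otimes>\<^bsub>M\<^esub> q)"
      using preserves_pushout[OF left[OF x] pl[OF x] po] by (simp add: tensor_left_def)
    show "is_pushout M (f \<otimes>\<^bsub>M\<^esub> Ident M x) (g \<otimes>\<^bsub>M\<^esub> Ident M x) (p \<otimes>\<^bsub>M\<^esub> Ident M x) (q \<otimes>\<^bsub>M\<^esub> Ident M x)"
      using preserves_pushout[OF right[OF x] pr[OF x] po] by (simp add: tensor_right_def)
  next
    fix x e assume x: "x \<in> Obj M" and e: "is_initial M e"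
    show "is_initial M (x \<otimes>\<^sub>o\<^bsub>M\<^esub> e)"
      using preserves_initial[OF category_axioms pl[OF x] e] by (simp add: tensor_left_def)
    show "is_initial M (e \<otimes>\<^sub>o\<^bsub>M\<^esub> x)"
      using preserves_initial[OF category_axioms pr[OF x] e] by (simp add: tensor_right_def)
  qed (fact init tm term_init)+
qed

section \<open>Zero arrows, and cokernels as a property\<close>

definition zero_arr :: "('o, 'm, 'z) category_scheme \<Rightarrow> 'o \<Rightarrow> 'o \<Rightarrow> 'm" where
  "zero_arr C x y = from_term C y \<cdot>\<^bsub>C\<^esub> to_term C x"

text \<open>A property of \<open>c\<close> and not a chosen object:
  \<open>coker f \<otimes> coker g\<close> is a cokernel of the pushout product but in general not
  the chosen one.\<close>

definition is_coker :: "('o, 'm, 'z) category_scheme \<Rightarrow> 'm \<Rightarrow> 'm \<Rightarrow> bool" where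
  "is_coker C f c \<longleftrightarrow> f \<in> Arr C \<and> c \<in> Arr C \<and> Dom C c = Cod C f \<and>
     c \<cdot>\<^bsub>C\<^esub> f = zero_arr C (Dom C f) (Cod C c) \<and>
     (\<forall>h\<in>Arr C. Dom C h = Cod C f \<and> h \<cdot>\<^bsub>C\<^esub> f = zero_arr C (Dom C f) (Cod C h) \<longrightarrow>
       (\<exists>!k. k \<in> hom C (Cod C c) (Cod C h) \<and> k \<cdot>\<^bsub>C\<^esub> c = h))"

definition is_epi :: "('o, 'm, 'z) category_scheme \<Rightarrow> 'm \<Rightarrow> bool" where
  "is_epi C c \<longleftrightarrow> c \<in> Arr C \<and> (\<forall>k\<in>Arr C. \<forall>l\<in>Arr C. Dom C k = Cod C c \<and> Dom C l = Cod C c \<and>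
     Cod C k = Cod C l \<and> k \<cdot>\<^bsub>C\<^esub> c = l \<cdot>\<^bsub>C\<^esub> c \<longrightarrow> k = l)"

definition is_mono :: "('o, 'm, 'z) category_scheme \<Rightarrow> 'm \<Rightarrow> bool" where
  "is_mono C c \<longleftrightarrow> c \<in> Arr C \<and> (\<forall>k\<in>Arr C. \<forall>l\<in>Arr C. Cod C k = Dom C c \<and> Cod C l = Dom C c \<and>
     Dom C k = Dom C l \<and> c \<cdot>\<^bsub>C\<^esub> k = c \<cdot>\<^bsub>C\<^esub> l \<longrightarrow> k = l)"

context pointed_monoidal
begin

lemma tensor_arr [simp]:
  assumes "f \<in> Arr M" "g \<in> Arr M"
  shows "f \<otimes> g \<in> Arr M" "Dom M (f \<otimes> g) = Dom M f \<otimes>\<^sub>o Dom M g" "Cod M (f \<otimes> g) = Cod M f \<otimes>\<^sub>o Cod M g"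
  using tensor_hom[of f "Dom M f" "Cod M f" g "Dom M g" "Cod M g"] assms by (auto simp: hom_def)

lemma tensor_merge [simp]:
  assumes "f \<in> Arr M" "f' \<in> Arr M" "g \<in> Arr M" "g' \<in> Arr M" "Dom M f' = Cod M f" "Dom M g' = Cod M g"
  shows "(f' \<otimes> g') \<cdot> (f \<otimes> g) = (f' \<cdot> f) \<otimes> (g' \<cdot> g)"
  using tensor_comp[of f "Dom M f" "Cod M f" f' "Cod M f'" g "Dom M g" "Cod M g" g' "Cod M g'"] assms
  by (simp add: hom_def)

text \<open>With composites nested to the right, two adjacent tensor products of arrows usually
  stand before a further factor \<open>k\<close>.\<close>

lemma tensor_merge2 [simp]:
  assumes "f \<in> Arr M" "f' \<in> Arr M" "g \<in> Arr M" "g' \<in> Arr M" "Dom M f' = Cod M f" "Dom M g' = Cod M g"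
    "k \<in> Arr M" "Cod M k = Dom M f \<otimes>\<^sub>o Dom M g"
  shows "(f' \<otimes> g') \<cdot> ((f \<otimes> g) \<cdot> k) = ((f' \<cdot> f) \<otimes> (g' \<cdot> g)) \<cdot> k"
proof -
  have "(f' \<otimes> g') \<cdot> ((f \<otimes> g) \<cdot> k) = ((f' \<otimes> g') \<cdot> (f \<otimes> g)) \<cdot> k"
    using assms by (intro comp_assoc_arr[symmetric]) simp_all
  then show ?thesis
    by (simp only: tensor_merge[OF assms(1-6)])
qed

declare tensor_obj [simp] tensor_ident [simp] unit_obj [simp]

lemma init_obj [simp]: "init_obj M \<in> Obj M"
  using initial_init by (simp add: is_initial_def)

lemma the_arr_initial:
  assumes "is_initial M a" "x \<in> Obj M"
  shows "the_arr M a x \<in> hom M a x"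
  unfolding the_arr_def by (rule theI') (use assms in \<open>simp add: is_initial_def\<close>)

lemma the_arr_terminal:
  assumes "is_terminal M a" "x \<in> Obj M"
  shows "the_arr M x a \<in> hom M x a"
  unfolding the_arr_def by (rule theI') (use assms in \<open>simp add: is_terminal_def\<close>)

lemma from_term [simp]:
  assumes "x \<in> Obj M"
  shows "from_term M x \<in> Arr M" "Dom M (from_term M x) = term_obj M" "Cod M (from_term M x) = x"
  using the_arr_initial[OF initial_term assms] by (auto simp: from_term_def hom_def)

lemma to_term [simp]:
  assumes "x \<in> Obj M"
  shows "to_term M x \<in> Arr M" "Dom M (to_term M x) = x" "Cod M (to_term M x) = term_obj M"
  using the_arr_terminal[OF terminal_term assms] by (auto simp: to_term_def hom_def)

lemma from_term_unique: "\<lbrakk>f \<in> Arr M; Dom M f = term_obj M; Cod M f = x\<rbrakk> \<Longrightarrow> f = from_term M x"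
  by (rule initial_arr_eq[OF initial_term, of _ x]) (auto simp: hom_def)

lemma to_term_unique: "\<lbrakk>f \<in> Arr M; Cod M f = term_obj M; Dom M f = x\<rbrakk> \<Longrightarrow> f = to_term M x"
  by (rule terminal_arr_eq[OF terminal_term, of _ x]) (auto simp: hom_def)

lemma zero_arr [simp]:
  assumes "x \<in> Obj M" "y \<in> Obj M"
  shows "zero_arr M x y \<in> Arr M" "Dom M (zero_arr M x y) = x" "Cod M (zero_arr M x y) = y"
  using assms by (auto simp: zero_arr_def)

text \<open>By uniqueness of arrows out of \<open>a\<close>, the arrow \<open>g\<close> factors
  through the zero object. Allowing any initial object covers tensor products with the zero object
  as well.\<close>

lemma zero_through_initial:
  assumes "is_initial M a" "f \<in> Arr M" "g \<in> Arr M" "Cod M f = a" "Dom M g = a"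
  shows "g \<cdot> f = zero_arr M (Dom M f) (Cod M g)"
proof -
  have a: "a \<in> Obj M" using assms(1) by (simp add: is_initial_def)
  have "g = from_term M (Cod M g) \<cdot> to_term M a"
    using assms a by (intro initial_arr_eq[OF assms(1), of _ "Cod M g"]) (auto simp: hom_def)
  then have "g \<cdot> f = from_term M (Cod M g) \<cdot> (to_term M a \<cdot> f)"
    using assms a comp_assoc_arr[of f "to_term M a" "from_term M (Cod M g)"] by auto
  also have "to_term M a \<cdot> f = to_term M (Dom M f)"
    using assms a by (intro to_term_unique) auto
  finally show ?thesis by (simp add: zero_arr_def)
qed

lemma zero_comp_left [simp]:
  "\<lbrakk>f \<in> Arr M; Cod M f = x; y \<in> Obj M\<rbrakk> \<Longrightarrow> zero_arr M x y \<cdot> f = zero_arr M (Dom M f) y"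
  using zero_through_initial[OF initial_term, of "to_term M x \<cdot> f" "from_term M y"]
  by (auto simp: zero_arr_def)

lemma zero_comp_right [simp]:
  "\<lbrakk>f \<in> Arr M; Dom M f = y; x \<in> Obj M\<rbrakk> \<Longrightarrow> f \<cdot> zero_arr M x y = zero_arr M x (Cod M f)"
  using zero_through_initial[OF initial_term, of "to_term M x" "f \<cdot> from_term M y"]
  by (auto simp: zero_arr_def)

text \<open>The tensored arrow factors through the tensor product of an object with the zero object,
  which is again initial.\<close>

lemma tensor_zero [simp]:
  assumes "f \<in> Arr M" "x \<in> Obj M" "y \<in> Obj M"
  shows "f \<otimes> zero_arr M x y = zero_arr M (Dom M f \<otimes>\<^sub>o x) (Cod M f \<otimes>\<^sub>o y)"
    and "zero_arr M x y \<otimes> f = zero_arr M (x \<otimes>\<^sub>o Dom M f) (y \<otimes>\<^sub>o Cod M f)"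
proof -
  have "f \<otimes> zero_arr M x y = (f \<otimes> from_term M y) \<cdot> (Ident M (Dom M f) \<otimes> to_term M x)"
    using assms by (simp add: zero_arr_def)
  also have "\<dots> = zero_arr M (Dom M f \<otimes>\<^sub>o x) (Cod M f \<otimes>\<^sub>o y)"
    using assms by (subst zero_through_initial[OF tensor_left_initial[OF _ initial_term, of "Dom M f"]]) auto
  finally show "f \<otimes> zero_arr M x y = zero_arr M (Dom M f \<otimes>\<^sub>o x) (Cod M f \<otimes>\<^sub>o y)" .
  have "zero_arr M x y \<otimes> f = (from_term M y \<otimes> f) \<cdot> (to_term M x \<otimes> Ident M (Dom M f))"
    using assms by (simp add: zero_arr_def)
  also have "\<dots> = zero_arr M (x \<otimes>\<^sub>o Dom M f) (y \<otimes>\<^sub>o Cod M f)"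
    using assms by (subst zero_through_initial[OF tensor_right_initial[OF _ initial_term, of "Dom M f"]]) auto
  finally show "zero_arr M x y \<otimes> f = zero_arr M (x \<otimes>\<^sub>o Dom M f) (y \<otimes>\<^sub>o Cod M f)" .
qed


subsection \<open>Cokernels and kernels\<close>

lemma is_cokerD:
  assumes "is_coker M f c"
  shows "f \<in> Arr M" "c \<in> Arr M" "Dom M c = Cod M f" "c \<cdot> f = zero_arr M (Dom M f) (Cod M c)"
  using assms by (auto simp: is_coker_def)

lemma is_coker_universal:
  assumes "is_coker M f c" "h \<in> Arr M" "Dom M h = Cod M f" "h \<cdot> f = zero_arr M (Dom M f) (Cod M h)"
  shows "\<exists>!k. k \<in> hom M (Cod M c) (Cod M h) \<and> k \<cdot> c = h"
  using assms unfolding is_coker_def by blast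

lemma is_coker_factor:
  assumes "is_coker M f c" "h \<in> Arr M" "Dom M h = Cod M f" "h \<cdot> f = zero_arr M (Dom M f) (Cod M h)"
  obtains k where "k \<in> Arr M" "Dom M k = Cod M c" "Cod M k = Cod M h" "k \<cdot> c = h"
  using is_coker_universal[OF assms] unfolding hom_def by blast

lemma is_coker_epi:
  assumes c: "is_coker M f c"
  shows "is_epi M c"
  unfolding is_epi_def
proof (intro conjI ballI impI)
  fix k l
  assume kl: "k \<in> Arr M" "l \<in> Arr M"
    "Dom M k = Cod M c \<and> Dom M l = Cod M c \<and> Cod M k = Cod M l \<and> k \<cdot> c = l \<cdot> c"
  note p = is_cokerD[OF c]
  have "(k \<cdot> c) \<cdot> f = zero_arr M (Dom M f) (Cod M k)"
    using p kl comp_assoc_arr[of f c k] by simp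
  then have "\<exists>!m. m \<in> hom M (Cod M c) (Cod M (k \<cdot> c)) \<and> m \<cdot> c = k \<cdot> c"
    using p kl by (intro is_coker_universal[OF c]) (simp_all del: comp_assoc_arr)
  moreover have "k \<in> hom M (Cod M c) (Cod M (k \<cdot> c))" "l \<in> hom M (Cod M c) (Cod M (k \<cdot> c))"
    using p kl by (simp_all add: hom_def)
  ultimately show "k = l"
    using kl by metis
qed (use is_cokerD[OF c] in auto)

text \<open>Applied to \<open>t : x \<otimes> X\<^sub>0 \<rightarrow> x \<otimes> *\<close>, this shows that tensoring preserves cokernels.\<close>

lemma pushout_zero_is_coker:
  assumes po: "is_pushout M f t c q" and a: "is_initial M (Cod M t)"
  shows "is_coker M f c"
proof -
  have p: "f \<in> Arr M" "t \<in> Arr M" "c \<in> Arr M" "q \<in> Arr M" "Dom M f = Dom M t" "Dom M c = Cod M f"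
    "Dom M q = Cod M t" "Cod M c = Cod M q" "c \<cdot> f = q \<cdot> t"
    using po by (auto simp: is_pushout_def)
  have "\<exists>!k. k \<in> hom M (Cod M c) (Cod M h) \<and> k \<cdot> c = h"
    if h: "h \<in> Arr M" "Dom M h = Cod M f" "h \<cdot> f = zero_arr M (Dom M f) (Cod M h)" for h
  proof -
    \<comment> \<open>The second leg of the competing cocone has to be the unique arrow out of an
      initial object, and the equation on it holds automatically. What remains of the pushout
      property is the cokernel property.\<close>
    obtain r where r: "r \<in> hom M (Cod M t) (Cod M h)"
      using a h unfolding is_initial_def by (meson arr_obj(2))
    then have "r \<cdot> t = zero_arr M (Dom M f) (Cod M h)"
      using zero_through_initial[OF a p(2), of r] p by (simp add: hom_def)
    then have "\<exists>!k. k \<in> hom M (Cod M c) (Cod M h) \<and> k \<cdot> c = h \<and> k \<cdot> q = r"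
      using h r by (intro pushout_universal[OF po]) (auto simp: hom_def)
    moreover have "k \<cdot> q = r" if "k \<in> hom M (Cod M c) (Cod M h)" for k
      using that p r by (intro initial_arr_eq[OF a _ r]) (auto simp: hom_def)
    ultimately show ?thesis by blast
  qed
  moreover have "c \<cdot> f = zero_arr M (Dom M f) (Cod M c)"
    using zero_through_initial[OF a p(2,4)] p by simp
  ultimately show ?thesis
    using p by (simp add: is_coker_def)
qed

text \<open>Tensoring is known to preserve pushouts, so cokernels must be presented as such; arrows
  out of the zero object are unique, which settles the second leg.\<close>

lemma is_coker_pushout:
  assumes c: "is_coker M f c"
  shows "is_pushout M f (to_term M (Dom M f)) c (from_term M (Cod M c))"
proof -
  note p = is_cokerD[OF c]
  have "\<exists>!k. k \<in> hom M (Cod M c) z \<and> k \<cdot> c = h \<and> k \<cdot> from_term M (Cod M c) = q"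
    if h: "h \<in> hom M (Cod M f) z" "q \<in> hom M (term_obj M) z" "h \<cdot> f = q \<cdot> to_term M (Dom M f)" for z h q
  proof -
    have q: "q = from_term M z"
      using h by (intro from_term_unique) (auto simp: hom_def)
    have "\<exists>!k. k \<in> hom M (Cod M c) (Cod M h) \<and> k \<cdot> c = h"
      using h q by (intro is_coker_universal[OF c]) (auto simp: hom_def zero_arr_def)
    moreover have "k \<cdot> from_term M (Cod M c) = q" if "k \<in> hom M (Cod M c) z" for k
      unfolding q using that p by (intro from_term_unique) (auto simp: hom_def)
    moreover have "Cod M h = z"
      using h by (simp add: hom_def)
    ultimately show ?thesis by blast
  qed
  then show ?thesis
    using p by (simp add: is_pushout_def zero_arr_def)
qed

lemma is_coker_tensor:
  assumes c: "is_coker M f c" and x: "x \<in> Obj M"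
  shows "is_coker M (Ident M x \<otimes> f) (Ident M x \<otimes> c)" "is_coker M (f \<otimes> Ident M x) (c \<otimes> Ident M x)"
  using pushout_zero_is_coker[OF tensor_left_pushout[OF x is_coker_pushout[OF c]]]
    pushout_zero_is_coker[OF tensor_right_pushout[OF x is_coker_pushout[OF c]]]
    tensor_left_initial[OF x initial_term] tensor_right_initial[OF x initial_term] is_cokerD[OF c] x
  by auto

lemma po_prop:
  assumes "f \<in> Arr M" "g \<in> Arr M" "Dom M f = Dom M g"
  shows "is_pushout M f g (po_inl M f g) (po_inr M f g)"
proof -
  have "\<exists>pq. is_pushout M f g (fst pq) (snd pq)"
    using ex_pushout[OF assms] by simp
  then show ?thesis
    unfolding po_inl_def po_inr_def by (rule someI_ex)
qed

lemma pb_prop: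
  assumes "f \<in> Arr M" "g \<in> Arr M" "Cod M f = Cod M g"
  shows "is_pullback M f g (pb_fst M f g) (pb_snd M f g)"
proof -
  have "\<exists>pq. is_pullback M f g (fst pq) (snd pq)"
    using ex_pullback[OF assms] by simp
  then show ?thesis
    unfolding pb_fst_def pb_snd_def by (rule someI_ex)
qed

lemma copair_prop:
  assumes "f \<in> Arr M" "g \<in> Arr M" "Dom M f = Dom M g"
    and "p \<in> Arr M" "q \<in> Arr M" "Dom M p = Cod M f" "Dom M q = Cod M g" "Cod M p = Cod M q"
    and "p \<cdot> f = q \<cdot> g"
  shows "copair M f g p q \<in> hom M (po_obj M f g) (Cod M p)"
    and "copair M f g p q \<cdot> po_inl M f g = p" "copair M f g p q \<cdot> po_inr M f g = q"
proof -
  have "\<exists>!u. u \<in> hom M (po_obj M f g) (Cod M p) \<and> u \<cdot> po_inl M f g = p \<and> u \<cdot> po_inr M f g = q"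
    unfolding po_obj_def using assms
    by (intro pushout_universal[OF po_prop]) (auto simp: hom_def)
  from theI'[OF this] show "copair M f g p q \<in> hom M (po_obj M f g) (Cod M p)"
    and "copair M f g p q \<cdot> po_inl M f g = p" "copair M f g p q \<cdot> po_inr M f g = q"
    by (auto simp: copair_def)
qed

lemma pairing_prop:
  assumes "f \<in> Arr M" "g \<in> Arr M" "Cod M f = Cod M g"
    and "p \<in> Arr M" "q \<in> Arr M" "Cod M p = Dom M f" "Cod M q = Dom M g" "Dom M p = Dom M q"
    and "f \<cdot> p = g \<cdot> q"
  shows "pairing M f g p q \<in> hom M (Dom M p) (pb_obj M f g)"
    and "pb_fst M f g \<cdot> pairing M f g p q = p"
proof -
  have "\<exists>!u. u \<in> hom M (Dom M p) (pb_obj M f g) \<and> pb_fst M f g \<cdot> u = p \<and> pb_snd M f g \<cdot> u = q"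
    unfolding pb_obj_def using assms
    by (intro pullback_universal[OF pb_prop]) (auto simp: hom_def)
  from theI'[OF this] show "pairing M f g p q \<in> hom M (Dom M p) (pb_obj M f g)"
    and "pb_fst M f g \<cdot> pairing M f g p q = p"
    by (auto simp: pairing_def)
qed

lemma is_coker_coker_obj: "f \<in> Arr M \<Longrightarrow> is_coker M f (coker_obj M f)"
  unfolding coker_obj_def
  by (rule pushout_zero_is_coker[OF po_prop]) (auto simp: initial_term)

lemma coker_obj [simp]:
  assumes "f \<in> Arr M"
  shows "coker_obj M f \<in> Arr M" "Dom M (coker_obj M f) = Cod M f"
    "coker_obj M f \<cdot> f = zero_arr M (Dom M f) (Cod M (coker_obj M f))"
  using is_cokerD[OF is_coker_coker_obj[OF assms]] by auto

lemma coker_obj_zero2 [simp]: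
  assumes "f \<in> Arr M" "g \<in> Arr M" "Cod M g = Dom M f"
  shows "coker_obj M f \<cdot> (f \<cdot> g) = zero_arr M (Dom M g) (Cod M (coker_obj M f))"
  using assms comp_assoc_arr[of g f "coker_obj M f"] by (simp del: comp_assoc_arr)

lemma epi_coker_obj: "f \<in> Arr M \<Longrightarrow> is_epi M (coker_obj M f)"
  using is_coker_coker_obj is_coker_epi by blast

lemma coker_copair [simp]:
  assumes "f \<in> Arr M" "p \<in> Arr M" "Dom M p = Cod M f" "p \<cdot> f = zero_arr M (Dom M f) (Cod M p)"
  shows "coker_copair M f p \<in> Arr M" "Dom M (coker_copair M f p) = Cod M (coker_obj M f)"
    "Cod M (coker_copair M f p) = Cod M p" "coker_copair M f p \<cdot> coker_obj M f = p"
  using assms copair_prop[of f "to_term M (Dom M f)" p "from_term M (Cod M p)"]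
  by (auto simp: hom_def coker_copair_def coker_obj_def po_obj_def zero_arr_def)

lemma ker_obj [simp]:
  assumes f: "f \<in> Arr M"
  shows "ker_obj M f \<in> Arr M" "Cod M (ker_obj M f) = Dom M f"
    "f \<cdot> ker_obj M f = zero_arr M (Dom M (ker_obj M f)) (Cod M f)"
proof -
  have pb: "is_pullback M f (from_term M (Cod M f)) (ker_obj M f) (pb_snd M f (from_term M (Cod M f)))"
    unfolding ker_obj_def using f by (intro pb_prop) auto
  then show "ker_obj M f \<in> Arr M" "Cod M (ker_obj M f) = Dom M f"
    by (auto simp: is_pullback_def)
  show "f \<cdot> ker_obj M f = zero_arr M (Dom M (ker_obj M f)) (Cod M f)"
    using pb f to_term_unique[of "pb_snd M f (from_term M (Cod M f))" "Dom M (ker_obj M f)"]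
    by (auto simp: is_pullback_def zero_arr_def)
qed

lemma ker_pairing [simp]:
  assumes "f \<in> Arr M" "p \<in> Arr M" "Cod M p = Dom M f" "f \<cdot> p = zero_arr M (Dom M p) (Cod M f)"
  shows "ker_pairing M f p \<in> Arr M" "Cod M (ker_pairing M f p) = Dom M (ker_obj M f)"
    "Dom M (ker_pairing M f p) = Dom M p" "ker_obj M f \<cdot> ker_pairing M f p = p"
  using assms pairing_prop[of f "from_term M (Cod M f)" p "to_term M (Dom M p)"]
  by (auto simp: hom_def ker_pairing_def ker_obj_def pb_obj_def zero_arr_def)

text \<open>The second projection of the pullback goes to a terminal object, so two arrows into the
  pullback always agree on it; \<open>ker_obj M f\<close> alone separates them.\<close>

lemma mono_ker_obj:
  assumes f: "f \<in> Arr M"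
  shows "is_mono M (ker_obj M f)"
  unfolding is_mono_def
proof (intro conjI ballI impI)
  fix k l
  assume kl: "k \<in> Arr M" "l \<in> Arr M" "Cod M k = Dom M (ker_obj M f) \<and> Cod M l = Dom M (ker_obj M f) \<and>
     Dom M k = Dom M l \<and> ker_obj M f \<cdot> k = ker_obj M f \<cdot> l"
  let ?q = "pb_snd M f (from_term M (Cod M f))"
  have pb: "is_pullback M f (from_term M (Cod M f)) (ker_obj M f) ?q"
    unfolding ker_obj_def using f by (intro pb_prop) auto
  then have q: "?q \<in> Arr M" "Cod M ?q = term_obj M" "Dom M ?q = Dom M (ker_obj M f)"
    "f \<cdot> ker_obj M f = from_term M (Cod M f) \<cdot> ?q"
    using f by (auto simp: is_pullback_def)
  have "\<exists>!u. u \<in> hom M (Dom M k) (Dom M (ker_obj M f)) \<and> ker_obj M f \<cdot> u = ker_obj M f \<cdot> k \<and> ?q \<cdot> u = ?q \<cdot> k"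
  proof (rule pullback_universal[OF pb])
    have "f \<cdot> (ker_obj M f \<cdot> k) = (f \<cdot> ker_obj M f) \<cdot> k"
      using f kl by (intro comp_assoc_arr[symmetric]) auto
    also have "\<dots> = from_term M (Cod M f) \<cdot> (?q \<cdot> k)"
      unfolding q(4) using f kl q by (intro comp_assoc_arr) auto
    finally show "f \<cdot> (ker_obj M f \<cdot> k) = from_term M (Cod M f) \<cdot> (?q \<cdot> k)" .
  qed (use f kl q in \<open>auto simp: hom_def\<close>)
  moreover have "?q \<cdot> l = ?q \<cdot> k"
    using to_term_unique[of "?q \<cdot> l" "Dom M k"] to_term_unique[of "?q \<cdot> k" "Dom M k"] q kl by simp
  moreover have "k \<in> hom M (Dom M k) (Dom M (ker_obj M f))" "l \<in> hom M (Dom M k) (Dom M (ker_obj M f))"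
    using kl by (simp_all add: hom_def)
  ultimately show "k = l"
    using kl by metis
qed (use f in auto)

end


section \<open>Arrow categories\<close>

lemma arrow_cat_simps [simp]:
  "Obj (arrow_cat M) = Arr M" "Arr (arrow_cat M) = {s. is_square M s}"
  "Dom (arrow_cat M) = Src" "Cod (arrow_cat M) = Tgt"
  "Ident (arrow_cat M) f = Square f f (Ident M (Dom M f)) (Ident M (Cod M f))"
  "t \<cdot>\<^bsub>arrow_cat M\<^esub> s = Square (Src s) (Tgt t) (Sq0 t \<cdot>\<^bsub>M\<^esub> Sq0 s) (Sq1 t \<cdot>\<^bsub>M\<^esub> Sq1 s)"
  by (simp_all add: arrow_cat_def)

lemma arrow_tensor_simps [simp]:
  "Obj (arrow_tensor M) = Arr M" "Arr (arrow_tensor M) = {s. is_square M s}"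
  "Dom (arrow_tensor M) = Src" "Cod (arrow_tensor M) = Tgt"
  "Ident (arrow_tensor M) f = Square f f (Ident M (Dom M f)) (Ident M (Cod M f))"
  "t \<cdot>\<^bsub>arrow_tensor M\<^esub> s = Square (Src s) (Tgt t) (Sq0 t \<cdot>\<^bsub>M\<^esub> Sq0 s) (Sq1 t \<cdot>\<^bsub>M\<^esub> Sq1 s)"
  "f \<otimes>\<^sub>o\<^bsub>arrow_tensor M\<^esub> g = f \<otimes>\<^bsub>M\<^esub> g"
  "s \<otimes>\<^bsub>arrow_tensor M\<^esub> t = Square (Src s \<otimes>\<^bsub>M\<^esub> Src t) (Tgt s \<otimes>\<^bsub>M\<^esub> Tgt t)
     (Sq0 s \<otimes>\<^bsub>M\<^esub> Sq0 t) (Sq1 s \<otimes>\<^bsub>M\<^esub> Sq1 t)"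
  "Unit (arrow_tensor M) = Ident M (Unit M)"
  by (simp_all add: arrow_tensor_def)

lemma arrow_box_simps [simp]:
  "Obj (arrow_box M) = Arr M" "Arr (arrow_box M) = {s. is_square M s}"
  "Dom (arrow_box M) = Src" "Cod (arrow_box M) = Tgt"
  "Ident (arrow_box M) f = Square f f (Ident M (Dom M f)) (Ident M (Cod M f))"
  "t \<cdot>\<^bsub>arrow_box M\<^esub> s = Square (Src s) (Tgt t) (Sq0 t \<cdot>\<^bsub>M\<^esub> Sq0 s) (Sq1 t \<cdot>\<^bsub>M\<^esub> Sq1 s)"
  "f \<otimes>\<^sub>o\<^bsub>arrow_box M\<^esub> g = pushout_product M f g"
  "Unit (arrow_box M) = L1_obj M (Unit M)"
  by (simp_all add: arrow_box_def)

text \<open>Both monoidal structures live on the same category, so typing and equations of squares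
  can be handled in \<open>arrow_cat M\<close>.\<close>

lemma hom_arrow:
  "hom (arrow_tensor M) f g = hom (arrow_cat M) f g" "hom (arrow_box M) f g = hom (arrow_cat M) f g"
  by (auto simp: hom_def)

context category
begin

lemma squareI [intro]:
  assumes "f \<in> Arr C" "g \<in> Arr C" "s0 \<in> Arr C" "Dom C s0 = Dom C f" "Cod C s0 = Dom C g"
    "s1 \<in> Arr C" "Dom C s1 = Cod C f" "Cod C s1 = Cod C g" "g \<cdot> s0 = s1 \<cdot> f"
  shows "Square f g s0 s1 \<in> hom (arrow_cat C) f g"
  using assms by (simp add: hom_def is_square_def)

lemma squareD:
  assumes "s \<in> hom (arrow_cat C) f g"
  shows "s = Square f g (Sq0 s) (Sq1 s)" "f \<in> Arr C" "g \<in> Arr C"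
    "Sq0 s \<in> Arr C" "Dom C (Sq0 s) = Dom C f" "Cod C (Sq0 s) = Dom C g"
    "Sq1 s \<in> Arr C" "Dom C (Sq1 s) = Cod C f" "Cod C (Sq1 s) = Cod C g"
    "g \<cdot> Sq0 s = Sq1 s \<cdot> f" "Src s = f" "Tgt s = g"
  using assms by (cases s; auto simp: hom_def is_square_def)+

lemma square_eqI:
  assumes "s \<in> hom (arrow_cat C) f g" "t \<in> hom (arrow_cat C) f g" "Sq0 s = Sq0 t" "Sq1 s = Sq1 t"
  shows "s = t"
  using squareD(1)[OF assms(1)] squareD(1)[OF assms(2)] assms by metis

text \<open>The identity \<open>g \<cdot> Sq0 s = Sq1 s \<cdot> f\<close> determines
  \<open>Sq1 s\<close> from \<open>Sq0 s\<close> once \<open>f\<close> can be cancelled on the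
  right.\<close>

lemma square_eq_epi:
  assumes s: "s \<in> hom (arrow_cat C) f g" and t: "t \<in> hom (arrow_cat C) f g"
    and "is_epi C f" "Sq0 s = Sq0 t"
  shows "s = t"
proof (rule square_eqI[OF s t assms(4)])
  show "Sq1 s = Sq1 t"
    using squareD[OF s] squareD[OF t] assms(3,4) unfolding is_epi_def by metis
qed

lemma square_eq_mono:
  assumes s: "s \<in> hom (arrow_cat C) f g" and t: "t \<in> hom (arrow_cat C) f g"
    and "is_mono C g" "Sq1 s = Sq1 t"
  shows "s = t"
proof (rule square_eqI[OF s t _ assms(4)])
  show "Sq0 s = Sq0 t"
    using squareD[OF s] squareD[OF t] assms(3,4) unfolding is_mono_def by metis
qed

lemma square_comp:
  assumes s: "s \<in> hom (arrow_cat C) f g" and t: "t \<in> hom (arrow_cat C) g h"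
  shows "t \<cdot>\<^bsub>arrow_cat C\<^esub> s \<in> hom (arrow_cat C) f h"
proof -
  note S = squareD[OF s] and T = squareD[OF t]
  have "h \<cdot> (Sq0 t \<cdot> Sq0 s) = (h \<cdot> Sq0 t) \<cdot> Sq0 s"
    using S(2-9) T(2-9) by (intro comp_assoc_arr[symmetric]) auto
  also have "\<dots> = Sq1 t \<cdot> (g \<cdot> Sq0 s)"
    unfolding T(10) using S(2-9) T(2-9) by (intro comp_assoc_arr) auto
  also have "\<dots> = (Sq1 t \<cdot> Sq1 s) \<cdot> f"
    unfolding S(10) using S(2-9) T(2-9) by (intro comp_assoc_arr[symmetric]) auto
  finally have "Square f h (Sq0 t \<cdot> Sq0 s) (Sq1 t \<cdot> Sq1 s) \<in> hom (arrow_cat C) f h"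
    using S(2-9) T(2-9) by (intro squareI) auto
  then show ?thesis
    by (simp add: S(11) T(12))
qed

lemma category_arrow_cat: "category (arrow_cat C)"
proof (unfold_locales, goal_cases)
  case (4 f a b g c)
  then show ?case by (rule square_comp)
next
  case (5 f a b)
  then show ?case using squareD[OF 5] by (cases f) auto
next
  case (6 f a b)
  then show ?case using squareD[OF 6] by (cases f) auto
next
  case (7 f a b g c h d)
  then show ?case using squareD[OF 7(1)] squareD[OF 7(2)] squareD[OF 7(3)] by simp
qed (auto simp: is_square_def)

text \<open>The category laws mention only these six fields, so they pass to both monoidal records
  over the arrow category.\<close>

lemma category_arrow:
  assumes "Obj N = Obj (arrow_cat C)" "Arr N = Arr (arrow_cat C)" "Dom N = Dom (arrow_cat C)"
    "Cod N = Cod (arrow_cat C)" "Ident N = Ident (arrow_cat C)" "Comp N = Comp (arrow_cat C)"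
  shows "category N"
  using category_arrow_cat assms by (simp add: category_def hom_def)

end

lemma (in pointed_monoidal) category_arrow_tensor: "category (arrow_tensor M)"
  by (rule category_arrow) (auto simp: arrow_tensor_def)

lemma (in pointed_monoidal) category_arrow_box: "category (arrow_box M)"
  by (rule category_arrow) (auto simp: arrow_box_def)

section \<open>Cokernel and kernel as adjoint functors between arrow categories\<close>

context pointed_monoidal
begin

lemma coker_map_hom:
  assumes "s \<in> hom (arrow_cat M) f g"
  shows "coker_map M s \<in> hom (arrow_cat M) (coker_obj M f) (coker_obj M g)"
proof -
  note S = squareD[OF assms]
  have "(coker_obj M g \<cdot> Sq1 s) \<cdot> f = coker_obj M g \<cdot> (g \<cdot> Sq0 s)"
    unfolding S(10) using S(2-9) by (intro comp_assoc_arr) auto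
  also have "\<dots> = zero_arr M (Dom M f) (Cod M (coker_obj M g))"
    using S(2-9) by simp
  finally show ?thesis
    unfolding coker_map_def S(11,12) using S(2-9) by (intro squareI) (simp_all del: comp_assoc_arr)
qed

lemma ker_map_hom:
  assumes "s \<in> hom (arrow_cat M) f g"
  shows "ker_map M s \<in> hom (arrow_cat M) (ker_obj M f) (ker_obj M g)"
proof -
  note S = squareD[OF assms]
  have "g \<cdot> (Sq0 s \<cdot> ker_obj M f) = (g \<cdot> Sq0 s) \<cdot> ker_obj M f"
    using S(2-9) by (intro comp_assoc_arr[symmetric]) auto
  also have "\<dots> = zero_arr M (Dom M (ker_obj M f)) (Cod M g)"
    unfolding S(10) using S(2-9) by simp
  finally show ?thesis
    unfolding ker_map_def S(11,12) using S(2-9) by (intro squareI) simp_all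
qed

text \<open>The cokernel starts where \<open>f\<close> ends, and the kernel ends where
  \<open>f\<close> starts. This shift is why codomains are projected on the pushout product side and
  domains on the tensor side.\<close>

lemma coker_map_sq [simp]: "Sq0 (coker_map M s) = Sq1 s"
  by (simp add: coker_map_def)

lemma ker_map_sq [simp]: "Sq1 (ker_map M s) = Sq0 s"
  by (simp add: ker_map_def)

lemma unit_hom:
  assumes "f \<in> Arr M"
  shows "coker_ker_unit M f \<in> hom (arrow_cat M) f (ker_obj M (coker_obj M f))"
  using assms by (auto simp: coker_ker_unit_def)

lemma counit_hom:
  assumes "f \<in> Arr M"
  shows "coker_ker_counit M f \<in> hom (arrow_cat M) (coker_obj M (ker_obj M f)) f"
  using assms by (auto simp: coker_ker_counit_def)

lemma unit_sq [simp]: "Sq1 (coker_ker_unit M f) = Ident M (Cod M f)"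
  by (simp add: coker_ker_unit_def)

lemma counit_sq [simp]: "Sq0 (coker_ker_counit M f) = Ident M (Dom M f)"
  by (simp add: coker_ker_counit_def)

lemma functor_coker: "is_functor (arrow_box M) (arrow_tensor M) (coker M)"
proof -
  interpret N1: category "arrow_box M" by (rule category_arrow_box)
  interpret N2: category "arrow_tensor M" by (rule category_arrow_tensor)
  interpret A: category "arrow_cat M" by (rule category_arrow_cat)
  show ?thesis
  proof (unfold_locales, unfold hom_arrow)
    show "Fa (coker M) f \<in> hom (arrow_cat M) (Fo (coker M) a) (Fo (coker M) b)"
      if "f \<in> hom (arrow_cat M) a b" for f a b
      using that by (simp add: coker_def coker_map_hom)
    show "Fa (coker M) (Ident (arrow_box M) a) = Ident (arrow_tensor M) (Fo (coker M) a)"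
      if "a \<in> Obj (arrow_box M)" for a
      using that A.ident_hom[of a] A.ident_hom[of "coker_obj M a"] epi_coker_obj[of a]
      by (intro square_eq_epi[of _ "coker_obj M a" "coker_obj M a"])
        (auto simp: coker_def intro: coker_map_hom)
    show "Fa (coker M) (g \<cdot>\<^bsub>arrow_box M\<^esub> f) = Fa (coker M) g \<cdot>\<^bsub>arrow_tensor M\<^esub> Fa (coker M) f"
      if f: "f \<in> hom (arrow_cat M) a b" and g: "g \<in> hom (arrow_cat M) b c" for f g a b c
      using coker_map_hom[OF square_comp[OF f g]] square_comp[OF coker_map_hom[OF f] coker_map_hom[OF g]]
        epi_coker_obj[of a] squareD(2)[OF f]
      by (intro square_eq_epi[of _ "coker_obj M a" "coker_obj M c"]) (simp_all add: coker_def)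
  qed (auto simp: coker_def)
qed

lemma functor_ker: "is_functor (arrow_tensor M) (arrow_box M) (ker M)"
proof -
  interpret N1: category "arrow_box M" by (rule category_arrow_box)
  interpret N2: category "arrow_tensor M" by (rule category_arrow_tensor)
  interpret A: category "arrow_cat M" by (rule category_arrow_cat)
  show ?thesis
  proof (unfold_locales, unfold hom_arrow)
    show "Fa (ker M) f \<in> hom (arrow_cat M) (Fo (ker M) a) (Fo (ker M) b)"
      if "f \<in> hom (arrow_cat M) a b" for f a b
      using that by (simp add: ker_def ker_map_hom)
    show "Fa (ker M) (Ident (arrow_tensor M) a) = Ident (arrow_box M) (Fo (ker M) a)"
      if "a \<in> Obj (arrow_tensor M)" for a
      using that A.ident_hom[of a] A.ident_hom[of "ker_obj M a"] mono_ker_obj[of a]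
      by (intro square_eq_mono[of _ "ker_obj M a" "ker_obj M a"])
        (auto simp: ker_def intro: ker_map_hom)
    show "Fa (ker M) (g \<cdot>\<^bsub>arrow_tensor M\<^esub> f) = Fa (ker M) g \<cdot>\<^bsub>arrow_box M\<^esub> Fa (ker M) f"
      if f: "f \<in> hom (arrow_cat M) a b" and g: "g \<in> hom (arrow_cat M) b c" for f g a b c
      using ker_map_hom[OF square_comp[OF f g]] square_comp[OF ker_map_hom[OF f] ker_map_hom[OF g]]
        mono_ker_obj[of c] squareD(3)[OF g]
      by (intro square_eq_mono[of _ "ker_obj M a" "ker_obj M c"]) (simp_all add: ker_def)
  qed (auto simp: ker_def)
qed

text \<open>Naturality of the unit and the right triangle end in a kernel and are tested on
  \<open>Sq1\<close>; naturality of the counit and the left triangle start at a cokernel and are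
  tested on \<open>Sq0\<close>. On these components the unit and the counit are identities.\<close>

lemma adjunction_coker_ker:
  "adjunction (arrow_box M) (arrow_tensor M) (coker M) (ker M) (coker_ker_unit M) (coker_ker_counit M)"
proof -
  interpret F: is_functor "arrow_box M" "arrow_tensor M" "coker M" by (rule functor_coker)
  interpret G: is_functor "arrow_tensor M" "arrow_box M" "ker M" by (rule functor_ker)
  interpret A: category "arrow_cat M" by (rule category_arrow_cat)
  have Fs: "Fo (coker M) = coker_obj M" "Fa (coker M) = coker_map M"
    "Fo (ker M) = ker_obj M" "Fa (ker M) = ker_map M"
    by (auto simp: coker_def ker_def)
  have comps: "t \<cdot>\<^bsub>arrow_box M\<^esub> s = t \<cdot>\<^bsub>arrow_cat M\<^esub> s" "t \<cdot>\<^bsub>arrow_tensor M\<^esub> s = t \<cdot>\<^bsub>arrow_cat M\<^esub> s"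
    "Ident (arrow_box M) f = Ident (arrow_cat M) f" "Ident (arrow_tensor M) f = Ident (arrow_cat M) f"
    for s t f by simp_all
  show ?thesis
  proof (unfold_locales, unfold hom_arrow Fs comps)
    fix s f g assume s: "s \<in> hom (arrow_cat M) f g"
    note S = squareD[OF s]
    show "coker_ker_unit M g \<cdot>\<^bsub>arrow_cat M\<^esub> s = ker_map M (coker_map M s) \<cdot>\<^bsub>arrow_cat M\<^esub> coker_ker_unit M f"
      using S square_comp[OF s unit_hom[OF S(3)]] mono_ker_obj
        square_comp[OF unit_hom[OF S(2)] ker_map_hom[OF coker_map_hom[OF s]]]
      by (intro square_eq_mono[of _ f "ker_obj M (coker_obj M g)"]) auto
    show "coker_ker_counit M g \<cdot>\<^bsub>arrow_cat M\<^esub> coker_map M (ker_map M s) = s \<cdot>\<^bsub>arrow_cat M\<^esub> coker_ker_counit M f"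
      using S square_comp[OF counit_hom[OF S(2)] s] epi_coker_obj
        square_comp[OF coker_map_hom[OF ker_map_hom[OF s]] counit_hom[OF S(3)]]
      by (intro square_eq_epi[of _ "coker_obj M (ker_obj M f)" g]) auto
  next
    fix f assume "f \<in> Obj (arrow_box M)"
    then have f: "f \<in> Arr M" by simp
    show "coker_ker_unit M f \<in> hom (arrow_cat M) f (ker_obj M (coker_obj M f))"
      using f by (rule unit_hom)
    show "coker_ker_counit M (coker_obj M f) \<cdot>\<^bsub>arrow_cat M\<^esub> coker_map M (coker_ker_unit M f) =
        Ident (arrow_cat M) (coker_obj M f)"
      using f epi_coker_obj A.ident_hom[of "coker_obj M f"]
        square_comp[OF coker_map_hom[OF unit_hom[OF f]] counit_hom[of "coker_obj M f"]]
      by (intro square_eq_epi[of _ "coker_obj M f" "coker_obj M f"]) auto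
  next
    fix f assume "f \<in> Obj (arrow_tensor M)"
    then have f: "f \<in> Arr M" by simp
    show "coker_ker_counit M f \<in> hom (arrow_cat M) (coker_obj M (ker_obj M f)) f"
      using f by (rule counit_hom)
    show "ker_map M (coker_ker_counit M f) \<cdot>\<^bsub>arrow_cat M\<^esub> coker_ker_unit M (ker_obj M f) =
        Ident (arrow_cat M) (ker_obj M f)"
      using f mono_ker_obj A.ident_hom[of "ker_obj M f"]
        square_comp[OF unit_hom[of "ker_obj M f"] ker_map_hom[OF counit_hom[OF f]]]
      by (intro square_eq_mono[of _ "ker_obj M f" "ker_obj M f"]) auto
  qed
qed

end

section \<open>The pushout product\<close>

context pointed_monoidal
begin

lemma assoc_arr [simp]:
  assumes "a \<in> Obj M" "b \<in> Obj M" "c \<in> Obj M"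
  shows "Assoc M a b c \<in> Arr M" "Dom M (Assoc M a b c) = (a \<otimes>\<^sub>o b) \<otimes>\<^sub>o c"
    "Cod M (Assoc M a b c) = a \<otimes>\<^sub>o (b \<otimes>\<^sub>o c)"
  using assoc_hom[OF assms] by (auto simp: hom_def)

abbreviation "assoc_inv a b c \<equiv> inverse_of M (Assoc M a b c)"

lemma assoc_inv:
  assumes "a \<in> Obj M" "b \<in> Obj M" "c \<in> Obj M"
  shows "inverse_arrows M (Assoc M a b c) (assoc_inv a b c)"
  using inverse_arrows_inverse_of[OF assoc_iso[OF assms]] .

lemma assoc_inv_arr [simp]:
  assumes "a \<in> Obj M" "b \<in> Obj M" "c \<in> Obj M"
  shows "assoc_inv a b c \<in> Arr M" "Cod M (assoc_inv a b c) = (a \<otimes>\<^sub>o b) \<otimes>\<^sub>o c"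
    "Dom M (assoc_inv a b c) = a \<otimes>\<^sub>o (b \<otimes>\<^sub>o c)"
    "assoc_inv a b c \<cdot> Assoc M a b c = Ident M ((a \<otimes>\<^sub>o b) \<otimes>\<^sub>o c)"
    "Assoc M a b c \<cdot> assoc_inv a b c = Ident M (a \<otimes>\<^sub>o (b \<otimes>\<^sub>o c))"
  using assoc_inv[OF assms] assms by (auto simp: hom_def inverse_arrows_def)

lemma assoc_nat:
  assumes "f \<in> Arr M" "g \<in> Arr M" "h \<in> Arr M"
  shows "Assoc M (Cod M f) (Cod M g) (Cod M h) \<cdot> ((f \<otimes> g) \<otimes> h) =
    (f \<otimes> (g \<otimes> h)) \<cdot> Assoc M (Dom M f) (Dom M g) (Dom M h)"
  using assms by (intro assoc_natural) (auto simp: hom_def)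

lemma assoc_inv_nat:
  assumes "f \<in> Arr M" "g \<in> Arr M" "h \<in> Arr M"
  shows "assoc_inv (Cod M f) (Cod M g) (Cod M h) \<cdot> (f \<otimes> (g \<otimes> h)) =
    ((f \<otimes> g) \<otimes> h) \<cdot> assoc_inv (Dom M f) (Dom M g) (Dom M h)"
proof -
  let ?a = "Assoc M (Dom M f) (Dom M g) (Dom M h)" and ?b = "Assoc M (Cod M f) (Cod M g) (Cod M h)"
  let ?i = "assoc_inv (Dom M f) (Dom M g) (Dom M h)" and ?j = "assoc_inv (Cod M f) (Cod M g) (Cod M h)"
  have "?j \<cdot> (f \<otimes> (g \<otimes> h)) = ?j \<cdot> (((f \<otimes> (g \<otimes> h)) \<cdot> ?a) \<cdot> ?i)"
    using assms by simp
  also have "\<dots> = ?j \<cdot> ((?b \<cdot> ((f \<otimes> g) \<otimes> h)) \<cdot> ?i)"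
    by (simp only: assoc_nat[OF assms])
  also have "\<dots> = (?j \<cdot> ?b) \<cdot> (((f \<otimes> g) \<otimes> h) \<cdot> ?i)"
    using assms by (simp del: assoc_inv_arr(4))
  also have "\<dots> = ((f \<otimes> g) \<otimes> h) \<cdot> ?i"
    using assms by simp
  finally show ?thesis .
qed

lemma pushout_eqI:
  assumes po: "is_pushout M f g p q" and "u \<in> Arr M" "v \<in> Arr M" "Dom M u = Cod M p" "Dom M v = Cod M p"
    and "u \<cdot> p = v \<cdot> p" "u \<cdot> q = v \<cdot> q"
  shows "u = v"
proof -
  have p: "p \<in> Arr M" "q \<in> Arr M" "f \<in> Arr M" "g \<in> Arr M" "Dom M p = Cod M f" "Dom M q = Cod M g"
    "Cod M q = Cod M p" "p \<cdot> f = q \<cdot> g"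
    using po by (auto simp: is_pushout_def)
  \<comment> \<open>The codomains of \<open>u\<close> and \<open>v\<close> agree because those of
    \<open>u \<cdot> p\<close> and \<open>v \<cdot> p\<close> do.\<close>
  have "Cod M u = Cod M (u \<cdot> p)" "Cod M v = Cod M (v \<cdot> p)"
    using assms(2-5) p by simp_all
  then have cod: "Cod M v = Cod M u"
    using assms(6) by simp
  have "\<exists>!w. w \<in> hom M (Cod M p) (Cod M u) \<and> w \<cdot> p = u \<cdot> p \<and> w \<cdot> q = u \<cdot> q"
    using assms(2,4) p by (intro pushout_universal[OF po]) (simp_all add: hom_def)
  moreover have "u \<in> hom M (Cod M p) (Cod M u)" "v \<in> hom M (Cod M p) (Cod M u)"
    using assms(2-5) cod by (simp_all add: hom_def)
  ultimately show ?thesis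
    using assms(6,7) by metis
qed

lemma pushout_factor:
  assumes po: "is_pushout M f g p q"
    and "p' \<in> Arr M" "q' \<in> Arr M" "Dom M p' = Cod M f" "Dom M q' = Cod M g" "Cod M p' = z" "Cod M q' = z"
    "p' \<cdot> f = q' \<cdot> g"
  obtains u where "u \<in> Arr M" "Dom M u = Cod M p" "Cod M u = z" "u \<cdot> p = p'" "u \<cdot> q = q'"
  using pushout_universal[OF po, of p' z q'] assms(2-) unfolding hom_def by blast

context
  fixes f g
  assumes fg: "f \<in> Arr M" "g \<in> Arr M"
begin

lemma box_pushout:
  "is_pushout M (Ident M (Dom M f) \<otimes> g) (f \<otimes> Ident M (Dom M g)) (box_inl M f g) (box_inr M f g)"
  unfolding box_inl_def box_inr_def using fg by (intro po_prop) auto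

lemma box_copair_prop:
  assumes "p \<in> Arr M" "q \<in> Arr M" "Dom M p = Dom M f \<otimes>\<^sub>o Cod M g" "Dom M q = Cod M f \<otimes>\<^sub>o Dom M g"
    "Cod M p = Cod M q" "p \<cdot> (Ident M (Dom M f) \<otimes> g) = q \<cdot> (f \<otimes> Ident M (Dom M g))"
  shows "box_copair M f g p q \<in> Arr M" "Dom M (box_copair M f g p q) = Cod M (box_inl M f g)"
    "Cod M (box_copair M f g p q) = Cod M q"
    "box_copair M f g p q \<cdot> box_inl M f g = p" "box_copair M f g p q \<cdot> box_inr M f g = q"
  using copair_prop[of "Ident M (Dom M f) \<otimes> g" "f \<otimes> Ident M (Dom M g)" p q] fg assms
  by (auto simp: box_copair_def box_inl_def box_inr_def po_obj_def hom_def)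

lemma pushout_product [simp]:
  "pushout_product M f g \<in> Arr M" "Cod M (pushout_product M f g) = Cod M f \<otimes>\<^sub>o Cod M g"
  "pushout_product M f g \<cdot> box_inl M f g = f \<otimes> Ident M (Cod M g)"
  "pushout_product M f g \<cdot> box_inr M f g = Ident M (Cod M f) \<otimes> g"
  using box_copair_prop[of "f \<otimes> Ident M (Cod M g)" "Ident M (Cod M f) \<otimes> g"] fg
  by (auto simp: pushout_product_def)

lemma box_legs [simp]:
  "box_inl M f g \<in> Arr M" "Dom M (box_inl M f g) = Dom M f \<otimes>\<^sub>o Cod M g"
  "Cod M (box_inl M f g) = Dom M (pushout_product M f g)"
  "box_inr M f g \<in> Arr M" "Dom M (box_inr M f g) = Cod M f \<otimes>\<^sub>o Dom M g"
  "Cod M (box_inr M f g) = Dom M (pushout_product M f g)"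
  using box_pushout fg box_copair_prop(2)[of "f \<otimes> Ident M (Cod M g)" "Ident M (Cod M f) \<otimes> g"]
  by (auto simp: is_pushout_def pushout_product_def)

lemma box_copair [simp]:
  assumes "p \<in> Arr M" "q \<in> Arr M" "Dom M p = Dom M f \<otimes>\<^sub>o Cod M g" "Dom M q = Cod M f \<otimes>\<^sub>o Dom M g"
    "Cod M p = Cod M q" "p \<cdot> (Ident M (Dom M f) \<otimes> g) = q \<cdot> (f \<otimes> Ident M (Dom M g))"
  shows "box_copair M f g p q \<in> Arr M" "Dom M (box_copair M f g p q) = Dom M (pushout_product M f g)"
    "Cod M (box_copair M f g p q) = Cod M q"
    "box_copair M f g p q \<cdot> box_inl M f g = p" "box_copair M f g p q \<cdot> box_inr M f g = q"
  using box_copair_prop[OF assms] by simp_all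

lemma pushout_product2 [simp]:
  assumes "k \<in> Arr M"
  shows "Cod M k = Dom M f \<otimes>\<^sub>o Cod M g \<Longrightarrow>
      pushout_product M f g \<cdot> (box_inl M f g \<cdot> k) = (f \<otimes> Ident M (Cod M g)) \<cdot> k"
    and "Cod M k = Cod M f \<otimes>\<^sub>o Dom M g \<Longrightarrow>
      pushout_product M f g \<cdot> (box_inr M f g \<cdot> k) = (Ident M (Cod M f) \<otimes> g) \<cdot> k"
proof -
  show "pushout_product M f g \<cdot> (box_inl M f g \<cdot> k) = (f \<otimes> Ident M (Cod M g)) \<cdot> k"
    if "Cod M k = Dom M f \<otimes>\<^sub>o Cod M g"
    using fg assms that by (subst comp_assoc_arr[symmetric]) simp_all
  show "pushout_product M f g \<cdot> (box_inr M f g \<cdot> k) = (Ident M (Cod M f) \<otimes> g) \<cdot> k"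
    if "Cod M k = Cod M f \<otimes>\<^sub>o Dom M g"
    using fg assms that by (subst comp_assoc_arr[symmetric]) simp_all
qed

lemma box_eqI:
  assumes "u \<in> Arr M" "v \<in> Arr M" "Dom M u = Dom M (pushout_product M f g)"
    "Dom M v = Dom M (pushout_product M f g)"
    "u \<cdot> box_inl M f g = v \<cdot> box_inl M f g" "u \<cdot> box_inr M f g = v \<cdot> box_inr M f g"
  shows "u = v"
  by (rule pushout_eqI[OF box_pushout]) (use assms fg in simp_all)

text \<open>The commuting square of the pushout, precomposed with \<open>l \<otimes> k\<close>. In
  this form arrows are moved from one leg to the other.\<close>

lemma box_slide:
  assumes "l \<in> Arr M" "k \<in> Arr M" "Cod M l = Dom M f" "Cod M k = Dom M g"
  shows "box_inl M f g \<cdot> (l \<otimes> (g \<cdot> k)) = box_inr M f g \<cdot> ((f \<cdot> l) \<otimes> k)"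
proof -
  have "box_inl M f g \<cdot> (l \<otimes> (g \<cdot> k)) = (box_inl M f g \<cdot> (Ident M (Dom M f) \<otimes> g)) \<cdot> (l \<otimes> k)"
    using fg assms by simp
  also have "box_inl M f g \<cdot> (Ident M (Dom M f) \<otimes> g) = box_inr M f g \<cdot> (f \<otimes> Ident M (Dom M g))"
    using box_pushout unfolding is_pushout_def by blast
  also have "(box_inr M f g \<cdot> (f \<otimes> Ident M (Dom M g))) \<cdot> (l \<otimes> k) = box_inr M f g \<cdot> ((f \<cdot> l) \<otimes> k)"
    using fg assms by simp
  finally show ?thesis .
qed

end

text \<open>The domain component is a copairing and thus known only through its composites with the
  legs; these are recorded because later equations between such components are tested there.\<close>

lemma box_tensor_hom:
  assumes s: "s \<in> hom (arrow_cat M) f f'" and t: "t \<in> hom (arrow_cat M) g g'"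
  shows "s \<otimes>\<^bsub>arrow_box M\<^esub> t \<in> hom (arrow_cat M) (pushout_product M f g) (pushout_product M f' g')"
    and "Sq0 (s \<otimes>\<^bsub>arrow_box M\<^esub> t) \<cdot> box_inl M f g = box_inl M f' g' \<cdot> (Sq0 s \<otimes> Sq1 t)"
    and "Sq0 (s \<otimes>\<^bsub>arrow_box M\<^esub> t) \<cdot> box_inr M f g = box_inr M f' g' \<cdot> (Sq1 s \<otimes> Sq0 t)"
    and "Sq1 (s \<otimes>\<^bsub>arrow_box M\<^esub> t) = Sq1 s \<otimes> Sq1 t"
proof -
  note S = squareD[OF s] and T = squareD[OF t]
  let ?p = "box_inl M f' g' \<cdot> (Sq0 s \<otimes> Sq1 t)" and ?q = "box_inr M f' g' \<cdot> (Sq1 s \<otimes> Sq0 t)"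
  let ?u = "box_copair M f g ?p ?q"
  have st: "s \<otimes>\<^bsub>arrow_box M\<^esub> t = Square (pushout_product M f g) (pushout_product M f' g') ?u (Sq1 s \<otimes> Sq1 t)"
    by (simp add: arrow_box_def S(11,12) T(11,12))
  \<comment> \<open>The two branches have to agree on the tensor product of the domains: the square
    \<open>t\<close> brings in \<open>g'\<close>, \<open>box_slide\<close> trades it for
    \<open>f'\<close>, and the square \<open>s\<close> turns that into \<open>f\<close>.\<close>
  have "?p \<cdot> (Ident M (Dom M f) \<otimes> g) = box_inl M f' g' \<cdot> (Sq0 s \<otimes> (g' \<cdot> Sq0 t))"
    unfolding T(10) using S(2-9) T(2-9) by simp
  also have "\<dots> = box_inr M f' g' \<cdot> ((Sq1 s \<cdot> f) \<otimes> Sq0 t)"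
    unfolding S(10)[symmetric] using S(2-9) T(2-9) by (intro box_slide) auto
  also have "\<dots> = ?q \<cdot> (f \<otimes> Ident M (Dom M g))"
    using S(2-9) T(2-9) by simp
  finally have pq: "?p \<cdot> (Ident M (Dom M f) \<otimes> g) = ?q \<cdot> (f \<otimes> Ident M (Dom M g))" .
  have u: "?u \<in> Arr M" "Dom M ?u = Dom M (pushout_product M f g)" "Cod M ?u = Cod M ?q"
    "?u \<cdot> box_inl M f g = ?p" "?u \<cdot> box_inr M f g = ?q"
    by (intro box_copair, use S(2-9) T(2-9) pq in \<open>simp_all del: comp_assoc_arr\<close>)+
  have "pushout_product M f' g' \<cdot> ?u = (Sq1 s \<otimes> Sq1 t) \<cdot> pushout_product M f g"
  proof (rule box_eqI[OF S(2) T(2)])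
    have "(pushout_product M f' g' \<cdot> ?u) \<cdot> box_inl M f g = (f' \<cdot> Sq0 s) \<otimes> Sq1 t"
      using S(2-9) T(2-9) u by simp
    also have "\<dots> = ((Sq1 s \<otimes> Sq1 t) \<cdot> pushout_product M f g) \<cdot> box_inl M f g"
      unfolding S(10) using S(2-9) T(2-9) by simp
    finally show "(pushout_product M f' g' \<cdot> ?u) \<cdot> box_inl M f g =
        ((Sq1 s \<otimes> Sq1 t) \<cdot> pushout_product M f g) \<cdot> box_inl M f g" .
    have "(pushout_product M f' g' \<cdot> ?u) \<cdot> box_inr M f g = Sq1 s \<otimes> (g' \<cdot> Sq0 t)"
      using S(2-9) T(2-9) u by simp
    also have "\<dots> = ((Sq1 s \<otimes> Sq1 t) \<cdot> pushout_product M f g) \<cdot> box_inr M f g"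
      unfolding T(10) using S(2-9) T(2-9) by simp
    finally show "(pushout_product M f' g' \<cdot> ?u) \<cdot> box_inr M f g =
        ((Sq1 s \<otimes> Sq1 t) \<cdot> pushout_product M f g) \<cdot> box_inr M f g" .
  qed (use S(2-9) T(2-9) u(1-3) in simp_all)
  then show "s \<otimes>\<^bsub>arrow_box M\<^esub> t \<in> hom (arrow_cat M) (pushout_product M f g) (pushout_product M f' g')"
    unfolding st using S(2-9) T(2-9) u(1-3) by (intro squareI) simp_all
  show "Sq0 (s \<otimes>\<^bsub>arrow_box M\<^esub> t) \<cdot> box_inl M f g = ?p" "Sq0 (s \<otimes>\<^bsub>arrow_box M\<^esub> t) \<cdot> box_inr M f g = ?q"
    "Sq1 (s \<otimes>\<^bsub>arrow_box M\<^esub> t) = Sq1 s \<otimes> Sq1 t"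
    unfolding st using u by simp_all
qed

lemma box_square_eqI:
  assumes f: "f \<in> Arr M" and g: "g \<in> Arr M" and s: "s \<in> hom (arrow_cat M) (pushout_product M f g) h"
    and t: "t \<in> hom (arrow_cat M) (pushout_product M f g) h"
    and "Sq0 s \<cdot> box_inl M f g = Sq0 t \<cdot> box_inl M f g" "Sq0 s \<cdot> box_inr M f g = Sq0 t \<cdot> box_inr M f g"
    "Sq1 s = Sq1 t"
  shows "s = t"
proof (rule square_eqI[OF s t _ assms(7)])
  show "Sq0 s = Sq0 t"
    by (rule box_eqI[OF f g]) (use squareD[OF s] squareD[OF t] assms(5,6) in auto)
qed

lemma box_tensor_ident:
  assumes f: "f \<in> Arr M" and g: "g \<in> Arr M"
  shows "Ident (arrow_cat M) f \<otimes>\<^bsub>arrow_box M\<^esub> Ident (arrow_cat M) g = Ident (arrow_cat M) (pushout_product M f g)"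
proof -
  interpret A: category "arrow_cat M" by (rule category_arrow_cat)
  have i: "Ident (arrow_cat M) h \<in> hom (arrow_cat M) h h" if "h \<in> Arr M" for h
    using that A.ident_hom by simp
  note b = box_tensor_hom[OF i[OF f] i[OF g]]
  show ?thesis
    by (rule box_square_eqI[OF f g b(1) i]) (use f g b(2-4) in simp_all)
qed

lemma box_tensor_comp:
  assumes s: "s \<in> hom (arrow_cat M) a a'" and s': "s' \<in> hom (arrow_cat M) a' a''"
    and t: "t \<in> hom (arrow_cat M) b b'" and t': "t' \<in> hom (arrow_cat M) b' b''"
  shows "(s' \<cdot>\<^bsub>arrow_cat M\<^esub> s) \<otimes>\<^bsub>arrow_box M\<^esub> (t' \<cdot>\<^bsub>arrow_cat M\<^esub> t) =
    (s' \<otimes>\<^bsub>arrow_box M\<^esub> t') \<cdot>\<^bsub>arrow_cat M\<^esub> (s \<otimes>\<^bsub>arrow_box M\<^esub> t)"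
proof -
  note S = squareD[OF s] and T = squareD[OF t] and S' = squareD[OF s'] and T' = squareD[OF t']
  note c = box_tensor_hom[OF square_comp[OF s s'] square_comp[OF t t']]
  note st = box_tensor_hom[OF s t] and st' = box_tensor_hom[OF s' t']
  note ST = squareD[OF st(1)] and ST' = squareD[OF st'(1)]
  note arr = S(2-9) T(2-9) S'(2-9) T'(2-9)
  have "(Sq0 (s' \<otimes>\<^bsub>arrow_box M\<^esub> t') \<cdot> Sq0 (s \<otimes>\<^bsub>arrow_box M\<^esub> t)) \<cdot> box_inl M a b =
      Sq0 (s' \<otimes>\<^bsub>arrow_box M\<^esub> t') \<cdot> (box_inl M a' b' \<cdot> (Sq0 s \<otimes> Sq1 t))"
    using arr ST(4-6) ST'(4-6) st(2) by simp
  also have "\<dots> = (Sq0 (s' \<otimes>\<^bsub>arrow_box M\<^esub> t') \<cdot> box_inl M a' b') \<cdot> (Sq0 s \<otimes> Sq1 t)"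
    using arr ST(4-6) ST'(4-6) by (intro comp_assoc_arr[symmetric]) simp_all
  also have "\<dots> = box_inl M a'' b'' \<cdot> ((Sq0 s' \<cdot> Sq0 s) \<otimes> (Sq1 t' \<cdot> Sq1 t))"
    unfolding st'(2) using arr by simp
  finally have l: "(Sq0 (s' \<otimes>\<^bsub>arrow_box M\<^esub> t') \<cdot> Sq0 (s \<otimes>\<^bsub>arrow_box M\<^esub> t)) \<cdot> box_inl M a b =
      box_inl M a'' b'' \<cdot> ((Sq0 s' \<cdot> Sq0 s) \<otimes> (Sq1 t' \<cdot> Sq1 t))" .
  have "(Sq0 (s' \<otimes>\<^bsub>arrow_box M\<^esub> t') \<cdot> Sq0 (s \<otimes>\<^bsub>arrow_box M\<^esub> t)) \<cdot> box_inr M a b =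
      Sq0 (s' \<otimes>\<^bsub>arrow_box M\<^esub> t') \<cdot> (box_inr M a' b' \<cdot> (Sq1 s \<otimes> Sq0 t))"
    using arr ST(4-6) ST'(4-6) st(3) by simp
  also have "\<dots> = (Sq0 (s' \<otimes>\<^bsub>arrow_box M\<^esub> t') \<cdot> box_inr M a' b') \<cdot> (Sq1 s \<otimes> Sq0 t)"
    using arr ST(4-6) ST'(4-6) by (intro comp_assoc_arr[symmetric]) simp_all
  also have "\<dots> = box_inr M a'' b'' \<cdot> ((Sq1 s' \<cdot> Sq1 s) \<otimes> (Sq0 t' \<cdot> Sq0 t))"
    unfolding st'(3) using arr by simp
  finally have r: "(Sq0 (s' \<otimes>\<^bsub>arrow_box M\<^esub> t') \<cdot> Sq0 (s \<otimes>\<^bsub>arrow_box M\<^esub> t)) \<cdot> box_inr M a b =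
      box_inr M a'' b'' \<cdot> ((Sq1 s' \<cdot> Sq1 s) \<otimes> (Sq0 t' \<cdot> Sq0 t))" .
  show ?thesis
  proof (rule box_square_eqI[OF S(2) T(2) c(1) square_comp[OF st(1) st'(1)]])
    show "Sq0 ((s' \<cdot>\<^bsub>arrow_cat M\<^esub> s) \<otimes>\<^bsub>arrow_box M\<^esub> (t' \<cdot>\<^bsub>arrow_cat M\<^esub> t)) \<cdot> box_inl M a b =
        Sq0 ((s' \<otimes>\<^bsub>arrow_box M\<^esub> t') \<cdot>\<^bsub>arrow_cat M\<^esub> (s \<otimes>\<^bsub>arrow_box M\<^esub> t)) \<cdot> box_inl M a b"
      unfolding c(2) using l by simp
    show "Sq0 ((s' \<cdot>\<^bsub>arrow_cat M\<^esub> s) \<otimes>\<^bsub>arrow_box M\<^esub> (t' \<cdot>\<^bsub>arrow_cat M\<^esub> t)) \<cdot> box_inr M a b =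
        Sq0 ((s' \<otimes>\<^bsub>arrow_box M\<^esub> t') \<cdot>\<^bsub>arrow_cat M\<^esub> (s \<otimes>\<^bsub>arrow_box M\<^esub> t)) \<cdot> box_inr M a b"
      unfolding c(3) using r by simp
    show "Sq1 ((s' \<cdot>\<^bsub>arrow_cat M\<^esub> s) \<otimes>\<^bsub>arrow_box M\<^esub> (t' \<cdot>\<^bsub>arrow_cat M\<^esub> t)) =
        Sq1 ((s' \<otimes>\<^bsub>arrow_box M\<^esub> t') \<cdot>\<^bsub>arrow_cat M\<^esub> (s \<otimes>\<^bsub>arrow_box M\<^esub> t))"
      unfolding c(4) using arr st(4) st'(4) by simp
  qed
qed


subsection \<open>Unitors and symmetry\<close>

lemma L1_obj [simp]:
  assumes "x \<in> Obj M"
  shows "L1_obj M x \<in> Arr M" "Dom M (L1_obj M x) = init_obj M" "Cod M (L1_obj M x) = x"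
  using the_arr_initial[OF initial_init assms] by (auto simp: L1_obj_def hom_def)

lemma initial_eqI: "\<lbrakk>is_initial M a; f \<in> Arr M; g \<in> Arr M; Dom M f = a; Dom M g = a; Cod M f = Cod M g\<rbrakk> \<Longrightarrow> f = g"
  by (rule initial_arr_eq[of a _ "Cod M g"]) (auto simp: hom_def)

lemma the_arr_initial_arr [simp]:
  assumes "is_initial M a" "x \<in> Obj M"
  shows "the_arr M a x \<in> Arr M" "Dom M (the_arr M a x) = a" "Cod M (the_arr M a x) = x"
  using the_arr_initial[OF assms] by (auto simp: hom_def)

lemma lunit_arr [simp]:
  assumes "a \<in> Obj M"
  shows "LUnit M a \<in> Arr M" "Dom M (LUnit M a) = Unit M \<otimes>\<^sub>o a" "Cod M (LUnit M a) = a"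
  using lunit_hom[OF assms] by (auto simp: hom_def)

lemma runit_arr [simp]:
  assumes "a \<in> Obj M"
  shows "RUnit M a \<in> Arr M" "Dom M (RUnit M a) = a \<otimes>\<^sub>o Unit M" "Cod M (RUnit M a) = a"
  using runit_hom[OF assms] by (auto simp: hom_def)

lemma sym_arr [simp]:
  assumes "a \<in> Obj M" "b \<in> Obj M"
  shows "Sym M a b \<in> Arr M" "Dom M (Sym M a b) = a \<otimes>\<^sub>o b" "Cod M (Sym M a b) = b \<otimes>\<^sub>o a"
  using sym_hom[OF assms] by (auto simp: hom_def)

lemma sym_nat:
  assumes "f \<in> Arr M" "g \<in> Arr M"
  shows "Sym M (Cod M f) (Cod M g) \<cdot> (f \<otimes> g) = (g \<otimes> f) \<cdot> Sym M (Dom M f) (Dom M g)"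
  using assms by (intro sym_natural) (auto simp: hom_def)

text \<open>The left leg starts at an initial object, so all equations on it are automatic; on the
  right leg the claim is the naturality of \<open>LUnit\<close>. For the right unitor the legs
  change roles.\<close>

lemma box_lunit_hom:
  assumes f: "f \<in> Arr M"
  shows "LUnit (arrow_box M) f \<in> hom (arrow_cat M) (pushout_product M (L1_obj M (Unit M)) f) f"
proof -
  let ?e = "L1_obj M (Unit M)"
  let ?p = "the_arr M (init_obj M \<otimes>\<^sub>o Cod M f) (Dom M f)" and ?q = "LUnit M (Dom M f)"
  have init: "is_initial M (init_obj M \<otimes>\<^sub>o x)" if "x \<in> Obj M" for x
    using that initial_init by (rule tensor_right_initial)
  have p: "?p \<in> Arr M" "Dom M ?p = init_obj M \<otimes>\<^sub>o Cod M f" "Cod M ?p = Dom M f"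
    using f init by auto
  have pq: "?p \<cdot> (Ident M (Dom M ?e) \<otimes> f) = ?q \<cdot> (?e \<otimes> Ident M (Dom M f))"
    by (rule initial_eqI[OF init[of "Dom M f"]]) (use f p in simp_all)
  let ?u = "box_copair M ?e f ?p ?q"
  have u: "?u \<in> Arr M" "Dom M ?u = Dom M (pushout_product M ?e f)" "Cod M ?u = Cod M ?q"
    "?u \<cdot> box_inl M ?e f = ?p" "?u \<cdot> box_inr M ?e f = ?q"
    by (intro box_copair, use f p pq in simp_all)+
  have "f \<cdot> ?u = LUnit M (Cod M f) \<cdot> pushout_product M ?e f"
  proof (rule box_eqI[of ?e f])
    show "(f \<cdot> ?u) \<cdot> box_inl M ?e f = (LUnit M (Cod M f) \<cdot> pushout_product M ?e f) \<cdot> box_inl M ?e f"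
      by (rule initial_eqI[OF init[of "Cod M f"]]) (use f p u in simp_all)
    show "(f \<cdot> ?u) \<cdot> box_inr M ?e f = (LUnit M (Cod M f) \<cdot> pushout_product M ?e f) \<cdot> box_inr M ?e f"
      using f u lunit_natural[of f "Dom M f" "Cod M f"] by (simp add: hom_def)
  qed (use f u(1-3) in simp_all)
  then show ?thesis
    using f u(1-3) by (simp add: arrow_box_def) (intro squareI; simp)
qed

lemma box_runit_hom:
  assumes f: "f \<in> Arr M"
  shows "RUnit (arrow_box M) f \<in> hom (arrow_cat M) (pushout_product M f (L1_obj M (Unit M))) f"
proof -
  let ?e = "L1_obj M (Unit M)"
  let ?p = "RUnit M (Dom M f)" and ?q = "the_arr M (Cod M f \<otimes>\<^sub>o init_obj M) (Dom M f)"
  have init: "is_initial M (x \<otimes>\<^sub>o init_obj M)" if "x \<in> Obj M" for x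
    using that initial_init by (rule tensor_left_initial)
  have p: "?q \<in> Arr M" "Dom M ?q = Cod M f \<otimes>\<^sub>o init_obj M" "Cod M ?q = Dom M f"
    using f init by auto
  have pq: "?p \<cdot> (Ident M (Dom M f) \<otimes> ?e) = ?q \<cdot> (f \<otimes> Ident M (Dom M ?e))"
    by (rule initial_eqI[OF init[of "Dom M f"]]) (use f p in simp_all)
  let ?u = "box_copair M f ?e ?p ?q"
  have u: "?u \<in> Arr M" "Dom M ?u = Dom M (pushout_product M f ?e)" "Cod M ?u = Cod M ?q"
    "?u \<cdot> box_inl M f ?e = ?p" "?u \<cdot> box_inr M f ?e = ?q"
    by (intro box_copair, use f p pq in simp_all)+
  have "f \<cdot> ?u = RUnit M (Cod M f) \<cdot> pushout_product M f ?e"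
  proof (rule box_eqI[of f ?e])
    show "(f \<cdot> ?u) \<cdot> box_inr M f ?e = (RUnit M (Cod M f) \<cdot> pushout_product M f ?e) \<cdot> box_inr M f ?e"
      by (rule initial_eqI[OF init[of "Cod M f"]]) (use f p u in simp_all)
    show "(f \<cdot> ?u) \<cdot> box_inl M f ?e = (RUnit M (Cod M f) \<cdot> pushout_product M f ?e) \<cdot> box_inl M f ?e"
      using f p u runit_natural[of f "Dom M f" "Cod M f"] by (simp add: hom_def)
  qed (use f p u(1-3) in simp_all)
  then show ?thesis
    using f p u(1-3) by (simp add: arrow_box_def) (intro squareI; simp)
qed

text \<open>The symmetry exchanges the two legs, so compatibility of the branches is a slide in the
  pushout product of \<open>g\<close> and \<open>f\<close> between two naturality squares.\<close>

lemma box_sym_hom: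
  assumes f: "f \<in> Arr M" and g: "g \<in> Arr M"
  shows "Sym (arrow_box M) f g \<in> hom (arrow_cat M) (pushout_product M f g) (pushout_product M g f)"
proof -
  let ?p = "box_inr M g f \<cdot> Sym M (Dom M f) (Cod M g)" and ?q = "box_inl M g f \<cdot> Sym M (Cod M f) (Dom M g)"
  have "?p \<cdot> (Ident M (Dom M f) \<otimes> g) = box_inr M g f \<cdot> ((g \<otimes> Ident M (Dom M f)) \<cdot> Sym M (Dom M f) (Dom M g))"
    using f g sym_nat[of "Ident M (Dom M f)" g] by simp
  also have "\<dots> = (box_inr M g f \<cdot> (g \<otimes> Ident M (Dom M f))) \<cdot> Sym M (Dom M f) (Dom M g)"
    using f g by simp
  also have "box_inr M g f \<cdot> (g \<otimes> Ident M (Dom M f)) = box_inl M g f \<cdot> (Ident M (Dom M g) \<otimes> f)"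
    using f g box_slide[of g f "Ident M (Dom M g)" "Ident M (Dom M f)"] by simp
  also have "(box_inl M g f \<cdot> (Ident M (Dom M g) \<otimes> f)) \<cdot> Sym M (Dom M f) (Dom M g) =
      ?q \<cdot> (f \<otimes> Ident M (Dom M g))"
    using f g sym_nat[of f "Ident M (Dom M g)"] by simp
  finally have pq: "?p \<cdot> (Ident M (Dom M f) \<otimes> g) = ?q \<cdot> (f \<otimes> Ident M (Dom M g))" .
  let ?u = "box_copair M f g ?p ?q"
  have u: "?u \<in> Arr M" "Dom M ?u = Dom M (pushout_product M f g)" "Cod M ?u = Cod M ?q"
    "?u \<cdot> box_inl M f g = ?p" "?u \<cdot> box_inr M f g = ?q"
    by (intro box_copair, use f g pq in \<open>simp_all del: comp_assoc_arr\<close>)+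
  have "pushout_product M g f \<cdot> ?u = Sym M (Cod M f) (Cod M g) \<cdot> pushout_product M f g"
  proof (rule box_eqI[OF f g])
    show "(pushout_product M g f \<cdot> ?u) \<cdot> box_inl M f g =
        (Sym M (Cod M f) (Cod M g) \<cdot> pushout_product M f g) \<cdot> box_inl M f g"
      using f g u sym_nat[of f "Ident M (Cod M g)"] by simp
    show "(pushout_product M g f \<cdot> ?u) \<cdot> box_inr M f g =
        (Sym M (Cod M f) (Cod M g) \<cdot> pushout_product M f g) \<cdot> box_inr M f g"
      using f g u sym_nat[of "Ident M (Cod M f)" g] by simp
  qed (use f g u(1-3) in simp_all)
  then show ?thesis
    using f g u(1-3) by (simp add: arrow_box_def) (intro squareI; simp)
qed

end

context pointed_monoidal
begin

subsection \<open>The associator\<close>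

text \<open>Tensoring preserves the defining pushout, so the tensored legs are still jointly
  epic.\<close>

lemma box_tensor_eqI:
  assumes fg: "f \<in> Arr M" "g \<in> Arr M" and x: "x \<in> Obj M"
    and "u \<in> Arr M" "v \<in> Arr M"
  shows "\<lbrakk>Dom M u = Dom M (pushout_product M f g) \<otimes>\<^sub>o x; Dom M v = Dom M (pushout_product M f g) \<otimes>\<^sub>o x;
      u \<cdot> (box_inl M f g \<otimes> Ident M x) = v \<cdot> (box_inl M f g \<otimes> Ident M x);
      u \<cdot> (box_inr M f g \<otimes> Ident M x) = v \<cdot> (box_inr M f g \<otimes> Ident M x)\<rbrakk> \<Longrightarrow> u = v"
    and "\<lbrakk>Dom M u = x \<otimes>\<^sub>o Dom M (pushout_product M f g); Dom M v = x \<otimes>\<^sub>o Dom M (pushout_product M f g);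
      u \<cdot> (Ident M x \<otimes> box_inl M f g) = v \<cdot> (Ident M x \<otimes> box_inl M f g);
      u \<cdot> (Ident M x \<otimes> box_inr M f g) = v \<cdot> (Ident M x \<otimes> box_inr M f g)\<rbrakk> \<Longrightarrow> u = v"
proof -
  show "u = v" if "Dom M u = Dom M (pushout_product M f g) \<otimes>\<^sub>o x"
      "Dom M v = Dom M (pushout_product M f g) \<otimes>\<^sub>o x"
      "u \<cdot> (box_inl M f g \<otimes> Ident M x) = v \<cdot> (box_inl M f g \<otimes> Ident M x)"
      "u \<cdot> (box_inr M f g \<otimes> Ident M x) = v \<cdot> (box_inr M f g \<otimes> Ident M x)"
    by (rule pushout_eqI[OF tensor_right_pushout[OF x box_pushout[OF fg]]]) (use assms that in simp_all)
  show "u = v" if "Dom M u = x \<otimes>\<^sub>o Dom M (pushout_product M f g)"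
      "Dom M v = x \<otimes>\<^sub>o Dom M (pushout_product M f g)"
      "u \<cdot> (Ident M x \<otimes> box_inl M f g) = v \<cdot> (Ident M x \<otimes> box_inl M f g)"
      "u \<cdot> (Ident M x \<otimes> box_inr M f g) = v \<cdot> (Ident M x \<otimes> box_inr M f g)"
    by (rule pushout_eqI[OF tensor_left_pushout[OF x box_pushout[OF fg]]]) (use assms that in simp_all)
qed

text \<open>Carries an equation between two composites into the head of a longer right-nested
  composite.\<close>

lemma comp_cong2:
  assumes "a \<cdot> b = c \<cdot> d" "a \<in> Arr M" "b \<in> Arr M" "c \<in> Arr M" "d \<in> Arr M" "Dom M a = Cod M b"
    "Dom M c = Cod M d" "k \<in> Arr M" "Cod M k = Dom M b"
  shows "a \<cdot> (b \<cdot> k) = c \<cdot> (d \<cdot> k)"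
proof -
  have "Dom M (a \<cdot> b) = Dom M (c \<cdot> d)" by (simp only: assms(1))
  then have d: "Dom M d = Dom M b" using assms(2-7) by simp
  have "a \<cdot> (b \<cdot> k) = (a \<cdot> b) \<cdot> k"
    using assms(2-9) by (intro comp_assoc_arr[symmetric]) simp_all
  also have "\<dots> = c \<cdot> (d \<cdot> k)"
    unfolding assms(1) using assms(2-9) d by (intro comp_assoc_arr) simp_all
  finally show ?thesis .
qed

context
  fixes f g h
  assumes arrs [simp]: "f \<in> Arr M" "g \<in> Arr M" "h \<in> Arr M"
begin

abbreviation (input) "fg \<equiv> pushout_product M f g"
abbreviation (input) "gh \<equiv> pushout_product M g h"
abbreviation (input) "il \<equiv> box_inl M f g"
abbreviation (input) "ir \<equiv> box_inr M f g"
abbreviation (input) "jl \<equiv> box_inl M fg h"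
abbreviation (input) "jr \<equiv> box_inr M fg h"
abbreviation (input) "kl \<equiv> box_inl M g h"
abbreviation (input) "kr \<equiv> box_inr M g h"
abbreviation (input) "ml \<equiv> box_inl M f gh"
abbreviation (input) "mr \<equiv> box_inr M f gh"
abbreviation (input) "i x \<equiv> Ident M x"

text \<open>The two iterated pushout products are colimits of the same diagram: a map out of either is
  determined by its restrictions to \<open>X\<^sub>0 \<otimes> Y\<^sub>1 \<otimes> Z\<^sub>1\<close>, \<open>X\<^sub>1 \<otimes> Y\<^sub>0 \<otimes> Z\<^sub>1\<close> and \<open>X\<^sub>1 \<otimes> Y\<^sub>1 \<otimes> Z\<^sub>0\<close>.\<close>

lemma left_triple_eqI:
  assumes "u \<in> Arr M" "v \<in> Arr M" "Dom M u = Dom M (pushout_product M fg h)"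
    "Dom M v = Dom M (pushout_product M fg h)"
    and "u \<cdot> (jl \<cdot> (il \<otimes> i (Cod M h))) = v \<cdot> (jl \<cdot> (il \<otimes> i (Cod M h)))"
    and "u \<cdot> (jl \<cdot> (ir \<otimes> i (Cod M h))) = v \<cdot> (jl \<cdot> (ir \<otimes> i (Cod M h)))"
    and "u \<cdot> jr = v \<cdot> jr"
  shows "u = v"
proof (rule box_eqI[of fg h])
  show "u \<cdot> jl = v \<cdot> jl"
    by (rule box_tensor_eqI(1)[of f g "Cod M h"]) (use assms in simp_all)
qed (use assms in simp_all)

lemma right_triple_eqI:
  assumes "u \<in> Arr M" "v \<in> Arr M" "Dom M u = Dom M (pushout_product M f gh)"
    "Dom M v = Dom M (pushout_product M f gh)"
    and "u \<cdot> ml = v \<cdot> ml"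
    and "u \<cdot> (mr \<cdot> (i (Cod M f) \<otimes> kl)) = v \<cdot> (mr \<cdot> (i (Cod M f) \<otimes> kl))"
    and "u \<cdot> (mr \<cdot> (i (Cod M f) \<otimes> kr)) = v \<cdot> (mr \<cdot> (i (Cod M f) \<otimes> kr))"
  shows "u = v"
proof (rule box_eqI[of f gh])
  show "u \<cdot> mr = v \<cdot> mr"
    by (rule box_tensor_eqI(2)[of g h "Cod M f"]) (use assms in simp_all)
qed (use assms in simp_all)

text \<open>The four \<open>slide\<close> facts are \<open>box_slide\<close> for the outer pushouts,
  precomposed with a leg of the inner pushout, on which the pushout product becomes a tensor product
  of arrows.\<close>

lemma slide1: "ml \<cdot> (i (Dom M f) \<otimes> (g \<otimes> i (Cod M h))) = mr \<cdot> (f \<otimes> kl)"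
  using box_slide[of f gh "i (Dom M f)" kl] by simp

lemma slide2: "ml \<cdot> (i (Dom M f) \<otimes> (i (Cod M g) \<otimes> h)) = mr \<cdot> (f \<otimes> kr)"
  using box_slide[of f gh "i (Dom M f)" kr] by simp

lemma slide3: "jl \<cdot> (ir \<otimes> h) = jr \<cdot> ((i (Cod M f) \<otimes> g) \<otimes> i (Dom M h))"
  using box_slide[of fg h ir "i (Dom M h)"] by simp

lemma slide4: "jl \<cdot> (il \<otimes> h) = jr \<cdot> ((f \<otimes> i (Cod M g)) \<otimes> i (Dom M h))"
  using box_slide[of fg h il "i (Dom M h)"] by simp

lemma commute_fg: "il \<cdot> (i (Dom M f) \<otimes> g) = ir \<cdot> (f \<otimes> i (Dom M g))"
  using box_slide[of f g "i (Dom M f)" "i (Dom M g)"] by simp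

lemma commute_gh: "kl \<cdot> (i (Dom M g) \<otimes> h) = kr \<cdot> (g \<otimes> i (Dom M h))"
  using box_slide[of g h "i (Dom M g)" "i (Dom M h)"] by simp

text \<open>Existence by gluing twice: \<open>?p1\<close> and \<open>?p2\<close> agree over the
  inner pushout tensored with \<open>Cod M h\<close> and give \<open>v\<close>; then
  \<open>v\<close> and \<open>?p3\<close> agree over the outer pushout. Every compatibility is a
  slide or an inner commuting square combined with naturality of the associator.\<close>

lemma ex_box_assoc:
  obtains w where "w \<in> Arr M" "Dom M w = Dom M (pushout_product M fg h)"
    "Cod M w = Dom M (pushout_product M f gh)"
    "w \<cdot> (jl \<cdot> (il \<otimes> i (Cod M h))) = ml \<cdot> Assoc M (Dom M f) (Cod M g) (Cod M h)"
    "w \<cdot> (jl \<cdot> (ir \<otimes> i (Cod M h))) = mr \<cdot> ((i (Cod M f) \<otimes> kl) \<cdot> Assoc M (Cod M f) (Dom M g) (Cod M h))"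
    "w \<cdot> jr = mr \<cdot> ((i (Cod M f) \<otimes> kr) \<cdot> Assoc M (Cod M f) (Cod M g) (Dom M h))"
proof -
  let ?p1 = "ml \<cdot> Assoc M (Dom M f) (Cod M g) (Cod M h)"
  let ?p2 = "mr \<cdot> ((i (Cod M f) \<otimes> kl) \<cdot> Assoc M (Cod M f) (Dom M g) (Cod M h))"
  let ?p3 = "mr \<cdot> ((i (Cod M f) \<otimes> kr) \<cdot> Assoc M (Cod M f) (Cod M g) (Dom M h))"
  let ?R = "Dom M (pushout_product M f gh)"
  have "?p1 \<cdot> ((i (Dom M f) \<otimes> g) \<otimes> i (Cod M h)) =
      ml \<cdot> ((i (Dom M f) \<otimes> (g \<otimes> i (Cod M h))) \<cdot> Assoc M (Dom M f) (Dom M g) (Cod M h))"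
    using assoc_nat[of "i (Dom M f)" g "i (Cod M h)"] by simp
  also have "\<dots> = mr \<cdot> ((f \<otimes> kl) \<cdot> Assoc M (Dom M f) (Dom M g) (Cod M h))"
    by (rule comp_cong2[OF slide1]) simp_all
  also have "\<dots> = ?p2 \<cdot> ((f \<otimes> i (Dom M g)) \<otimes> i (Cod M h))"
    using assoc_nat[of f "i (Dom M g)" "i (Cod M h)"] by simp
  finally have "?p1 \<cdot> ((i (Dom M f) \<otimes> g) \<otimes> i (Cod M h)) = ?p2 \<cdot> ((f \<otimes> i (Dom M g)) \<otimes> i (Cod M h))" .
  then obtain v where v: "v \<in> Arr M" "Dom M v = Cod M (il \<otimes> i (Cod M h))" "Cod M v = ?R"
    "v \<cdot> (il \<otimes> i (Cod M h)) = ?p1" "v \<cdot> (ir \<otimes> i (Cod M h)) = ?p2"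
    by (rule pushout_factor[OF tensor_right_pushout[OF _ box_pushout[of f g], of "Cod M h"], of ?p1 ?p2 ?R, rotated -2])
      (simp_all del: comp_assoc_arr)
  \<comment> \<open>Both sides start at the inner pushout tensored with \<open>Dom M h\<close>, so
    they are compared on the two tensored inner legs.\<close>
  have "v \<cdot> (i (Dom M fg) \<otimes> h) = ?p3 \<cdot> (fg \<otimes> i (Dom M h))"
  proof (rule box_tensor_eqI(1)[of f g "Dom M h"])
    have "(v \<cdot> (i (Dom M fg) \<otimes> h)) \<cdot> (il \<otimes> i (Dom M h)) = v \<cdot> ((il \<otimes> i (Cod M h)) \<cdot> (i (Dom M f \<otimes>\<^sub>o Cod M g) \<otimes> h))"
      using v(1-3) by simp
    also have "\<dots> = ml \<cdot> (Assoc M (Dom M f) (Cod M g) (Cod M h) \<cdot> (i (Dom M f \<otimes>\<^sub>o Cod M g) \<otimes> h))"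
      by (rule comp_cong2[OF v(4)]) (use v(1-3) in simp_all)
    also have "\<dots> = ml \<cdot> ((i (Dom M f) \<otimes> (i (Cod M g) \<otimes> h)) \<cdot> Assoc M (Dom M f) (Cod M g) (Dom M h))"
      using assoc_nat[of "i (Dom M f)" "i (Cod M g)" h] by simp
    also have "\<dots> = mr \<cdot> ((f \<otimes> kr) \<cdot> Assoc M (Dom M f) (Cod M g) (Dom M h))"
      by (rule comp_cong2[OF slide2]) simp_all
    also have "\<dots> = (?p3 \<cdot> (fg \<otimes> i (Dom M h))) \<cdot> (il \<otimes> i (Dom M h))"
      using assoc_nat[of f "i (Cod M g)" "i (Dom M h)"] by simp
    finally show "(v \<cdot> (i (Dom M fg) \<otimes> h)) \<cdot> (il \<otimes> i (Dom M h)) =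
      (?p3 \<cdot> (fg \<otimes> i (Dom M h))) \<cdot> (il \<otimes> i (Dom M h))" .
    have "(v \<cdot> (i (Dom M fg) \<otimes> h)) \<cdot> (ir \<otimes> i (Dom M h)) = v \<cdot> ((ir \<otimes> i (Cod M h)) \<cdot> (i (Cod M f \<otimes>\<^sub>o Dom M g) \<otimes> h))"
      using v(1-3) by simp
    also have "\<dots> = mr \<cdot> (((i (Cod M f) \<otimes> kl) \<cdot> Assoc M (Cod M f) (Dom M g) (Cod M h)) \<cdot> (i (Cod M f \<otimes>\<^sub>o Dom M g) \<otimes> h))"
      by (rule comp_cong2[OF v(5)]) (use v(1-3) in simp_all)
    also have "\<dots> = mr \<cdot> ((i (Cod M f) \<otimes> (kl \<cdot> (i (Dom M g) \<otimes> h))) \<cdot> Assoc M (Cod M f) (Dom M g) (Dom M h))"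
      using assoc_nat[of "i (Cod M f)" "i (Dom M g)" h] by simp
    also have "\<dots> = (?p3 \<cdot> (fg \<otimes> i (Dom M h))) \<cdot> (ir \<otimes> i (Dom M h))"
      unfolding commute_gh using assoc_nat[of "i (Cod M f)" g "i (Dom M h)"] by simp
    finally show "(v \<cdot> (i (Dom M fg) \<otimes> h)) \<cdot> (ir \<otimes> i (Dom M h)) =
      (?p3 \<cdot> (fg \<otimes> i (Dom M h))) \<cdot> (ir \<otimes> i (Dom M h))" .
  qed (use v(1-3) in simp_all)
  then obtain w where w: "w \<in> Arr M" "Dom M w = Cod M jl" "Cod M w = ?R" "w \<cdot> jl = v" "w \<cdot> jr = ?p3"
    by (rule pushout_factor[OF box_pushout[of fg h], of v ?p3 ?R, rotated -2])
      (use v(1-3) in \<open>simp_all del: comp_assoc_arr\<close>)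
  have "w \<cdot> (jl \<cdot> k) = v \<cdot> k" if "k \<in> Arr M" "Cod M k = Dom M jl" for k
    using w(1,2) that by (simp flip: w(4))
  with v w show ?thesis
    by (intro that[of w]) simp_all
qed

text \<open>The same gluing from the other side: the branches through \<open>kl\<close> and
  \<open>kr\<close> are joined first, over the inner pushout tensored with
  \<open>Cod M f\<close>.\<close>

lemma ex_box_assoc_inv:
  obtains w where "w \<in> Arr M" "Dom M w = Dom M (pushout_product M f gh)"
    "Cod M w = Dom M (pushout_product M fg h)"
    "w \<cdot> ml = jl \<cdot> ((il \<otimes> i (Cod M h)) \<cdot> assoc_inv (Dom M f) (Cod M g) (Cod M h))"
    "w \<cdot> (mr \<cdot> (i (Cod M f) \<otimes> kl)) = jl \<cdot> ((ir \<otimes> i (Cod M h)) \<cdot> assoc_inv (Cod M f) (Dom M g) (Cod M h))"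
    "w \<cdot> (mr \<cdot> (i (Cod M f) \<otimes> kr)) = jr \<cdot> assoc_inv (Cod M f) (Cod M g) (Dom M h)"
proof -
  let ?p1 = "jl \<cdot> ((il \<otimes> i (Cod M h)) \<cdot> assoc_inv (Dom M f) (Cod M g) (Cod M h))"
  let ?p2 = "jl \<cdot> ((ir \<otimes> i (Cod M h)) \<cdot> assoc_inv (Cod M f) (Dom M g) (Cod M h))"
  let ?p3 = "jr \<cdot> assoc_inv (Cod M f) (Cod M g) (Dom M h)"
  let ?S = "Dom M (pushout_product M fg h)"
  have "?p2 \<cdot> (i (Cod M f) \<otimes> (i (Dom M g) \<otimes> h)) = jl \<cdot> ((ir \<otimes> h) \<cdot> assoc_inv (Cod M f) (Dom M g) (Dom M h))"
    using assoc_inv_nat[of "i (Cod M f)" "i (Dom M g)" h] by simp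
  also have "\<dots> = jr \<cdot> (((i (Cod M f) \<otimes> g) \<otimes> i (Dom M h)) \<cdot> assoc_inv (Cod M f) (Dom M g) (Dom M h))"
    by (rule comp_cong2[OF slide3]) simp_all
  also have "\<dots> = ?p3 \<cdot> (i (Cod M f) \<otimes> (g \<otimes> i (Dom M h)))"
    using assoc_inv_nat[of "i (Cod M f)" g "i (Dom M h)"] by simp
  finally have "?p2 \<cdot> (i (Cod M f) \<otimes> (i (Dom M g) \<otimes> h)) = ?p3 \<cdot> (i (Cod M f) \<otimes> (g \<otimes> i (Dom M h)))" .
  then obtain v where v: "v \<in> Arr M" "Dom M v = Cod M (i (Cod M f) \<otimes> kl)" "Cod M v = ?S"
    "v \<cdot> (i (Cod M f) \<otimes> kl) = ?p2" "v \<cdot> (i (Cod M f) \<otimes> kr) = ?p3"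
    by (rule pushout_factor[OF tensor_left_pushout[OF _ box_pushout[of g h], of "Cod M f"], of ?p2 ?p3 ?S, rotated -2])
      (simp_all del: comp_assoc_arr)
  have "?p1 \<cdot> (i (Dom M f) \<otimes> gh) = v \<cdot> (f \<otimes> i (Dom M gh))"
  proof (rule box_tensor_eqI(2)[of g h "Dom M f"])
    have "(v \<cdot> (f \<otimes> i (Dom M gh))) \<cdot> (i (Dom M f) \<otimes> kl) = v \<cdot> ((i (Cod M f) \<otimes> kl) \<cdot> (f \<otimes> i (Dom M g \<otimes>\<^sub>o Cod M h)))"
      using v(1-3) by simp
    also have "\<dots> = jl \<cdot> (((ir \<otimes> i (Cod M h)) \<cdot> assoc_inv (Cod M f) (Dom M g) (Cod M h)) \<cdot> (f \<otimes> i (Dom M g \<otimes>\<^sub>o Cod M h)))"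
      by (rule comp_cong2[OF v(4)]) (use v(1-3) in simp_all)
    also have "\<dots> = jl \<cdot> (((ir \<cdot> (f \<otimes> i (Dom M g))) \<otimes> i (Cod M h)) \<cdot> assoc_inv (Dom M f) (Dom M g) (Cod M h))"
      using assoc_inv_nat[of f "i (Dom M g)" "i (Cod M h)"] by simp
    also have "\<dots> = (?p1 \<cdot> (i (Dom M f) \<otimes> gh)) \<cdot> (i (Dom M f) \<otimes> kl)"
      unfolding commute_fg[symmetric] using assoc_inv_nat[of "i (Dom M f)" g "i (Cod M h)"] by simp
    finally show "(?p1 \<cdot> (i (Dom M f) \<otimes> gh)) \<cdot> (i (Dom M f) \<otimes> kl) =
      (v \<cdot> (f \<otimes> i (Dom M gh))) \<cdot> (i (Dom M f) \<otimes> kl)" by (rule sym)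
    have "(v \<cdot> (f \<otimes> i (Dom M gh))) \<cdot> (i (Dom M f) \<otimes> kr) = v \<cdot> ((i (Cod M f) \<otimes> kr) \<cdot> (f \<otimes> i (Cod M g \<otimes>\<^sub>o Dom M h)))"
      using v(1-3) by simp
    also have "\<dots> = jr \<cdot> (assoc_inv (Cod M f) (Cod M g) (Dom M h) \<cdot> (f \<otimes> i (Cod M g \<otimes>\<^sub>o Dom M h)))"
      by (rule comp_cong2[OF v(5)]) (use v(1-3) in simp_all)
    also have "\<dots> = jr \<cdot> (((f \<otimes> i (Cod M g)) \<otimes> i (Dom M h)) \<cdot> assoc_inv (Dom M f) (Cod M g) (Dom M h))"
      using assoc_inv_nat[of f "i (Cod M g)" "i (Dom M h)"] by simp
    also have "\<dots> = jl \<cdot> ((il \<otimes> h) \<cdot> assoc_inv (Dom M f) (Cod M g) (Dom M h))"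
      by (rule comp_cong2[OF slide4[symmetric]]) simp_all
    also have "\<dots> = (?p1 \<cdot> (i (Dom M f) \<otimes> gh)) \<cdot> (i (Dom M f) \<otimes> kr)"
      using assoc_inv_nat[of "i (Dom M f)" "i (Cod M g)" h] by simp
    finally show "(?p1 \<cdot> (i (Dom M f) \<otimes> gh)) \<cdot> (i (Dom M f) \<otimes> kr) =
      (v \<cdot> (f \<otimes> i (Dom M gh))) \<cdot> (i (Dom M f) \<otimes> kr)" by (rule sym)
  qed (use v(1-3) in simp_all)
  then obtain w where w: "w \<in> Arr M" "Dom M w = Cod M ml" "Cod M w = ?S" "w \<cdot> ml = ?p1" "w \<cdot> mr = v"
    by (rule pushout_factor[OF box_pushout[of f gh], of ?p1 v ?S, rotated -2])
      (use v(1-3) in \<open>simp_all del: comp_assoc_arr\<close>)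
  have "w \<cdot> (mr \<cdot> k) = v \<cdot> k" if "k \<in> Arr M" "Cod M k = Dom M mr" for k
    using w(1,2) that by (simp flip: w(5))
  with v w show ?thesis
    by (intro that[of w]) simp_all
qed

text \<open>Justifies the definite description: existence is \<open>ex_box_assoc\<close>, uniqueness
  is \<open>left_triple_eqI\<close>.\<close>

lemma box_assoc0:
  shows "box_assoc0 M f g h \<in> Arr M" "Dom M (box_assoc0 M f g h) = Dom M (pushout_product M fg h)"
    "Cod M (box_assoc0 M f g h) = Dom M (pushout_product M f gh)"
    "box_assoc0 M f g h \<cdot> (jl \<cdot> (il \<otimes> i (Cod M h))) = ml \<cdot> Assoc M (Dom M f) (Cod M g) (Cod M h)"
    "box_assoc0 M f g h \<cdot> (jl \<cdot> (ir \<otimes> i (Cod M h))) =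
      mr \<cdot> ((i (Cod M f) \<otimes> kl) \<cdot> Assoc M (Cod M f) (Dom M g) (Cod M h))"
    "box_assoc0 M f g h \<cdot> jr = mr \<cdot> ((i (Cod M f) \<otimes> kr) \<cdot> Assoc M (Cod M f) (Cod M g) (Dom M h))"
proof -
  let ?P = "\<lambda>u. u \<in> hom M (Dom M (pushout_product M fg h)) (Dom M (pushout_product M f gh)) \<and>
    u \<cdot> (jl \<cdot> (il \<otimes> i (Cod M h))) = ml \<cdot> Assoc M (Dom M f) (Cod M g) (Cod M h) \<and>
    u \<cdot> (jl \<cdot> (ir \<otimes> i (Cod M h))) = mr \<cdot> ((i (Cod M f) \<otimes> kl) \<cdot> Assoc M (Cod M f) (Dom M g) (Cod M h)) \<and>
    u \<cdot> jr = mr \<cdot> ((i (Cod M f) \<otimes> kr) \<cdot> Assoc M (Cod M f) (Cod M g) (Dom M h))"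
  obtain w where "?P w"
    using ex_box_assoc unfolding hom_def by blast
  moreover have "u = w" if "?P u" "?P w" for u w
    by (rule left_triple_eqI) (use that in \<open>simp_all add: hom_def\<close>)
  ultimately have "\<exists>!u. ?P u" by blast
  from theI'[OF this] show "box_assoc0 M f g h \<in> Arr M"
    "Dom M (box_assoc0 M f g h) = Dom M (pushout_product M fg h)"
    "Cod M (box_assoc0 M f g h) = Dom M (pushout_product M f gh)"
    "box_assoc0 M f g h \<cdot> (jl \<cdot> (il \<otimes> i (Cod M h))) = ml \<cdot> Assoc M (Dom M f) (Cod M g) (Cod M h)"
    "box_assoc0 M f g h \<cdot> (jl \<cdot> (ir \<otimes> i (Cod M h))) =
      mr \<cdot> ((i (Cod M f) \<otimes> kl) \<cdot> Assoc M (Cod M f) (Dom M g) (Cod M h))"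
    "box_assoc0 M f g h \<cdot> jr = mr \<cdot> ((i (Cod M f) \<otimes> kr) \<cdot> Assoc M (Cod M f) (Cod M g) (Dom M h))"
    unfolding box_assoc0_def hom_def by blast+
qed

text \<open>On each of the three legs the required square is an instance of the naturality of the
  associator of \<open>M\<close>.\<close>

lemma box_assoc_hom:
  "Assoc (arrow_box M) f g h \<in>
    hom (arrow_cat M) (pushout_product M fg h) (pushout_product M f gh)"
proof -
  note b = box_assoc0
  let ?u = "box_assoc0 M f g h" and ?a = "Assoc M (Cod M f) (Cod M g) (Cod M h)"
  have "pushout_product M f gh \<cdot> ?u = ?a \<cdot> pushout_product M fg h"
  proof (rule left_triple_eqI)
    show "(pushout_product M f gh \<cdot> ?u) \<cdot> (jl \<cdot> (il \<otimes> i (Cod M h))) =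
        (?a \<cdot> pushout_product M fg h) \<cdot> (jl \<cdot> (il \<otimes> i (Cod M h)))"
      using b assoc_nat[of f "i (Cod M g)" "i (Cod M h)"] by simp
    show "(pushout_product M f gh \<cdot> ?u) \<cdot> (jl \<cdot> (ir \<otimes> i (Cod M h))) =
        (?a \<cdot> pushout_product M fg h) \<cdot> (jl \<cdot> (ir \<otimes> i (Cod M h)))"
      using b assoc_nat[of "i (Cod M f)" g "i (Cod M h)"] by simp
    show "(pushout_product M f gh \<cdot> ?u) \<cdot> jr = (?a \<cdot> pushout_product M fg h) \<cdot> jr"
      using b assoc_nat[of "i (Cod M f)" "i (Cod M g)" h] by simp
  qed (use b in simp_all)
  then show ?thesis
    using b by (simp add: arrow_box_def) (intro squareI; simp)
qed

lemma box_assoc0_iso: "is_iso M (box_assoc0 M f g h)"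
proof -
  note b = box_assoc0
  let ?u = "box_assoc0 M f g h"
  obtain w where w: "w \<in> Arr M" "Dom M w = Dom M (pushout_product M f gh)"
    "Cod M w = Dom M (pushout_product M fg h)"
    "w \<cdot> ml = jl \<cdot> ((il \<otimes> i (Cod M h)) \<cdot> assoc_inv (Dom M f) (Cod M g) (Cod M h))"
    "w \<cdot> (mr \<cdot> (i (Cod M f) \<otimes> kl)) = jl \<cdot> ((ir \<otimes> i (Cod M h)) \<cdot> assoc_inv (Cod M f) (Dom M g) (Cod M h))"
    "w \<cdot> (mr \<cdot> (i (Cod M f) \<otimes> kr)) = jr \<cdot> assoc_inv (Cod M f) (Cod M g) (Dom M h)"
    using ex_box_assoc_inv .
  \<comment> \<open>The facts \<open>wl\<close> to \<open>ur'\<close> are the equations of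
    \<open>w\<close> and \<open>?u\<close> on the legs with a further factor \<open>k\<close>. With
    them both composites simplify to the identity on each leg.\<close>
  have wl: "w \<cdot> (ml \<cdot> k) = jl \<cdot> ((il \<otimes> i (Cod M h)) \<cdot> (assoc_inv (Dom M f) (Cod M g) (Cod M h) \<cdot> k))"
    if "k \<in> Arr M" "Cod M k = Dom M ml" for k
    using comp_cong2[OF w(4), of k] w(1-3) that by simp
  have wr: "w \<cdot> (mr \<cdot> ((i (Cod M f) \<otimes> kl) \<cdot> k)) =
      jl \<cdot> ((ir \<otimes> i (Cod M h)) \<cdot> (assoc_inv (Cod M f) (Dom M g) (Cod M h) \<cdot> k))"
    if "k \<in> Arr M" "Cod M k = Dom M (i (Cod M f) \<otimes> kl)" for k
    using comp_cong2[OF w(5), of k] w(1-3) that by simp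
  have wr': "w \<cdot> (mr \<cdot> ((i (Cod M f) \<otimes> kr) \<cdot> k)) = jr \<cdot> (assoc_inv (Cod M f) (Cod M g) (Dom M h) \<cdot> k)"
    if "k \<in> Arr M" "Cod M k = Dom M (i (Cod M f) \<otimes> kr)" for k
    using comp_cong2[OF w(6), of k] w(1-3) that by simp
  have ul: "?u \<cdot> (jl \<cdot> ((il \<otimes> i (Cod M h)) \<cdot> k)) = ml \<cdot> (Assoc M (Dom M f) (Cod M g) (Cod M h) \<cdot> k)"
    if "k \<in> Arr M" "Cod M k = Dom M (il \<otimes> i (Cod M h))" for k
    using comp_cong2[OF b(4), of k] b(1-3) that by simp
  have ur: "?u \<cdot> (jl \<cdot> ((ir \<otimes> i (Cod M h)) \<cdot> k)) =
      mr \<cdot> ((i (Cod M f) \<otimes> kl) \<cdot> (Assoc M (Cod M f) (Dom M g) (Cod M h) \<cdot> k))"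
    if "k \<in> Arr M" "Cod M k = Dom M (ir \<otimes> i (Cod M h))" for k
    using comp_cong2[OF b(5), of k] b(1-3) that by simp
  have ur': "?u \<cdot> (jr \<cdot> k) = mr \<cdot> ((i (Cod M f) \<otimes> kr) \<cdot> (Assoc M (Cod M f) (Cod M g) (Dom M h) \<cdot> k))"
    if "k \<in> Arr M" "Cod M k = Dom M jr" for k
    using comp_cong2[OF b(6), of k] b(1-3) that by simp
  have "w \<cdot> ?u = i (Dom M (pushout_product M fg h))"
    by (rule left_triple_eqI) (use b w(1-3) wl wr wr' in simp_all)
  moreover have "?u \<cdot> w = i (Dom M (pushout_product M f gh))"
    by (rule right_triple_eqI) (use b(1-3) w ul ur ur' in simp_all)
  ultimately show ?thesis
    unfolding is_iso_def inverse_arrows_def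
    using b(1-3) w(1-3) by (intro exI[of _ w]) (simp add: hom_def)
qed

end

text \<open>Composing the commuting square with the two inverses shows that these form a square
  again.\<close>

lemma square_inverse:
  assumes s: "s \<in> hom (arrow_cat M) f g"
    and i0: "inverse_arrows M (Sq0 s) s0" and i1: "inverse_arrows M (Sq1 s) s1"
  shows "inverse_arrows (arrow_cat M) s (Square g f s0 s1)"
proof -
  note S = squareD[OF s]
  have a0: "s0 \<in> Arr M" "Dom M s0 = Dom M g" "Cod M s0 = Dom M f" "s0 \<cdot> Sq0 s = Ident M (Dom M f)"
      "Sq0 s \<cdot> s0 = Ident M (Dom M g)"
    and a1: "s1 \<in> Arr M" "Dom M s1 = Cod M g" "Cod M s1 = Cod M f" "s1 \<cdot> Sq1 s = Ident M (Cod M f)"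
      "Sq1 s \<cdot> s1 = Ident M (Cod M g)"
    using i0 i1 S by (simp_all add: inverse_arrows_def hom_def)
  have "f \<cdot> s0 = ((s1 \<cdot> Sq1 s) \<cdot> f) \<cdot> s0"
    unfolding a1(4) using S(2-9) a0(1-3) a1(1-3) by simp
  also have "\<dots> = s1 \<cdot> ((Sq1 s \<cdot> f) \<cdot> s0)"
    using S(2-9) a0(1-3) a1(1-3) by simp
  also have "\<dots> = s1 \<cdot> (g \<cdot> (Sq0 s \<cdot> s0))"
    unfolding S(10)[symmetric] using S(2-9) a0(1-3) a1(1-3) by simp
  also have "\<dots> = s1 \<cdot> g"
    unfolding a0(5) using S(2-9) a0(1-3) a1(1-3) by simp
  finally have "Square g f s0 s1 \<in> hom (arrow_cat M) g f"
    using S(2-9) a0(1-3) a1(1-3) by (intro squareI) simp_all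
  moreover have "s \<in> Arr (arrow_cat M)"
    using s by (simp add: hom_def)
  ultimately show ?thesis
    using S(11,12) a0(4,5) a1(4,5) by (simp add: inverse_arrows_def)
qed

lemma inverse_arrows_arrow:
  "inverse_arrows (arrow_box M) = inverse_arrows (arrow_cat M)"
  "inverse_arrows (arrow_tensor M) = inverse_arrows (arrow_cat M)"
  by (auto simp: inverse_arrows_def hom_arrow fun_eq_iff)

lemma square_iso:
  assumes "s \<in> hom (arrow_cat M) f g" "is_iso M (Sq0 s)" "is_iso M (Sq1 s)"
  shows "is_iso (arrow_cat M) s"
  using square_inverse[OF assms(1)] assms(2,3) by (auto simp: is_iso_def)

section \<open>The two tensor structures on the arrow category\<close>

lemma tensor_category_box: "tensor_category (arrow_box M)"
proof -
  interpret A: category "arrow_cat M" by (rule category_arrow_cat)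
  interpret N: category "arrow_box M" by (rule category_arrow_box)
  have eqs: "t \<cdot>\<^bsub>arrow_box M\<^esub> s = t \<cdot>\<^bsub>arrow_cat M\<^esub> s" "Ident (arrow_box M) f = Ident (arrow_cat M) f"
    "Obj (arrow_box M) = Arr M" "f \<otimes>\<^sub>o\<^bsub>arrow_box M\<^esub> g = pushout_product M f g"
    "Unit (arrow_box M) = L1_obj M (Unit M)" for s t f g
    by simp_all
  show ?thesis
  proof (unfold_locales, unfold eqs hom_arrow)
    fix f g h assume fgh: "f \<in> Arr M" "g \<in> Arr M" "h \<in> Arr M"
    show "is_iso (arrow_box M) (Assoc (arrow_box M) f g h)"
    proof -
      have "is_iso (arrow_cat M) (Assoc (arrow_box M) f g h)"
        using fgh box_assoc0_iso assoc_iso by (intro square_iso[OF box_assoc_hom]) (auto simp: arrow_box_def)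
      then show ?thesis
        by (simp add: is_iso_def inverse_arrows_arrow)
    qed
  qed (simp_all add: box_tensor_hom(1) box_tensor_ident box_tensor_comp box_assoc_hom
      box_lunit_hom box_runit_hom box_sym_hom del: arrow_cat_simps)
qed

lemma arrow_tensor_hom:
  assumes s: "s \<in> hom (arrow_cat M) f f'" and t: "t \<in> hom (arrow_cat M) g g'"
  shows "s \<otimes>\<^bsub>arrow_tensor M\<^esub> t \<in> hom (arrow_cat M) (f \<otimes> g) (f' \<otimes> g')"
proof -
  note S = squareD[OF s] and T = squareD[OF t]
  have "(f' \<otimes> g') \<cdot> (Sq0 s \<otimes> Sq0 t) = (Sq1 s \<otimes> Sq1 t) \<cdot> (f \<otimes> g)"
    using S(2-10) T(2-10) by simp
  then show ?thesis
    using S(2-9) T(2-9) by (simp add: S(11,12) T(11,12)) (intro squareI; simp)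
qed

lemma tensor_category_tensor: "tensor_category (arrow_tensor M)"
proof -
  interpret A: category "arrow_cat M" by (rule category_arrow_cat)
  interpret N: category "arrow_tensor M" by (rule category_arrow_tensor)
  have eqs: "Obj (arrow_tensor M) = Arr M" "f \<otimes>\<^sub>o\<^bsub>arrow_tensor M\<^esub> g = f \<otimes> g"
    "Unit (arrow_tensor M) = Ident M (Unit M)" for f g
    by simp_all
  have assoc: "Assoc (arrow_tensor M) f g h \<in> hom (arrow_cat M) ((f \<otimes> g) \<otimes> h) (f \<otimes> (g \<otimes> h))"
    if "f \<in> Arr M" "g \<in> Arr M" "h \<in> Arr M" for f g h
    using that by (simp add: arrow_tensor_def assoc_nat squareI)
  show ?thesis
  proof (unfold_locales, unfold eqs hom_arrow)
    fix f g h assume fgh: "f \<in> Arr M" "g \<in> Arr M" "h \<in> Arr M"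
    show "Assoc (arrow_tensor M) f g h \<in> hom (arrow_cat M) ((f \<otimes> g) \<otimes> h) (f \<otimes> (g \<otimes> h))"
      using fgh by (rule assoc)
    have "is_iso (arrow_cat M) (Assoc (arrow_tensor M) f g h)"
      using fgh assoc_iso by (intro square_iso[OF assoc]) (auto simp: arrow_tensor_def)
    then show "is_iso (arrow_tensor M) (Assoc (arrow_tensor M) f g h)"
      by (simp add: is_iso_def inverse_arrows_arrow)
  next
    fix f assume f: "f \<in> Arr M"
    show "LUnit (arrow_tensor M) f \<in> hom (arrow_cat M) (Ident M (Unit M) \<otimes> f) f"
      using f lunit_natural[of f "Dom M f" "Cod M f"] by (simp add: arrow_tensor_def hom_def[of M] squareI)
    show "RUnit (arrow_tensor M) f \<in> hom (arrow_cat M) (f \<otimes> Ident M (Unit M)) f"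
      using f runit_natural[of f "Dom M f" "Cod M f"] by (simp add: arrow_tensor_def hom_def[of M] squareI)
  next
    fix f g assume f: "f \<in> Arr M" and g: "g \<in> Arr M"
    show "Ident (arrow_tensor M) f \<otimes>\<^bsub>arrow_tensor M\<^esub> Ident (arrow_tensor M) g =
        Ident (arrow_tensor M) (f \<otimes> g)"
      using f g by simp
    show "Sym (arrow_tensor M) f g \<in> hom (arrow_cat M) (f \<otimes> g) (g \<otimes> f)"
      using f g sym_nat[of f g] by (simp add: arrow_tensor_def squareI)
  next
    fix f f' f'' g g' g'' s s' t t'
    assume s: "s \<in> hom (arrow_cat M) f f'" "s' \<in> hom (arrow_cat M) f' f''"
      and t: "t \<in> hom (arrow_cat M) g g'" "t' \<in> hom (arrow_cat M) g' g''"
    show "(s' \<cdot>\<^bsub>arrow_tensor M\<^esub> s) \<otimes>\<^bsub>arrow_tensor M\<^esub> (t' \<cdot>\<^bsub>arrow_tensor M\<^esub> t) =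
      (s' \<otimes>\<^bsub>arrow_tensor M\<^esub> t') \<cdot>\<^bsub>arrow_tensor M\<^esub> (s \<otimes>\<^bsub>arrow_tensor M\<^esub> t)"
      using squareD(2-9)[OF s(1)] squareD(2-9)[OF s(2)] squareD(2-9)[OF t(1)] squareD(2-9)[OF t(2)]
      by simp
  qed (simp_all add: arrow_tensor_hom del: arrow_tensor_simps(8))
qed

end

context pointed_monoidal
begin

subsection \<open>The cokernel is strong monoidal\<close>

lemma epi_cancel:
  assumes "is_epi M c" "k \<in> Arr M" "l \<in> Arr M" "Dom M k = Cod M c" "Dom M l = Cod M c" "k \<cdot> c = l \<cdot> c"
  shows "k = l"
proof -
  have c: "c \<in> Arr M" using assms(1) by (simp add: is_epi_def)
  have "Cod M (k \<cdot> c) = Cod M (l \<cdot> c)" by (simp only: assms(6))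
  then have "Cod M k = Cod M l" using assms(2-5) c by simp
  then show ?thesis
    using assms unfolding is_epi_def by blast
qed

text \<open>Composing with the legs, an arrow \<open>h\<close> that kills the pushout product kills
  \<open>f\<close> tensored with \<open>Cod M g\<close> and \<open>Cod M f\<close> tensored with
  \<open>g\<close>. By the first it factors through \<open>cf \<otimes> Ident M (Cod M g)\<close> as
  \<open>k\<close>. By the second, \<open>k\<close> kills
  \<open>Ident M (Cod M cf) \<otimes> g\<close> and so factors further through
  \<open>Ident M (Cod M cf) \<otimes> cg\<close>.\<close>

lemma is_coker_box:
  assumes cf: "is_coker M f cf" and cg: "is_coker M g cg"
  shows "is_coker M (pushout_product M f g) (cf \<otimes> cg)"
proof -
  note F = is_cokerD[OF cf] and G = is_cokerD[OF cg]
  let ?fg = "pushout_product M f g"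
  have arr: "?fg \<in> Arr M" "Cod M ?fg = Cod M f \<otimes>\<^sub>o Cod M g"
    using F G by simp_all
  \<comment> \<open>On the left leg the factor \<open>cf \<cdot> f\<close> vanishes, on the right
    leg the factor \<open>cg \<cdot> g\<close>.\<close>
  have zero: "(cf \<otimes> cg) \<cdot> ?fg = zero_arr M (Dom M ?fg) (Cod M cf \<otimes>\<^sub>o Cod M cg)"
    by (rule box_eqI[of f g]) (use F G in simp_all)
  have "\<exists>!k. k \<in> hom M (Cod M (cf \<otimes> cg)) (Cod M h) \<and> k \<cdot> (cf \<otimes> cg) = h"
    if h: "h \<in> Arr M" "Dom M h = Cod M ?fg" "h \<cdot> ?fg = zero_arr M (Dom M ?fg) (Cod M h)" for h
  proof -
    have "h \<cdot> (f \<otimes> Ident M (Cod M g)) = (h \<cdot> ?fg) \<cdot> box_inl M f g"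
      using F G h(1,2) by simp
    also have "\<dots> = zero_arr M (Dom M f \<otimes>\<^sub>o Cod M g) (Cod M h)"
      unfolding h(3) using F G h(1,2) by simp
    finally have hl: "h \<cdot> (f \<otimes> Ident M (Cod M g)) = zero_arr M (Dom M f \<otimes>\<^sub>o Cod M g) (Cod M h)" .
    have "h \<cdot> (Ident M (Cod M f) \<otimes> g) = (h \<cdot> ?fg) \<cdot> box_inr M f g"
      using F G h(1,2) by simp
    also have "\<dots> = zero_arr M (Cod M f \<otimes>\<^sub>o Dom M g) (Cod M h)"
      unfolding h(3) using F G h(1,2) by simp
    finally have hr: "h \<cdot> (Ident M (Cod M f) \<otimes> g) = zero_arr M (Cod M f \<otimes>\<^sub>o Dom M g) (Cod M h)" .
    obtain k where k: "k \<in> Arr M" "Dom M k = Cod M (cf \<otimes> Ident M (Cod M g))" "Cod M k = Cod M h"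
      "k \<cdot> (cf \<otimes> Ident M (Cod M g)) = h"
      by (rule is_coker_factor[OF is_coker_tensor(2)[OF cf, of "Cod M g"], of h]) (use F G h(1,2) hl in auto)
    \<comment> \<open>Precomposed with the epimorphism
      \<open>cf \<otimes> Ident M (Dom M g)\<close>, this is the vanishing of \<open>h\<close> on
      \<open>Ident M (Cod M f) \<otimes> g\<close>.\<close>
    have kz: "k \<cdot> (Ident M (Cod M cf) \<otimes> g) = zero_arr M (Cod M cf \<otimes>\<^sub>o Dom M g) (Cod M h)"
    proof (rule epi_cancel)
      show "is_epi M (cf \<otimes> Ident M (Dom M g))"
        using is_coker_epi[OF is_coker_tensor(2)[OF cf, of "Dom M g"]] G by simp
      have "(k \<cdot> (Ident M (Cod M cf) \<otimes> g)) \<cdot> (cf \<otimes> Ident M (Dom M g)) =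
          (k \<cdot> (cf \<otimes> Ident M (Cod M g))) \<cdot> (Ident M (Cod M f) \<otimes> g)"
        using F G k(1-3) by simp
      also have "\<dots> = zero_arr M (Cod M cf \<otimes>\<^sub>o Dom M g) (Cod M h) \<cdot> (cf \<otimes> Ident M (Dom M g))"
        unfolding k(4) hr using F G h(1) by simp
      finally show "(k \<cdot> (Ident M (Cod M cf) \<otimes> g)) \<cdot> (cf \<otimes> Ident M (Dom M g)) =
        zero_arr M (Cod M cf \<otimes>\<^sub>o Dom M g) (Cod M h) \<cdot> (cf \<otimes> Ident M (Dom M g))" .
    qed (use F G k(1-3) h(1) in simp_all)
    obtain l where l: "l \<in> Arr M" "Dom M l = Cod M (Ident M (Cod M cf) \<otimes> cg)" "Cod M l = Cod M k"
      "l \<cdot> (Ident M (Cod M cf) \<otimes> cg) = k"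
      by (rule is_coker_factor[OF is_coker_tensor(1)[OF cg, of "Cod M cf"], of k]) (use F G k(1-3) kz in auto)
    \<comment> \<open>Dividing in two steps, first by \<open>f\<close> and then by \<open>g\<close>,
      shows that \<open>l\<close> factors \<open>h\<close> and, by cancelling two epimorphisms in
      turn, that \<open>l\<close> is the only such arrow.\<close>
    have split: "m \<cdot> (cf \<otimes> cg) = (m \<cdot> (Ident M (Cod M cf) \<otimes> cg)) \<cdot> (cf \<otimes> Ident M (Cod M g))"
      if "m \<in> Arr M" "Dom M m = Cod M cf \<otimes>\<^sub>o Cod M cg" for m
      using F G that by simp
    have "l \<cdot> (cf \<otimes> cg) = h"
      using split[of l] l k(4) F G by (simp only: l(4)) simp
    moreover have "m = l" if m: "m \<in> hom M (Cod M (cf \<otimes> cg)) (Cod M h)" "m \<cdot> (cf \<otimes> cg) = h" for m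
    proof -
      have m': "m \<in> Arr M" "Dom M m = Cod M cf \<otimes>\<^sub>o Cod M cg"
        using m F G by (simp_all add: hom_def)
      have "m \<cdot> (Ident M (Cod M cf) \<otimes> cg) = k"
      proof (rule epi_cancel[OF is_coker_epi[OF is_coker_tensor(2)[OF cf, of "Cod M g"]]])
        show "(m \<cdot> (Ident M (Cod M cf) \<otimes> cg)) \<cdot> (cf \<otimes> Ident M (Cod M g)) = k \<cdot> (cf \<otimes> Ident M (Cod M g))"
          unfolding split[OF m', symmetric] k(4) by (rule m(2))
      qed (use F G k(1-3) m' in simp_all)
      then have "m \<cdot> (Ident M (Cod M cf) \<otimes> cg) = l \<cdot> (Ident M (Cod M cf) \<otimes> cg)"
        by (simp only: l(4))
      then show ?thesis
        by (rule epi_cancel[OF is_coker_epi[OF is_coker_tensor(1)[OF cg, of "Cod M cf"]], rotated -1])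
          (use m' l(1,2) F G in simp_all)
    qed
    moreover have "l \<in> hom M (Cod M (cf \<otimes> cg)) (Cod M h)"
      using l(1-3) k(3) F G by (simp add: hom_def)
    ultimately show ?thesis by blast
  qed
  then show ?thesis
    using arr zero F G by (simp add: is_coker_def)
qed

text \<open>An arrow out of an initial object is zero, so dividing by it changes nothing. This puts
  the unit of the tensor structure and all \<open>L0 x\<close> among the cokernels.\<close>

lemma is_coker_ident:
  assumes x: "x \<in> Obj M"
  shows "is_coker M (L1_obj M x) (Ident M x)"
proof -
  have "L1_obj M x = zero_arr M (init_obj M) x"
    by (rule initial_eqI[OF initial_init]) (use x in simp_all)
  moreover have "\<exists>!k. k \<in> hom M x (Cod M h) \<and> k \<cdot> Ident M x = h" if "h \<in> Arr M" "Dom M h = x" for h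
  proof (intro ex1I conjI)
    show "h \<in> hom M x (Cod M h)" "h \<cdot> Ident M x = h"
      using that by (simp_all add: hom_def)
    show "k = h" if "k \<in> hom M x (Cod M h) \<and> k \<cdot> Ident M x = h" for k
      using that comp_ident_right by metis
  qed
  ultimately show ?thesis
    using x L1_obj[OF x] by (simp add: is_coker_def)
qed

text \<open>Two cokernels of one arrow factor through each other, and both composites are identities
  because cokernels are epi. Hence \<open>is_coker_box\<close> and \<open>is_coker_ident\<close>
  make \<open>coker_delta\<close> and \<open>coker_L1\<close> invertible.\<close>

lemma coker_copair_iso:
  assumes c: "is_coker M f c"
  shows "is_iso M (coker_copair M f c)"
proof -
  note C = is_cokerD[OF c]
  let ?k = "coker_copair M f c" and ?d = "coker_obj M f"
  note D = coker_obj[OF C(1)]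
  note k = coker_copair[OF C(1,2,3,4)]
  obtain l where l: "l \<in> Arr M" "Dom M l = Cod M c" "Cod M l = Cod M ?d" "l \<cdot> c = ?d"
    by (rule is_coker_factor[OF c D(1)]) (use C(1) in simp_all)
  have "l \<cdot> ?k = Ident M (Cod M ?d)"
  proof (rule epi_cancel[OF epi_coker_obj[OF C(1)]])
    show "(l \<cdot> ?k) \<cdot> ?d = Ident M (Cod M ?d) \<cdot> ?d"
      using D(1) k l by simp
  qed (use D(1) k(1-3) l(1-3) in simp_all)
  moreover have "?k \<cdot> l = Ident M (Cod M c)"
  proof (rule epi_cancel[OF is_coker_epi[OF c]])
    show "(?k \<cdot> l) \<cdot> c = Ident M (Cod M c) \<cdot> c"
      using C(2) k l by simp
  qed (use C(2) k(1-3) l(1-3) in simp_all)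
  ultimately show ?thesis
    unfolding is_iso_def inverse_arrows_def using k(1-3) l(1-3)
    by (intro exI[of _ l]) (simp add: hom_def)
qed

text \<open>The comparison maps of \<open>coker\<close> are inverses of \<open>coker_delta\<close>
  and \<open>coker_L1\<close>; this keeps their projections identities.\<close>

lemma inverse_square:
  assumes s: "s \<in> hom (arrow_cat M) f g" and x: "Sq0 s = Ident M x" "x \<in> Obj M" and iso: "is_iso M (Sq1 s)"
  shows "inverse_of (arrow_tensor M) s \<in> hom (arrow_cat M) g f"
    and "Sq0 (inverse_of (arrow_tensor M) s) = Ident M x"
proof -
  interpret N: category "arrow_tensor M" by (rule category_arrow_tensor)
  note S = squareD[OF s]
  have "inverse_arrows M (Ident M x) (Ident M x)"
    using x(2) by (simp add: inverse_arrows_def hom_def)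
  then have "is_iso M (Sq0 s)"
    unfolding x(1) is_iso_def by blast
  then have "is_iso (arrow_tensor M) s"
    using square_iso[OF s _ iso] by (simp add: is_iso_def inverse_arrows_arrow)
  then have inv: "inverse_arrows (arrow_cat M) s (inverse_of (arrow_tensor M) s)"
    using N.inverse_arrows_inverse_of by (simp add: inverse_arrows_arrow)
  let ?t = "inverse_of (arrow_tensor M) s"
  show t: "?t \<in> hom (arrow_cat M) g f"
    using inv S(11,12) by (simp add: inverse_arrows_def)
  have dom: "Dom M f = x"
    using S(5) x by simp
  have "Sq0 ?t \<cdot> Ident M x = Ident M x"
    using inv S(11) x dom by (simp add: inverse_arrows_def)
  moreover have "Sq0 ?t \<cdot> Ident M x = Sq0 ?t"
    using squareD[OF t] S(5,6) x by simp
  ultimately show "Sq0 ?t = Ident M x" by simp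
qed

lemma coker_delta_hom:
  assumes f: "f \<in> Arr M" and g: "g \<in> Arr M"
  shows "coker_delta M f g \<in>
      hom (arrow_cat M) (coker_obj M (pushout_product M f g)) (coker_obj M f \<otimes> coker_obj M g)"
    and "Sq0 (coker_delta M f g) = Ident M (Cod M f \<otimes>\<^sub>o Cod M g)"
    and "is_iso M (Sq1 (coker_delta M f g))"
proof -
  have c: "is_coker M (pushout_product M f g) (coker_obj M f \<otimes> coker_obj M g)"
    using f g is_coker_coker_obj by (intro is_coker_box)
  note k = coker_copair[OF is_cokerD[OF c]]
  show "coker_delta M f g \<in>
      hom (arrow_cat M) (coker_obj M (pushout_product M f g)) (coker_obj M f \<otimes> coker_obj M g)"
    using f g k unfolding coker_delta_def by (intro squareI) simp_all
  show "Sq0 (coker_delta M f g) = Ident M (Cod M f \<otimes>\<^sub>o Cod M g)"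
    by (simp add: coker_delta_def)
  show "is_iso M (Sq1 (coker_delta M f g))"
    using coker_copair_iso[OF c] by (simp add: coker_delta_def)
qed

lemma coker_L1_hom:
  assumes x: "x \<in> Obj M"
  shows "coker_L1 M x \<in> hom (arrow_cat M) (coker_obj M (L1_obj M x)) (Ident M x)"
    and "Sq0 (coker_L1 M x) = Ident M x"
    and "is_iso M (Sq1 (coker_L1 M x))"
proof -
  note c = is_coker_ident[OF x]
  note k = coker_copair[OF is_cokerD[OF c]]
  show "coker_L1 M x \<in> hom (arrow_cat M) (coker_obj M (L1_obj M x)) (Ident M x)"
    using x k unfolding coker_L1_def by (intro squareI) simp_all
  show "Sq0 (coker_L1 M x) = Ident M x"
    by (simp add: coker_L1_def)
  show "is_iso M (Sq1 (coker_L1 M x))"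
    using coker_copair_iso[OF c] by (simp add: coker_L1_def)
qed

lemma coker_mu:
  assumes f: "f \<in> Arr M" and g: "g \<in> Arr M"
  shows "LMu (coker M) f g \<in>
      hom (arrow_cat M) (coker_obj M f \<otimes> coker_obj M g) (coker_obj M (pushout_product M f g))"
    and "Sq0 (LMu (coker M) f g) = Ident M (Cod M f \<otimes>\<^sub>o Cod M g)"
  using f g inverse_square[OF coker_delta_hom(1,2)[OF f g] _ coker_delta_hom(3)[OF f g]]
  by (simp_all add: coker_def)

lemma coker_L1_inv:
  assumes x: "x \<in> Obj M"
  shows "inverse_of (arrow_tensor M) (coker_L1 M x) \<in> hom (arrow_cat M) (Ident M x) (coker_obj M (L1_obj M x))"
    and "Sq0 (inverse_of (arrow_tensor M) (coker_L1 M x)) = Ident M x"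
  using inverse_square[OF coker_L1_hom(1,2)[OF x] x coker_L1_hom(3)[OF x]] .

text \<open>\<open>Sq1\<close> of this adjoint transpose is \<open>Sq0\<close> of two counits
  tensored and composed with \<open>coker_delta\<close>, times an identity of the unit; all of these
  are identities.\<close>

lemma ker_mu:
  assumes f: "f \<in> Arr M" and g: "g \<in> Arr M"
  shows "LMu (ker M) f g \<in>
      hom (arrow_cat M) (pushout_product M (ker_obj M f) (ker_obj M g)) (ker_obj M (f \<otimes> g))"
    and "Sq1 (LMu (ker M) f g) = Ident M (Dom M f \<otimes>\<^sub>o Dom M g)"
proof -
  let ?k = "pushout_product M (ker_obj M f) (ker_obj M g)"
  have kf: "ker_obj M f \<in> Arr M" "ker_obj M g \<in> Arr M"
    using f g by simp_all
  have "(coker_ker_counit M f \<otimes>\<^bsub>arrow_tensor M\<^esub> coker_ker_counit M g)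
      \<cdot>\<^bsub>arrow_cat M\<^esub> coker_delta M (ker_obj M f) (ker_obj M g) \<in> hom (arrow_cat M) (coker_obj M ?k) (f \<otimes> g)"
    by (rule square_comp[OF coker_delta_hom(1)[OF kf] arrow_tensor_hom[OF counit_hom[OF f] counit_hom[OF g]]])
  from square_comp[OF unit_hom[of ?k] ker_map_hom[OF this]]
  show "LMu (ker M) f g \<in> hom (arrow_cat M) ?k (ker_obj M (f \<otimes> g))"
    using kf by (simp add: ker_def)
  show "Sq1 (LMu (ker M) f g) = Ident M (Dom M f \<otimes>\<^sub>o Dom M g)"
    using f g coker_delta_hom(2)[OF kf] by (simp add: ker_def)
qed

text \<open>Serves twice: for the monoidal unit as \<open>LEps (ker M)\<close>, and for each entry
  of \<open>P\<close> as the operad map behind \<open>ker_Alg\<close>. Dually,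
  \<open>coker_L1_inv\<close> serves both purposes for \<open>coker\<close>.\<close>

lemma ker_L0:
  assumes x: "x \<in> Obj M"
  shows "ker_map M (coker_L1 M x) \<cdot>\<^bsub>arrow_box M\<^esub> coker_ker_unit M (L1_obj M x) \<in>
      hom (arrow_cat M) (L1_obj M x) (ker_obj M (Ident M x))"
    and "Sq1 (ker_map M (coker_L1 M x) \<cdot>\<^bsub>arrow_box M\<^esub> coker_ker_unit M (L1_obj M x)) = Ident M x"
  using square_comp[OF unit_hom[of "L1_obj M x"] ker_map_hom[OF coker_L1_hom(1)[OF x]]] x
    coker_L1_hom(2)[OF x]
  by simp_all


section \<open>The projections to \<open>M\<close>\<close>

lemma strict_box: "strict_functor (arrow_box M) M (Cod M) Sq1"
proof -
  interpret N: tensor_category "arrow_box M" by (rule tensor_category_box)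
  interpret T: tensor_category M by (rule tensor_category_axioms)
  show ?thesis
  proof (unfold_locales, unfold hom_arrow)
    show "Sq1 s \<in> hom M (Cod M a) (Cod M b)" if "s \<in> hom (arrow_cat M) a b" for s a b
      using squareD[OF that] by (simp add: hom_def)
    show "Sq1 (s \<otimes>\<^bsub>arrow_box M\<^esub> t) = Sq1 s \<otimes> Sq1 t" for s t
      by (simp add: arrow_box_def)
  qed (auto simp: arrow_box_def)
qed

lemma strict_tensor: "strict_functor (arrow_tensor M) M (Dom M) Sq0"
proof -
  interpret N: tensor_category "arrow_tensor M" by (rule tensor_category_tensor)
  interpret T: tensor_category M by (rule tensor_category_axioms)
  show ?thesis
  proof (unfold_locales, unfold hom_arrow)
    show "Sq0 s \<in> hom M (Dom M a) (Dom M b)" if "s \<in> hom (arrow_cat M) a b" for s a b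
      using squareD[OF that] by (simp add: hom_def)
  qed (auto simp: arrow_tensor_def)
qed

text \<open>Lets \<open>M\<close> count as a category over itself, the starting point from which
  \<open>L0\<close> and \<open>L1\<close> push the operad \<open>P\<close>.\<close>

lemma strict_id: "strict_functor M M (\<lambda>x. x) (\<lambda>s. s)"
proof -
  interpret T: tensor_category M by (rule tensor_category_axioms)
  show ?thesis by unfold_locales auto
qed

text \<open>Both legs start at initial objects, so arrows out of the pushout exist and are unique.
  This makes \<open>LMu (L1 M)\<close> well defined although the chosen pushout may differ from the
  chosen initial object.\<close>

lemma initial_L1_box:
  assumes x: "x \<in> Obj M" and y: "y \<in> Obj M"
  shows "is_initial M (Dom M (pushout_product M (L1_obj M x) (L1_obj M y)))"
proof -
  let ?f = "L1_obj M x" and ?g = "L1_obj M y"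
  have i1: "is_initial M (init_obj M \<otimes>\<^sub>o z)" and i2: "is_initial M (z \<otimes>\<^sub>o init_obj M)"
    if "z \<in> Obj M" for z
    using that tensor_right_initial tensor_left_initial initial_init by auto
  have "\<exists>!u. u \<in> hom M (Dom M (pushout_product M ?f ?g)) z" if z: "z \<in> Obj M" for z
  proof -
    let ?p = "the_arr M (init_obj M \<otimes>\<^sub>o y) z" and ?q = "the_arr M (x \<otimes>\<^sub>o init_obj M) z"
    have pq: "?p \<in> Arr M" "Dom M ?p = init_obj M \<otimes>\<^sub>o y" "Cod M ?p = z"
      "?q \<in> Arr M" "Dom M ?q = x \<otimes>\<^sub>o init_obj M" "Cod M ?q = z"
      using i1[OF y] i2[OF x] z by simp_all
    have "?p \<cdot> (Ident M (Dom M ?f) \<otimes> ?g) = ?q \<cdot> (?f \<otimes> Ident M (Dom M ?g))"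
      by (rule initial_eqI[OF i1[of "init_obj M"]]) (use pq x y in simp_all)
    then have "box_copair M ?f ?g ?p ?q \<in> hom M (Dom M (pushout_product M ?f ?g)) z"
      using box_copair[of ?f ?g ?p ?q] pq x y by (simp add: hom_def)
    moreover have "u = v"
      if uv: "u \<in> hom M (Dom M (pushout_product M ?f ?g)) z" "v \<in> hom M (Dom M (pushout_product M ?f ?g)) z"
      for u v
    proof (rule box_eqI[of ?f ?g])
      show "u \<cdot> box_inl M ?f ?g = v \<cdot> box_inl M ?f ?g"
        by (rule initial_eqI[OF i1[OF y]]) (use uv x y in \<open>simp_all add: hom_def\<close>)
      show "u \<cdot> box_inr M ?f ?g = v \<cdot> box_inr M ?f ?g"
        by (rule initial_eqI[OF i2[OF x]]) (use uv x y in \<open>simp_all add: hom_def\<close>)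
    qed (use uv x y in \<open>simp_all add: hom_def\<close>)
    ultimately show ?thesis by blast
  qed
  then show ?thesis
    using x y by (simp add: is_initial_def)
qed

section \<open>The embeddings, the cokernel and the kernel as lax functors over the base
  category\<close>

lemma lax_L1: "lax_over M (arrow_box M) M (\<lambda>x. x) (\<lambda>s. s) (Cod M) Sq1 (L1 M)"
proof -
  interpret S1: strict_functor M M "\<lambda>x. x" "\<lambda>s. s" by (rule strict_id)
  interpret S2: strict_functor "arrow_box M" M "Cod M" Sq1 by (rule strict_box)
  interpret A: category "arrow_cat M" by (rule category_arrow_cat)
  have L1_sq: "Square (L1_obj M a) (L1_obj M b) (Ident M (init_obj M)) m \<in>
      hom (arrow_cat M) (L1_obj M a) (L1_obj M b)" if m: "m \<in> hom M a b" for m a b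
  proof (rule squareI)
    have ab: "m \<in> Arr M" "Dom M m = a" "Cod M m = b" "a \<in> Obj M" "b \<in> Obj M"
      using homD[OF m] by auto
    show "L1_obj M b \<cdot> Ident M (init_obj M) = m \<cdot> L1_obj M a"
      by (rule initial_eqI[OF initial_init]) (use ab in simp_all)
  qed (use homD[OF m] in simp_all)
  show ?thesis
  proof (unfold_locales, unfold hom_arrow)
    show "Fa (L1 M) m \<in> hom (arrow_cat M) (Fo (L1 M) a) (Fo (L1 M) b)" if "m \<in> hom M a b" for m a b
      using L1_sq[OF that] homD[OF that] by (simp add: L1_def)
    show "LMu (L1 M) x y \<in> hom (arrow_cat M) (Fo (L1 M) x \<otimes>\<^sub>o\<^bsub>arrow_box M\<^esub> Fo (L1 M) y) (Fo (L1 M) (x \<otimes>\<^sub>o y))"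
      if x: "x \<in> Obj M" and y: "y \<in> Obj M" for x y
    proof -
      let ?f = "pushout_product M (L1_obj M x) (L1_obj M y)" and ?g = "L1_obj M (x \<otimes>\<^sub>o y)"
      let ?u = "the_arr M (Dom M ?f) (init_obj M)"
      note i = initial_L1_box[OF x y]
      have u: "?u \<in> Arr M" "Dom M ?u = Dom M ?f" "Cod M ?u = init_obj M"
        using i by simp_all
      have "?g \<cdot> ?u = Ident M (x \<otimes>\<^sub>o y) \<cdot> ?f"
        by (rule initial_eqI[OF i]) (use x y u in simp_all)
      then have "Square ?f ?g ?u (Ident M (x \<otimes>\<^sub>o y)) \<in> hom (arrow_cat M) ?f ?g"
        using x y u by (intro squareI) simp_all
      then show ?thesis by (simp add: L1_def)
    qed
    show "LEps (L1 M) \<in> hom (arrow_cat M) (Unit (arrow_box M)) (Fo (L1 M) (Unit M))"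
      using A.ident_hom[of "L1_obj M (Unit M)"] by (simp add: L1_def)
    show "Fa (L1 M) (m \<cdot> l) = Fa (L1 M) m \<cdot>\<^bsub>arrow_box M\<^esub> Fa (L1 M) l"
      if "l \<in> hom M a b" "m \<in> hom M b c" for l m a b c
      using that homD[OF that(1)] homD[OF that(2)] by (simp add: L1_def)
  qed (simp_all add: L1_def)
qed

lemma lax_L0: "lax_over M (arrow_tensor M) M (\<lambda>x. x) (\<lambda>s. s) (Dom M) Sq0 (L0 M)"
proof -
  interpret S1: strict_functor M M "\<lambda>x. x" "\<lambda>s. s" by (rule strict_id)
  interpret S2: strict_functor "arrow_tensor M" M "Dom M" Sq0 by (rule strict_tensor)
  interpret A: category "arrow_cat M" by (rule category_arrow_cat)
  show ?thesis
  proof (unfold_locales, unfold hom_arrow)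
    show "Fa (L0 M) m \<in> hom (arrow_cat M) (Fo (L0 M) a) (Fo (L0 M) b)" if "m \<in> hom M a b" for m a b
      using homD[OF that] by (auto simp: L0_def)
    show "LMu (L0 M) x y \<in> hom (arrow_cat M) (Fo (L0 M) x \<otimes>\<^sub>o\<^bsub>arrow_tensor M\<^esub> Fo (L0 M) y) (Fo (L0 M) (x \<otimes>\<^sub>o y))"
      if "x \<in> Obj M" "y \<in> Obj M" for x y
      using that by (simp add: L0_def squareI)
    show "LEps (L0 M) \<in> hom (arrow_cat M) (Unit (arrow_tensor M)) (Fo (L0 M) (Unit M))"
      using A.ident_hom[of "Ident M (Unit M)"] by (simp add: L0_def)
    show "Fa (L0 M) (m \<cdot> l) = Fa (L0 M) m \<cdot>\<^bsub>arrow_tensor M\<^esub> Fa (L0 M) l"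
      if "l \<in> hom M a b" "m \<in> hom M b c" for l m a b c
      using homD[OF that(1)] homD[OF that(2)] by (simp add: L0_def)
  qed (simp_all add: L0_def)
qed

lemma lax_coker: "lax_over (arrow_box M) (arrow_tensor M) M (Cod M) Sq1 (Dom M) Sq0 (coker M)"
proof -
  interpret S1: strict_functor "arrow_box M" M "Cod M" Sq1 by (rule strict_box)
  interpret S2: strict_functor "arrow_tensor M" M "Dom M" Sq0 by (rule strict_tensor)
  interpret L: is_functor "arrow_box M" "arrow_tensor M" "coker M" by (rule functor_coker)
  have Fs: "Fo (coker M) = coker_obj M" "Fa (coker M) = coker_map M"
      "LEps (coker M) = inverse_of (arrow_tensor M) (coker_L1 M (Unit M))"
    by (simp_all add: coker_def)
  show ?thesis
    by (unfold_locales, unfold hom_arrow Fs)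
      (simp_all add: coker_mu coker_L1_inv)
qed

lemma lax_ker: "lax_over (arrow_tensor M) (arrow_box M) M (Dom M) Sq0 (Cod M) Sq1 (ker M)"
proof -
  interpret S1: strict_functor "arrow_tensor M" M "Dom M" Sq0 by (rule strict_tensor)
  interpret S2: strict_functor "arrow_box M" M "Cod M" Sq1 by (rule strict_box)
  interpret L: is_functor "arrow_tensor M" "arrow_box M" "ker M" by (rule functor_ker)
  have Fs: "Fo (ker M) = ker_obj M" "Fa (ker M) = ker_map M"
      "LEps (ker M) = ker_map M (coker_L1 M (Unit M)) \<cdot>\<^bsub>arrow_box M\<^esub> coker_ker_unit M (L1_obj M (Unit M))"
    by (simp_all add: ker_def)
  show ?thesis
    by (unfold_locales, unfold hom_arrow Fs)
      (simp_all add: ker_mu ker_L0 del: arrow_box_simps(6))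
qed

section \<open>Operads and algebras in the two arrow categories\<close>

context
  fixes C :: "'c set" and P :: "('c, 'o, 'm) operad"
  assumes P: "colored_operad M C P"
begin

interpretation P: colored_operad M C P by (rule P)

lemma strict_operad_id: "strict_operad_functor M M (\<lambda>x. x) (\<lambda>s. s) C P P"
proof -
  interpret S: strict_functor M M "\<lambda>x. x" "\<lambda>s. s" by (rule strict_id)
  interpret typed_operad M C P by (rule P.typed_operad_axioms)
  show ?thesis by unfold_locales auto
qed

lemma reflecting_box:
  "reflecting_functor (arrow_box M) M (Cod M) Sq1 C (operad_box M P) P (Arr M) {f. is_mono M f}"
proof -
  interpret L: lax_over M "arrow_box M" M "\<lambda>x. x" "\<lambda>s. s" "Cod M" Sq1 "L1 M" by (rule lax_L1)
  interpret O: strict_operad_functor "arrow_box M" M "Cod M" Sq1 C "operad_box M P" P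
    unfolding operad_box_def by (rule L.push_operad_over[OF strict_operad_id])
  show ?thesis
  proof (unfold_locales, unfold hom_arrow)
    show "Ent (operad_box M P) d cs \<in> Arr M" if "d \<in> C" "cs \<in> lists C" for d cs
      using O.Q.ent_obj[OF that] by simp
    show "s = t" if "s \<in> hom (arrow_cat M) a b" "t \<in> hom (arrow_cat M) a b" "b \<in> {f. is_mono M f}"
      "Sq1 s = Sq1 t" for s t a b
      using that by (intro square_eq_mono) auto
  qed simp_all
qed

text \<open>Closure of the cokernels under \<open>\<otimes>\<close> is \<open>is_coker_box\<close>;
  the unit and the operad entries are identities, covered by \<open>is_coker_ident\<close>.\<close>

lemma reflecting_tensor:
  "reflecting_functor (arrow_tensor M) M (Dom M) Sq0 C (operad_tensor M P) P
    {c. \<exists>k. is_coker M k c} (Arr M)"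
proof -
  interpret L: lax_over M "arrow_tensor M" M "\<lambda>x. x" "\<lambda>s. s" "Dom M" Sq0 "L0 M" by (rule lax_L0)
  interpret O: strict_operad_functor "arrow_tensor M" M "Dom M" Sq0 C "operad_tensor M P" P
    unfolding operad_tensor_def by (rule L.push_operad_over[OF strict_operad_id])
  show ?thesis
  proof (unfold_locales, unfold hom_arrow)
    show "{c. \<exists>k. is_coker M k c} \<subseteq> Obj (arrow_tensor M)"
      using is_cokerD(2) by auto
    show "a \<otimes>\<^sub>o\<^bsub>arrow_tensor M\<^esub> b \<in> {c. \<exists>k. is_coker M k c}"
      if "a \<in> {c. \<exists>k. is_coker M k c}" "b \<in> {c. \<exists>k. is_coker M k c}" for a b
    proof -
      obtain k l where "is_coker M k a" "is_coker M l b"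
        using \<open>a \<in> _\<close> \<open>b \<in> _\<close> by blast
      then show ?thesis
        using is_coker_box[of k a l b] by auto
    qed
    show "Unit (arrow_tensor M) \<in> {c. \<exists>k. is_coker M k c}"
      using is_coker_ident[OF unit_obj] by auto
    show "Ent (operad_tensor M P) d cs \<in> {c. \<exists>k. is_coker M k c}" if "d \<in> C" "cs \<in> lists C" for d cs
      using is_coker_ident[OF P.ent_obj[OF that]] by (auto simp: operad_tensor_def push_operad_def L0_def)
    show "s = t" if "s \<in> hom (arrow_cat M) a b" "t \<in> hom (arrow_cat M) a b"
      "a \<in> {c. \<exists>k. is_coker M k c}" "Sq0 s = Sq0 t" for s t a b
      using that is_coker_epi by (intro square_eq_epi) auto
  qed
qed

lemma algebra_functor_coker:
  "algebra_functor (arrow_box M) (arrow_tensor M) M (Cod M) Sq1 (Dom M) Sq0 (coker M) C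
    (operad_box M P) (operad_tensor M P) P {c. \<exists>k. is_coker M k c} (Arr M)
    (\<lambda>d cs. inverse_of (arrow_tensor M) (coker_L1 M (Ent P d cs)))"
proof -
  interpret L: lax_over "arrow_box M" "arrow_tensor M" M "Cod M" Sq1 "Dom M" Sq0 "coker M"
    by (rule lax_coker)
  interpret O1: reflecting_functor "arrow_box M" M "Cod M" Sq1 C "operad_box M P" P "Arr M" "{f. is_mono M f}"
    by (rule reflecting_box)
  interpret O2: reflecting_functor "arrow_tensor M" M "Dom M" Sq0 C "operad_tensor M P" P
      "{c. \<exists>k. is_coker M k c}" "Arr M"
    by (rule reflecting_tensor)
  show ?thesis
  proof (unfold_locales, unfold hom_arrow)
    fix d cs assume d: "d \<in> C" "cs \<in> lists C"
    show "inverse_of (arrow_tensor M) (coker_L1 M (Ent P d cs)) \<in>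
        hom (arrow_cat M) (Ent (operad_tensor M P) d cs) (Fo (coker M) (Ent (operad_box M P) d cs))"
      "Sq0 (inverse_of (arrow_tensor M) (coker_L1 M (Ent P d cs))) = Ident M (Ent P d cs)"
      using coker_L1_inv[OF P.ent_obj[OF d]]
      by (simp_all add: operad_tensor_def operad_box_def push_operad_def L0_def L1_def coker_def)
  next
    show "Fo (coker M) x \<in> {c. \<exists>k. is_coker M k c} \<inter> Arr M" if "x \<in> Obj (arrow_box M)" for x
      using that is_coker_coker_obj by (auto simp: coker_def)
  qed
qed

lemma algebra_functor_ker:
  "algebra_functor (arrow_tensor M) (arrow_box M) M (Dom M) Sq0 (Cod M) Sq1 (ker M) C
    (operad_tensor M P) (operad_box M P) P (Arr M) {f. is_mono M f}
    (\<lambda>d cs. ker_map M (coker_L1 M (Ent P d cs)) \<cdot>\<^bsub>arrow_box M\<^esub> coker_ker_unit M (L1_obj M (Ent P d cs)))"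
proof -
  interpret L: lax_over "arrow_tensor M" "arrow_box M" M "Dom M" Sq0 "Cod M" Sq1 "ker M"
    by (rule lax_ker)
  interpret O1: reflecting_functor "arrow_tensor M" M "Dom M" Sq0 C "operad_tensor M P" P
      "{c. \<exists>k. is_coker M k c}" "Arr M"
    by (rule reflecting_tensor)
  interpret O2: reflecting_functor "arrow_box M" M "Cod M" Sq1 C "operad_box M P" P "Arr M" "{f. is_mono M f}"
    by (rule reflecting_box)
  show ?thesis
  proof (unfold_locales, unfold hom_arrow)
    fix d cs assume d: "d \<in> C" "cs \<in> lists C"
    show "ker_map M (coker_L1 M (Ent P d cs)) \<cdot>\<^bsub>arrow_box M\<^esub> coker_ker_unit M (L1_obj M (Ent P d cs)) \<in>
        hom (arrow_cat M) (Ent (operad_box M P) d cs) (Fo (ker M) (Ent (operad_tensor M P) d cs))"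
      "Sq1 (ker_map M (coker_L1 M (Ent P d cs)) \<cdot>\<^bsub>arrow_box M\<^esub> coker_ker_unit M (L1_obj M (Ent P d cs))) =
        Ident M (Ent P d cs)"
      using ker_L0[OF P.ent_obj[OF d]]
      by (simp_all add: operad_tensor_def operad_box_def push_operad_def L0_def L1_def ker_def
          del: arrow_box_simps(6))
  next
    show "Fo (ker M) x \<in> Arr M \<inter> {f. is_mono M f}" if "x \<in> Obj (arrow_tensor M)" for x
      using that mono_ker_obj by (auto simp: ker_def)
  qed
qed

text \<open>By \<open>T_Str_push\<close>, applied once in each direction, going forth and back
  leaves the projected structure maps unchanged. As the components of unit and counit project to
  identities, both are homomorphisms by \<open>is_alg_arr_identI\<close>.\<close>

lemma adjunction_algebras:
  "adjunction (Alg_box M C P) (Alg_tensor M C P) (coker_Alg M C P) (ker_Alg M C P)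
    (unit_Alg M C P) (counit_Alg M C P)"
proof -
  interpret K: algebra_functor "arrow_box M" "arrow_tensor M" M "Cod M" Sq1 "Dom M" Sq0 "coker M" C
    "operad_box M P" "operad_tensor M P" P "{c. \<exists>k. is_coker M k c}" "Arr M"
    "\<lambda>d cs. inverse_of (arrow_tensor M) (coker_L1 M (Ent P d cs))"
    by (rule algebra_functor_coker)
  interpret R: algebra_functor "arrow_tensor M" "arrow_box M" M "Dom M" Sq0 "Cod M" Sq1 "ker M" C
    "operad_tensor M P" "operad_box M P" P "Arr M" "{f. is_mono M f}"
    "\<lambda>d cs. ker_map M (coker_L1 M (Ent P d cs)) \<cdot>\<^bsub>arrow_box M\<^esub> coker_ker_unit M (L1_obj M (Ent P d cs))"
    by (rule algebra_functor_ker)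
  have Fs: "Fo (coker M) = coker_obj M" "Fo (ker M) = ker_obj M"
    by (simp_all add: coker_def ker_def)
  have unit: "is_alg_arr (arrow_box M) C (operad_box M P)
      \<lparr>ADom = A, ACod = R.push (K.push A), AMap = (\<lambda>c\<in>C. coker_ker_unit M (Car A c))\<rparr>"
    if A: "is_algebra (arrow_box M) C (operad_box M P) A" for A
  proof (rule R.O2.is_alg_arr_identI[OF A R.push_algebra[OF K.push_algebra[OF A]]])
    fix c assume c: "c \<in> C"
    have a: "Car A c \<in> Arr M"
      using K.O1.Q.algebraD(4)[OF A c] by simp
    have car: "Car (R.push (K.push A)) c = ker_obj M (coker_obj M (Car A c))"
      using R.Car_push[OF K.push_algebra[OF A] c] K.Car_push[OF A c] by (simp add: Fs)
    show "(\<lambda>c\<in>C. coker_ker_unit M (Car A c)) c \<in> hom (arrow_box M) (Car A c) (Car (R.push (K.push A)) c)"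
      unfolding hom_arrow car restrict_apply'[OF c] using a by (rule unit_hom)
    show "Sq1 ((\<lambda>c\<in>C. coker_ker_unit M (Car A c)) c) = Ident M (Cod M (Car A c))"
      using c by simp
    show "Car A c \<in> Arr M" by fact
    show "Car (R.push (K.push A)) c \<in> {f. is_mono M f}"
      using R.Car_push_EF(2)[OF K.push_algebra[OF A] c] .
  next
    show "Sq1 (Str A d cs) = Sq1 (Str (R.push (K.push A)) d cs)" if "d \<in> C" "cs \<in> lists C" for d cs
      using R.T_Str_push[OF K.push_algebra[OF A] that] K.T_Str_push[OF A that] by simp
  qed simp
  have counit: "is_alg_arr (arrow_tensor M) C (operad_tensor M P)
      \<lparr>ADom = K.push (R.push B), ACod = B, AMap = (\<lambda>c\<in>C. coker_ker_counit M (Car B c))\<rparr>"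
    if B: "is_algebra (arrow_tensor M) C (operad_tensor M P) B" for B
  proof (rule K.O2.is_alg_arr_identI[OF K.push_algebra[OF R.push_algebra[OF B]] B])
    fix c assume c: "c \<in> C"
    have b: "Car B c \<in> Arr M"
      using K.O2.Q.algebraD(4)[OF B c] by simp
    have car: "Car (K.push (R.push B)) c = coker_obj M (ker_obj M (Car B c))"
      using K.Car_push[OF R.push_algebra[OF B] c] R.Car_push[OF B c] by (simp add: Fs)
    show "(\<lambda>c\<in>C. coker_ker_counit M (Car B c)) c \<in> hom (arrow_tensor M) (Car (K.push (R.push B)) c) (Car B c)"
      unfolding hom_arrow car restrict_apply'[OF c] using b by (rule counit_hom)
    show "Sq0 ((\<lambda>c\<in>C. coker_ker_counit M (Car B c)) c) = Ident M (Dom M (Car (K.push (R.push B)) c))"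
      unfolding car restrict_apply'[OF c] using b by simp
    show "Car B c \<in> Arr M" by fact
    show "Car (K.push (R.push B)) c \<in> {c. \<exists>k. is_coker M k c}"
      using K.Car_push_EF(1)[OF R.push_algebra[OF B] c] .
  next
    show "Sq0 (Str (K.push (R.push B)) d cs) = Sq0 (Str B d cs)" if "d \<in> C" "cs \<in> lists C" for d cs
      using K.T_Str_push[OF R.push_algebra[OF B] that] R.T_Str_push[OF B that] by simp
  qed simp
  have u: "unit_Alg M C P = (\<lambda>A. \<lparr>ADom = A, ACod = R.push (K.push A),
      AMap = (\<lambda>c\<in>C. coker_ker_unit M (Car A c))\<rparr>)"
    and c: "counit_Alg M C P = (\<lambda>B. \<lparr>ADom = K.push (R.push B), ACod = B,
      AMap = (\<lambda>c\<in>C. coker_ker_counit M (Car B c))\<rparr>)"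
    by (simp_all add: fun_eq_iff unit_Alg_def counit_Alg_def coker_Alg_def ker_Alg_def Alg_fctr_def)
  show ?thesis
    unfolding u c coker_Alg_def ker_Alg_def
    by (rule adjunction_Alg[OF adjunction_coker_ker K.O1.Q.typed_operad_axioms
          K.O2.Q.typed_operad_axioms K.is_functor_Alg R.is_functor_Alg refl refl unit counit])
qed

end

end

theorem theorem3p4p2:
  fixes M :: "('o, 'm) monoidal"
    and C :: "'c set"
    and P :: "('c, 'o, 'm) operad"
  assumes "symmetric_monoidal M"
    and "complete_cat TYPE('i::infinite) M"
    and "cocomplete_cat TYPE('i) M"
    and "pointed M"
    and "tensor_preserves_colimits TYPE('i) M"
    and "colored_operad M C P"
  shows "adjunction (arrow_box M) (arrow_tensor M) (coker M) (ker M)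
           (coker_ker_unit M) (coker_ker_counit M) \<and>
         adjunction (Alg_box M C P) (Alg_tensor M C P) (coker_Alg M C P) (ker_Alg M C P)
           (unit_Alg M C P) (counit_Alg M C P)"
proof -
  interpret pointed_monoidal M
    using assms(1-5) by (rule pointed_monoidalI)
  show ?thesis
    using adjunction_coker_ker adjunction_algebras[OF assms(6)] by blast
qed

end
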